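(* Let $(B_m,g_B)$ be a scalar flat compact Riemannian manifold of dimension $m$ and $(F_k,g_F)$ a pseudo-Riemannian manifold of dimension $k\ge 1$. Suppose that $\mu\in\mathbb{R}\setminus\{0,1,k,\overline{\mu}_+,\overline{\mu}_-\}$, where $\overline{\mu}_\pm$ are the numbers defined in the context. Let $\psi\in C^\infty_{>0}(B)$ and let $\lambda$ be a constant. Then $B\times F$ with the metric $\psi^{2\mu}g_B+\psi^2g_F$ is Einstein with $\lambda$ if and only if $(F_k,g_F)$ is Einstein with $\nu=0$, $\lambda=0$, $\psi$ is a positive constant (in particular, the product is a usual product), and $(B_m,g_B)$ is Ricci-flat.
   Context: A pseudo-Riemannian manifold $(N,h)$ is called Einstein with $\lambda\in C^\infty(N)$ if $\mathrm{Ric}_h=\lambda h$; "$(F,g_F)$ is Einstein with $\nu=0$" means $\mathrm{Ric}_{g_F}=0$. Scalar flat means scalar curvature identically zero (automatic if $m=1$). $C^\infty_{>0}(B)$ is the set of smooth positive functions on $B$; functions and metrics on the factors are identified with their pullbacks to $B\times F$. Manifolds are connected. The numbers $\overline{\mu}_\pm$ are the roots in $\mu$ of $\mu[(m-2)\mu+k]+k(\mu-1)=0$: for $m\ge3$, $\overline{\mu}_\pm=\overline{\mu}\pm\sqrt{\overline{\mu}^2-\overline{\mu}}$ with $\overline{\mu}=-\frac{k}{m-2}$; for $m=1$, $\overline{\mu}_\pm=k\mp\sqrt{k^2-k}$; for $m=2$ there is the single root $\tfrac12$. *)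

theory Defs
  imports "HOL-Analysis.Analysis"
begin

section \<open>Smooth maps between Euclidean spaces\<close>

text \<open>\<open>Ck_on n S f\<close>: on the open set \<open>S\<close>, all iterated directional derivatives of \<open>f\<close> of order
  at most \<open>n\<close> exist (as Frechet derivatives) and are continuous.\<close>

primrec Ck_on ::
  "nat \<Rightarrow> 'a::euclidean_space set \<Rightarrow> ('a \<Rightarrow> 'b::real_normed_vector) \<Rightarrow> bool" where
  "Ck_on 0 S f \<longleftrightarrow> continuous_on S f"
| "Ck_on (Suc n) S f \<longleftrightarrow>
     (\<forall>x\<in>S. f differentiable (at x)) \<and> (\<forall>v. Ck_on n S (\<lambda>x. frechet_derivative f (at x) v))"

definition smooth_on :: "'a::euclidean_space set \<Rightarrow> ('a \<Rightarrow> 'b::real_normed_vector) \<Rightarrow> bool" where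
  "smooth_on S f \<longleftrightarrow> (\<forall>n. Ck_on n S f)"

definition pderiv_at :: "'n::finite \<Rightarrow> (real^'n \<Rightarrow> real) \<Rightarrow> real^'n \<Rightarrow> real" where
  "pderiv_at i f x = frechet_derivative f (at x) (axis i 1)"


section \<open>Smooth manifolds\<close>

text \<open>Only the values of \<open>chart_map\<close> on \<open>chart_dom\<close> matter. The dimension is \<open>CARD('n)\<close>.\<close>

datatype ('p, 'n::finite) chart =
  Chart (chart_dom: "'p set") (chart_map: "'p \<Rightarrow> real^'n")

datatype ('p, 'n::finite) manifold =
  Manifold (mtop: "'p topology") (atlas: "('p, 'n) chart set")

abbreviation points :: "('p, 'n::finite) manifold \<Rightarrow> 'p set" where
  "points M \<equiv> topspace (mtop M)"

definition chart_img :: "('p, 'n::finite) chart \<Rightarrow> (real^'n) set" where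
  "chart_img c = chart_map c ` chart_dom c"

definition chart_inv :: "('p, 'n::finite) chart \<Rightarrow> real^'n \<Rightarrow> 'p" where
  "chart_inv c = inv_into (chart_dom c) (chart_map c)"

text \<open>Manifolds are nonempty and connected by convention. The atlas need not be maximal.\<close>

definition smooth_manifold :: "('p, 'n::finite) manifold \<Rightarrow> bool" where
  "smooth_manifold M \<longleftrightarrow>
     Hausdorff_space (mtop M) \<and> second_countable (mtop M) \<and>
     points M \<noteq> {} \<and> connected_space (mtop M) \<and>
     (\<Union>c\<in>atlas M. chart_dom c) = points M \<and>
     (\<forall>c\<in>atlas M. openin (mtop M) (chart_dom c) \<and> open (chart_img c) \<and>
        homeomorphic_map (subtopology (mtop M) (chart_dom c)) (top_of_set (chart_img c))
          (chart_map c)) \<and>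
     (\<forall>c\<in>atlas M. \<forall>d\<in>atlas M.
        smooth_on (chart_map c ` (chart_dom c \<inter> chart_dom d)) (chart_map d \<circ> chart_inv c))"

definition smooth_fun_on :: "('p, 'n::finite) manifold \<Rightarrow> 'p set \<Rightarrow> ('p \<Rightarrow> real) \<Rightarrow> bool" where
  "smooth_fun_on M W f \<longleftrightarrow>
     (\<forall>c\<in>atlas M. smooth_on (chart_map c ` (chart_dom c \<inter> W)) (f \<circ> chart_inv c))"

abbreviation smooth_fun :: "('p, 'n::finite) manifold \<Rightarrow> ('p \<Rightarrow> real) \<Rightarrow> bool" where
  "smooth_fun M \<equiv> smooth_fun_on M (points M)"

definition smooth_near :: "('p, 'n::finite) manifold \<Rightarrow> 'p \<Rightarrow> ('p \<Rightarrow> real) \<Rightarrow> bool" where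
  "smooth_near M p f \<longleftrightarrow> (\<exists>W. openin (mtop M) W \<and> p \<in> W \<and> smooth_fun_on M W f)"


section \<open>Tangent vectors\<close>

text \<open>A tangent vector at \<open>p\<close> is a derivation acting on functions that are smooth near \<open>p\<close>; as a
  HOL function it is made to vanish on all other functions, so that equality of tangent vectors
  is equality of HOL functions.\<close>

type_synonym 'p tangent = "('p \<Rightarrow> real) \<Rightarrow> real"

definition coord_vec ::
  "('p, 'n::finite) manifold \<Rightarrow> ('p, 'n) chart \<Rightarrow> 'p \<Rightarrow> 'n \<Rightarrow> 'p tangent" where
  "coord_vec M c p i =
     (\<lambda>f. if smooth_near M p f then pderiv_at i (f \<circ> chart_inv c) (chart_map c p) else 0)"

definition tangent_space :: "('p, 'n::finite) manifold \<Rightarrow> 'p \<Rightarrow> 'p tangent set" where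
  "tangent_space M p =
     {v. \<exists>c\<in>atlas M. p \<in> chart_dom c \<and>
           (\<exists>a::real^'n. v = (\<lambda>f. \<Sum>i\<in>UNIV. a $ i * coord_vec M c p i f))}"

text \<open>The tangent map at \<open>p\<close> of \<open>\<Phi>\<close>, a smooth map into \<open>N\<close>.\<close>

definition tangent_map ::
  "('q, 'n::finite) manifold \<Rightarrow> ('p \<Rightarrow> 'q) \<Rightarrow> 'p \<Rightarrow> 'p tangent \<Rightarrow> 'q tangent" where
  "tangent_map N \<Phi> p v = (\<lambda>f. if smooth_near N (\<Phi> p) f then v (f \<circ> \<Phi>) else 0)"


section \<open>Metrics\<close>

type_synonym 'p tensor2 = "'p \<Rightarrow> 'p tangent \<Rightarrow> 'p tangent \<Rightarrow> real"

definition components ::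
  "('p, 'n::finite) manifold \<Rightarrow> 'p tensor2 \<Rightarrow> ('p, 'n) chart \<Rightarrow> real^'n \<Rightarrow> real^'n^'n" where
  "components M g c x =
     (\<chi> i j. g (chart_inv c x) (coord_vec M c (chart_inv c x) i) (coord_vec M c (chart_inv c x) j))"

definition pseudo_riemannian :: "('p, 'n::finite) manifold \<Rightarrow> 'p tensor2 \<Rightarrow> bool" where
  "pseudo_riemannian M g \<longleftrightarrow>
     smooth_manifold M \<and>
     (\<forall>p\<in>points M.
        (\<forall>u\<in>tangent_space M p. \<forall>v\<in>tangent_space M p. \<forall>w\<in>tangent_space M p. \<forall>a b.
           g p (\<lambda>f. a * u f + b * v f) w = a * g p u w + b * g p v w) \<and>
        (\<forall>v\<in>tangent_space M p. \<forall>w\<in>tangent_space M p. g p v w = g p w v) \<and>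
        (\<forall>v\<in>tangent_space M p. (\<forall>w\<in>tangent_space M p. g p v w = 0) \<longrightarrow> v = (\<lambda>f. 0))) \<and>
     (\<forall>c\<in>atlas M. \<forall>i j. smooth_on (chart_img c) (\<lambda>x. components M g c x $ i $ j))"

definition riemannian :: "('p, 'n::finite) manifold \<Rightarrow> 'p tensor2 \<Rightarrow> bool" where
  "riemannian M g \<longleftrightarrow>
     pseudo_riemannian M g \<and>
     (\<forall>p\<in>points M. \<forall>v\<in>tangent_space M p. v \<noteq> (\<lambda>f. 0) \<longrightarrow> g p v v > 0)"


section \<open>Curvature\<close>

text \<open>In this section \<open>G\<close> is the matrix of components of a metric in a chart, as a function of
  the coordinates.\<close>

definition christoffel ::
  "(real^'n \<Rightarrow> real^'n^'n) \<Rightarrow> 'n::finite \<Rightarrow> 'n \<Rightarrow> 'n \<Rightarrow> real^'n \<Rightarrow> real" where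
  "christoffel G k i j x =
     1/2 * (\<Sum>l\<in>UNIV. matrix_inv (G x) $ k $ l *
       (pderiv_at i (\<lambda>y. G y $ l $ j) x + pderiv_at j (\<lambda>y. G y $ l $ i) x
        - pderiv_at l (\<lambda>y. G y $ i $ j) x))"

text \<open>\<open>riemann_coord G k l i j\<close> is the \<open>\<partial>\<^sub>k\<close>-component of \<open>R(\<partial>\<^sub>i, \<partial>\<^sub>j)\<partial>\<^sub>l\<close>, where
  \<open>R(X, Y) = [\<nabla>\<^sub>X, \<nabla>\<^sub>Y] - \<nabla>\<^bsub>[X, Y]\<^esub>\<close>.\<close>

definition riemann_coord ::
  "(real^'n \<Rightarrow> real^'n^'n) \<Rightarrow> 'n::finite \<Rightarrow> 'n \<Rightarrow> 'n \<Rightarrow> 'n \<Rightarrow> real^'n \<Rightarrow> real" where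
  "riemann_coord G k l i j x =
     pderiv_at i (christoffel G k j l) x - pderiv_at j (christoffel G k i l) x
     + (\<Sum>r\<in>UNIV. christoffel G k i r x * christoffel G r j l x
                 - christoffel G k j r x * christoffel G r i l x)"

definition ricci_coord :: "(real^'n \<Rightarrow> real^'n^'n) \<Rightarrow> real^'n \<Rightarrow> real^'n::finite^'n" where
  "ricci_coord G x = (\<chi> l j. \<Sum>k\<in>UNIV. riemann_coord G k l k j x)"

definition scalar_coord :: "(real^'n \<Rightarrow> real^'n::finite^'n) \<Rightarrow> real^'n \<Rightarrow> real" where
  "scalar_coord G x =
     (\<Sum>i\<in>UNIV. \<Sum>j\<in>UNIV. matrix_inv (G x) $ i $ j * ricci_coord G x $ i $ j)"

definition einstein :: "('p, 'n::finite) manifold \<Rightarrow> 'p tensor2 \<Rightarrow> ('p \<Rightarrow> real) \<Rightarrow> bool" where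
  "einstein M g lam \<longleftrightarrow>
     smooth_fun M lam \<and>
     (\<forall>c\<in>atlas M. \<forall>x\<in>chart_img c.
        ricci_coord (components M g c) x = lam (chart_inv c x) *\<^sub>R components M g c x)"

definition ricci_flat :: "('p, 'n::finite) manifold \<Rightarrow> 'p tensor2 \<Rightarrow> bool" where
  "ricci_flat M g \<longleftrightarrow>
     (\<forall>c\<in>atlas M. \<forall>x\<in>chart_img c. ricci_coord (components M g c) x = 0)"

definition scalar_flat :: "('p, 'n::finite) manifold \<Rightarrow> 'p tensor2 \<Rightarrow> bool" where
  "scalar_flat M g \<longleftrightarrow>
     (\<forall>c\<in>atlas M. \<forall>x\<in>chart_img c. scalar_coord (components M g c) x = 0)"


section \<open>Products\<close>

definition join_vec :: "real^'m::finite \<Rightarrow> real^'k::finite \<Rightarrow> real^('m + 'k)" where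
  "join_vec x y = (\<chi> s. case s of Inl i \<Rightarrow> x $ i | Inr j \<Rightarrow> y $ j)"

definition prod_chart ::
  "('p, 'm::finite) chart \<Rightarrow> ('q, 'k::finite) chart \<Rightarrow> ('p \<times> 'q, 'm + 'k) chart" where
  "prod_chart c d =
     Chart (chart_dom c \<times> chart_dom d) (\<lambda>(p, q). join_vec (chart_map c p) (chart_map d q))"

definition prod_manifold ::
  "('p, 'm::finite) manifold \<Rightarrow> ('q, 'k::finite) manifold \<Rightarrow> ('p \<times> 'q, 'm + 'k) manifold" where
  "prod_manifold M N =
     Manifold (prod_topology (mtop M) (mtop N)) {prod_chart c d |c d. c \<in> atlas M \<and> d \<in> atlas N}"

definition pullback ::
  "('q, 'n::finite) manifold \<Rightarrow> ('p \<Rightarrow> 'q) \<Rightarrow> 'q tensor2 \<Rightarrow> 'p tensor2" where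
  "pullback N \<Phi> h = (\<lambda>p v w. h (\<Phi> p) (tangent_map N \<Phi> p v) (tangent_map N \<Phi> p w))"

text \<open>The metric \<open>\<psi>\<^bsup>2\<mu>\<^esup> g\<^sub>B + \<psi>\<^bsup>2\<^esup> g\<^sub>F\<close> on \<open>B \<times> F\<close>.\<close>

definition bcwp_metric ::
  "('p, 'm::finite) manifold \<Rightarrow> 'p tensor2 \<Rightarrow> ('q, 'k::finite) manifold \<Rightarrow> 'q tensor2 \<Rightarrow>
   real \<Rightarrow> ('p \<Rightarrow> real) \<Rightarrow> ('p \<times> 'q) tensor2" where
  "bcwp_metric B gB F gF \<mu> \<psi> =
     (\<lambda>z v w. \<psi> (fst z) powr (2 * \<mu>) * pullback B fst gB z v w
            + (\<psi> (fst z))\<^sup>2 * pullback F snd gF z v w)"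


section \<open>The exceptional exponents\<close>

definition mubar :: "nat \<Rightarrow> nat \<Rightarrow> real" where
  "mubar m k = - real k / (real m - 2)"

definition mubar_plus :: "nat \<Rightarrow> nat \<Rightarrow> real" where
  "mubar_plus m k =
     (if m = 1 then real k - sqrt ((real k)\<^sup>2 - real k)
      else if m = 2 then 1/2
      else mubar m k + sqrt ((mubar m k)\<^sup>2 - mubar m k))"

definition mubar_minus :: "nat \<Rightarrow> nat \<Rightarrow> real" where
  "mubar_minus m k =
     (if m = 1 then real k + sqrt ((real k)\<^sup>2 - real k)
      else if m = 2 then 1/2
      else mubar m k - sqrt ((mubar m k)\<^sup>2 - mubar m k))"

lemma quadratic_root_iff:
  fixes b d \<mu> :: real
  assumes "b\<^sup>2 - d \<ge> 0"
  shows "\<mu>\<^sup>2 - 2 * b * \<mu> + d = 0 \<longleftrightarrow> \<mu> \<in> {b + sqrt (b\<^sup>2 - d), b - sqrt (b\<^sup>2 - d)}"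
proof -
  have "(\<mu> - (b + sqrt (b\<^sup>2 - d))) * (\<mu> - (b - sqrt (b\<^sup>2 - d))) = (\<mu> - b)\<^sup>2 - (sqrt (b\<^sup>2 - d))\<^sup>2"
    by (simp add: algebra_simps power2_eq_square)
  also have "\<dots> = \<mu>\<^sup>2 - 2 * b * \<mu> + d"
    using assms by (simp add: power2_eq_square algebra_simps)
  finally show ?thesis
    by (metis (no_types, lifting) eq_iff_diff_eq_0 insert_iff mult_eq_0_iff singletonD)
qed

lemma mubar_root_iff:
  assumes "m \<ge> 1" "k \<ge> 1"
  shows "\<mu> * ((real m - 2) * \<mu> + real k) + real k * (\<mu> - 1) = 0 \<longleftrightarrow>
         \<mu> \<in> {mubar_plus m k, mubar_minus m k}"
proof -
  consider "m = 1" | "m = 2" | "m \<ge> 3"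
    using assms by linarith
  then show ?thesis
  proof cases
    case 1
    have "(real k)\<^sup>2 - real k \<ge> 0"
      using assms by (simp add: power2_eq_square)
    from quadratic_root_iff[OF this, of \<mu>] show ?thesis
      using 1 by (auto simp: mubar_plus_def mubar_minus_def power2_eq_square algebra_simps)
  next
    case 2
    have "\<mu> * real k + real k * (\<mu> - 1) = real k * (2 * \<mu> - 1)"
      by (simp add: algebra_simps)
    then show ?thesis
      using 2 assms by (auto simp: mubar_plus_def mubar_minus_def)
  next
    case 3
    let ?b = "mubar m k"
    have neg: "?b < 0"
      using 3 assms by (simp add: mubar_def divide_neg_pos)
    then have "?b\<^sup>2 - ?b \<ge> 0"
      by (smt (verit) zero_le_power2)
    note root = quadratic_root_iff[OF this, of \<mu>]
    have k: "real k = - (real m - 2) * ?b"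
      using 3 by (simp add: mubar_def field_simps)
    have "\<mu> * ((real m - 2) * \<mu> + real k) + real k * (\<mu> - 1)
               = (real m - 2) * (\<mu>\<^sup>2 - 2 * ?b * \<mu> + ?b)"
      by (simp only: k) (simp add: algebra_simps power2_eq_square)
    then show ?thesis
      using root 3 by (simp add: mubar_plus_def mubar_minus_def)
  qed
qed

end

theory Submission
  imports Defs
begin

text \<open>Let \<open>m\<close> and \<open>k\<close> be the dimensions, \<open>f = ln \<psi>\<close> and \<open>\<eta> = (m - 2)\<mu> + k\<close>. The fibre part of the Einstein
  equation separates the variables: \<open>Ric\<^sub>F = \<nu> g\<^sub>F\<close>, where the constant \<open>\<nu>\<close> equals
  \<open>e\<^bsup>2f\<^esup> (\<lambda> + e\<^bsup>-2\<mu>f\<^esup> (\<Delta>f + \<eta>|df|\<^sup>2))\<close>. Since \<open>g\<^sub>B\<close> is scalar flat, the trace of the base part reads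
  \<open>-(\<eta> + m\<mu>)\<Delta>f = m\<lambda> e\<^bsup>2\<mu>f\<^esup>\<close> at critical points of \<open>f\<close>. As \<open>\<Delta>f\<close> has opposite signs at a maximum and at a
  minimum of \<open>f\<close>, this gives \<open>\<lambda> = 0\<close>, and then the formula for \<open>\<nu>\<close> gives \<open>\<nu> = 0\<close>. The remaining equation
  \<open>\<Delta>f + \<eta>|df|\<^sup>2 = 0\<close> is elliptic, so \<open>f\<close> is constant by the strong maximum principle.\<close>

section \<open>Partial derivatives\<close>

text \<open>The base equation is used only at critical points of \<open>f\<close>, because there
  every term containing \<open>df\<close> drops out and the trace involves nothing but the
  Laplacian. The signs at the maximum and at the minimum are compared by multiplying the two
  equations: the coefficient \<eta> + m\<mu> then occurs squared, so its own sign has no influence.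
  The constant \<nu> is bounded from both sides by evaluating it at the same two points. In the
  remaining equation the quadratic term \<eta>|df|^2 is read as a drift term whose coefficient is a
  multiple of the gradient of \<open>f\<close> itself; the equation thereby becomes linear in
  \<open>f\<close>, for either sign of \<eta>, and Hopf's argument applies. Every estimate is
  pointwise, so nothing is integrated over \<open>B\<close>. The strong maximum principle works
  inside one chart; connectedness of \<open>B\<close> carries its conclusion from chart to
  chart.\<close>

definition twice_diff_on :: "(real^'n) set \<Rightarrow> (real^'n::finite \<Rightarrow> real) \<Rightarrow> bool" where
  "twice_diff_on U f \<longleftrightarrow>
     (\<forall>x\<in>U. f differentiable at x \<and> (\<forall>i. pderiv_at i f differentiable at x))"

lemma pderiv_at_eq: "(f has_derivative D) (at x) \<Longrightarrow> pderiv_at i f x = D (axis i 1)"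
  unfolding pderiv_at_def by (metis frechet_derivative_at)

lemma has_derivative_frechet: "f differentiable at x \<Longrightarrow> (f has_derivative frechet_derivative f (at x)) (at x)"
  using frechet_derivative_works by blast

lemma frechet_derivative_pderiv_at:
  assumes "f differentiable at x"
  shows "frechet_derivative f (at x) v = (\<Sum>i\<in>UNIV. v $ i * pderiv_at i f x)"
proof -
  interpret linear "frechet_derivative f (at x)"
    using linear_frechet_derivative[OF assms] .
  have "v = (\<Sum>i\<in>UNIV. v $ i *\<^sub>R axis i 1)"
    using basis_expansion[of v] by (simp add: scalar_mult_eq_scaleR)
  then have "frechet_derivative f (at x) v = frechet_derivative f (at x) (\<Sum>i\<in>UNIV. v $ i *\<^sub>R axis i 1)"
    by metis
  also have "\<dots> = (\<Sum>i\<in>UNIV. v $ i * pderiv_at i f x)"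
    by (simp add: sum scale pderiv_at_def)
  finally show ?thesis .
qed

lemma has_derivative_pderiv_at:
  "f differentiable at x \<Longrightarrow> (f has_derivative (\<lambda>v. \<Sum>i\<in>UNIV. v $ i * pderiv_at i f x)) (at x)"
  using has_derivative_frechet[of f x] frechet_derivative_pderiv_at[of f x]
  by (metis (no_types, lifting) ext)

lemma has_derivative_iff_on_open:
  assumes "open U" "x \<in> U" "\<And>y. y \<in> U \<Longrightarrow> f y = g y"
  shows "(f has_derivative D) (at x) \<longleftrightarrow> (g has_derivative D) (at x)"
  using assms by (metis has_derivative_transform_within_open)

lemma frechet_derivative_cong_on_open:
  assumes "open U" "x \<in> U" "\<And>y. y \<in> U \<Longrightarrow> f y = g y"
  shows "frechet_derivative f (at x) = frechet_derivative g (at x)"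
  unfolding frechet_derivative_def using has_derivative_iff_on_open[OF assms] by simp

text \<open>Coordinate identities are available on open sets only, since components in a chart have
  no meaning outside the chart image. Locality of the derivative allows such identities to be
  differentiated.\<close>

lemma pderiv_at_cong_on_open:
  assumes "open U" "x \<in> U" "\<And>y. y \<in> U \<Longrightarrow> f y = g y"
  shows "pderiv_at i f x = pderiv_at i g x"
  unfolding pderiv_at_def using frechet_derivative_cong_on_open[OF assms] by simp

lemma differentiable_cong_on_open:
  assumes "open U" "x \<in> U" "\<And>y. y \<in> U \<Longrightarrow> f y = g y"
  shows "f differentiable at x \<longleftrightarrow> g differentiable at x"
  unfolding differentiable_def using has_derivative_iff_on_open[OF assms] by simp

lemma twice_diff_on_cong:
  assumes "open U" "\<And>y. y \<in> U \<Longrightarrow> f y = g y" "twice_diff_on U f"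
  shows "twice_diff_on U g"
  unfolding twice_diff_on_def
proof (intro ballI conjI allI)
  fix x i assume x: "x \<in> U"
  show "g differentiable at x"
    using assms x differentiable_cong_on_open[of U x f g] by (auto simp: twice_diff_on_def)
  have "pderiv_at i f y = pderiv_at i g y" if "y \<in> U" for y
    using pderiv_at_cong_on_open[of U y f g] assms that by blast
  then show "pderiv_at i g differentiable at x"
    using assms x differentiable_cong_on_open[of U x "pderiv_at i f" "pderiv_at i g"]
    by (auto simp: twice_diff_on_def)
qed

lemma twice_diff_onD:
  assumes "twice_diff_on U f" "x \<in> U"
  shows "f differentiable at x" "pderiv_at i f differentiable at x"
  using assms by (auto simp: twice_diff_on_def)

section \<open>Rules for partial derivatives\<close>

lemma pderiv_at_const [simp]: "pderiv_at i (\<lambda>x. c) x = 0"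
  by (simp add: pderiv_at_def)

lemma pderiv_at_component: "pderiv_at i (\<lambda>y. y $ j) x = (if i = j then 1 else 0)"
proof -
  have "((\<lambda>y::real^'a. y $ j) has_derivative (\<lambda>y. y $ j)) (at x)"
    by (simp add: bounded_linear_imp_has_derivative bounded_linear_vec_nth)
  from pderiv_at_eq[OF this, of i] show ?thesis by (simp add: axis_def)
qed

lemma
  assumes "f differentiable at x" "g differentiable at x"
  shows pderiv_at_add: "pderiv_at i (\<lambda>y. f y + g y) x = pderiv_at i f x + pderiv_at i g x"
    and pderiv_at_diff: "pderiv_at i (\<lambda>y. f y - g y) x = pderiv_at i f x - pderiv_at i g x"
    and pderiv_at_mult: "pderiv_at i (\<lambda>y. f y * g y) x = pderiv_at i f x * g x + f x * pderiv_at i g x"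
  using pderiv_at_eq[OF has_derivative_add[OF assms[THEN has_derivative_frechet]], of i]
    pderiv_at_eq[OF has_derivative_diff[OF assms[THEN has_derivative_frechet]], of i]
    pderiv_at_eq[OF has_derivative_mult[OF assms[THEN has_derivative_frechet]], of i]
  by (simp_all add: pderiv_at_def)

lemma pderiv_at_cmult:
  "f differentiable at x \<Longrightarrow> pderiv_at i (\<lambda>y. c * f y) x = c * pderiv_at i f x"
  using pderiv_at_mult[of "\<lambda>_. c" x f i] by simp

lemma pderiv_at_sum:
  assumes "\<And>s. s \<in> S \<Longrightarrow> f s differentiable at x"
  shows "pderiv_at i (\<lambda>y. \<Sum>s\<in>S. f s y) x = (\<Sum>s\<in>S. pderiv_at i (f s) x)"
proof -
  have "((\<lambda>y. \<Sum>s\<in>S. f s y) has_derivative (\<lambda>v. \<Sum>s\<in>S. frechet_derivative (f s) (at x) v)) (at x)"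
    by (rule has_derivative_sum) (rule has_derivative_frechet[OF assms])
  from pderiv_at_eq[OF this, of i] show ?thesis
    unfolding pderiv_at_def .
qed

lemma has_derivative_exp_compose:
  fixes f :: "real^'n::finite \<Rightarrow> real"
  assumes "f differentiable at x"
  shows "((\<lambda>y. exp (f y)) has_derivative (\<lambda>v. exp (f x) * frechet_derivative f (at x) v)) (at x)"
proof -
  have "((\<lambda>y. exp (f y)) has_derivative (\<lambda>v. frechet_derivative f (at x) v * exp (f x))) (at x)"
    by (rule DERIV_compose_FDERIV[OF DERIV_exp has_derivative_frechet[OF assms]])
  then show ?thesis by (simp add: mult.commute)
qed

lemma differentiable_exp_compose:
  fixes f :: "real^'n::finite \<Rightarrow> real"
  shows "f differentiable at x \<Longrightarrow> (\<lambda>y. exp (f y)) differentiable at x"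
  using has_derivative_exp_compose differentiableI by blast

lemma pderiv_at_exp:
  assumes "f differentiable at x"
  shows "pderiv_at i (\<lambda>y. exp (f y)) x = exp (f x) * pderiv_at i f x"
  using pderiv_at_eq[OF has_derivative_exp_compose[OF assms], of i] by (simp add: pderiv_at_def)

lemma pderiv_at_ln:
  fixes f :: "real^'n::finite \<Rightarrow> real"
  assumes "f differentiable at x" "f x > 0"
  shows "(\<lambda>y. ln (f y)) differentiable at x"
    and "pderiv_at i (\<lambda>y. ln (f y)) x = inverse (f x) * pderiv_at i f x"
proof -
  have "((\<lambda>y. ln (f y)) has_derivative (\<lambda>v. frechet_derivative f (at x) v * inverse (f x))) (at x)"
    by (rule DERIV_compose_FDERIV[OF DERIV_ln[OF assms(2)] has_derivative_frechet[OF assms(1)]])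
  from differentiableI[OF this] pderiv_at_eq[OF this, of i]
  show "(\<lambda>y. ln (f y)) differentiable at x"
    "pderiv_at i (\<lambda>y. ln (f y)) x = inverse (f x) * pderiv_at i f x"
    by (simp_all add: pderiv_at_def mult.commute)
qed

section \<open>Closure properties of twice differentiable functions\<close>

lemma twice_diff_on_const: "twice_diff_on U (\<lambda>_. c)"
  unfolding twice_diff_on_def by (simp add: pderiv_at_def[abs_def])

lemma twice_diff_on_add:
  assumes "open U" "twice_diff_on U f" "twice_diff_on U g"
  shows "twice_diff_on U (\<lambda>x. f x + g x)"
  unfolding twice_diff_on_def
proof (intro ballI conjI allI)
  fix x i assume x: "x \<in> U"
  note d = twice_diff_onD[OF assms(2)] twice_diff_onD[OF assms(3)]
  show "(\<lambda>x. f x + g x) differentiable at x"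
    using d x by simp
  have "(\<lambda>y. pderiv_at i f y + pderiv_at i g y) differentiable at x"
    using d x by simp
  then show "pderiv_at i (\<lambda>x. f x + g x) differentiable at x"
    using differentiable_cong_on_open[OF assms(1) x,
        of "pderiv_at i (\<lambda>x. f x + g x)" "\<lambda>y. pderiv_at i f y + pderiv_at i g y"]
      pderiv_at_add d by blast
qed

lemma twice_diff_on_mult:
  assumes "open U" "twice_diff_on U f" "twice_diff_on U g"
  shows "twice_diff_on U (\<lambda>x. f x * g x)"
  unfolding twice_diff_on_def
proof (intro ballI conjI allI)
  fix x i assume x: "x \<in> U"
  note d = twice_diff_onD[OF assms(2)] twice_diff_onD[OF assms(3)]
  show "(\<lambda>x. f x * g x) differentiable at x"
    using d x by simp
  have "(\<lambda>y. pderiv_at i f y * g y + f y * pderiv_at i g y) differentiable at x"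
    using d x by simp
  then show "pderiv_at i (\<lambda>x. f x * g x) differentiable at x"
    using differentiable_cong_on_open[OF assms(1) x,
        of "pderiv_at i (\<lambda>x. f x * g x)" "\<lambda>y. pderiv_at i f y * g y + f y * pderiv_at i g y"]
      pderiv_at_mult d by blast
qed

lemma twice_diff_on_cmult:
  "open U \<Longrightarrow> twice_diff_on U f \<Longrightarrow> twice_diff_on U (\<lambda>x. c * f x)"
  using twice_diff_on_mult[OF _ twice_diff_on_const] .

lemma twice_diff_on_exp:
  assumes "open U" "twice_diff_on U f"
  shows "twice_diff_on U (\<lambda>x. exp (f x))"
  unfolding twice_diff_on_def
proof (intro ballI conjI allI)
  fix x i assume x: "x \<in> U"
  note d = twice_diff_onD[OF assms(2)]
  show "(\<lambda>x. exp (f x)) differentiable at x"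
    using d x differentiable_exp_compose by blast
  have "(\<lambda>y. exp (f y) * pderiv_at i f y) differentiable at x"
    using d x differentiable_exp_compose[of f x] by simp
  then show "pderiv_at i (\<lambda>x. exp (f x)) differentiable at x"
    using differentiable_cong_on_open[OF assms(1) x,
        of "pderiv_at i (\<lambda>x. exp (f x))" "\<lambda>y. exp (f y) * pderiv_at i f y"]
      pderiv_at_exp d by blast
qed

lemma twice_diff_on_ln:
  assumes "open U" "twice_diff_on U f" "\<And>x. x \<in> U \<Longrightarrow> f x > 0"
  shows "twice_diff_on U (\<lambda>x. ln (f x))"
  unfolding twice_diff_on_def
proof (intro ballI conjI allI)
  fix x i assume x: "x \<in> U"
  note d = twice_diff_onD[OF assms(2)]
  show "(\<lambda>x. ln (f x)) differentiable at x"
    using d x assms(3) pderiv_at_ln by blast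
  have "(\<lambda>y. inverse (f y) * pderiv_at i f y) differentiable at x"
    using d x assms(3)[of x] by simp
  then show "pderiv_at i (\<lambda>x. ln (f x)) differentiable at x"
    using differentiable_cong_on_open[OF assms(1) x,
        of "pderiv_at i (\<lambda>x. ln (f x))" "\<lambda>y. inverse (f y) * pderiv_at i f y"]
      pderiv_at_ln(2) d assms(3) by blast
qed

text \<open>Curvature differentiates the metric entries twice, so this is the regularity that the
  coordinate computations work with; it passes through products, \<open>exp\<close> and
  \<open>ln\<close> without an induction on the order of differentiation.\<close>

lemma twice_diff_on_smooth:
  assumes "smooth_on U f"
  shows "twice_diff_on U f"
proof -
  have "Ck_on (Suc (Suc 0)) U f"
    using assms smooth_on_def by blast
  then show ?thesis
    by (auto simp: twice_diff_on_def pderiv_at_def[abs_def])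
qed

text \<open>The second difference quotient of \<open>f\<close> along \<open>u\<close> and \<open>v\<close> is, by the mean value theorem applied
  in direction \<open>u\<close>, a difference quotient of \<open>\<partial>\<^sub>u f\<close>, hence tends to \<open>\<partial>\<^sub>v \<partial>\<^sub>u f\<close>.\<close>

lemma second_difference_quotient:
  fixes f :: "real^'n::finite \<Rightarrow> real"
  assumes "open U" "x \<in> U" "twice_diff_on U f" "e > 0"
  shows "\<exists>d>0. \<forall>t. 0 < t \<and> t < d \<longrightarrow>
    \<bar>f (x + t *\<^sub>R axis i 1 + t *\<^sub>R axis j 1) - f (x + t *\<^sub>R axis i 1) - f (x + t *\<^sub>R axis j 1) + f x
      - t\<^sup>2 * pderiv_at j (pderiv_at i f) x\<bar> \<le> e * t\<^sup>2"
proof -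
  let ?u = "axis i 1 :: real^'n" and ?v = "axis j 1 :: real^'n" and ?h = "pderiv_at i f"
  let ?D = "frechet_derivative ?h (at x)"
  obtain r where r: "r > 0" "ball x r \<subseteq> U"
    using assms by (meson open_contains_ball)
  have "(?h has_derivative ?D) (at x)"
    using has_derivative_frechet twice_diff_onD(2)[OF assms(3,2)] by blast
  \<comment> \<open>Two such errors will be added, at points whose distances from \<open>x\<close>
    are at most \<open>2 * t\<close> and \<open>t\<close>; with \<open>e / 3\<close> they total
    \<open>e * t\<close>.\<close>
  then obtain d where d: "d > 0" and
    D: "\<And>y. norm (y - x) < d \<Longrightarrow> \<bar>?h y - ?h x - ?D (y - x)\<bar> \<le> e / 3 * norm (y - x)"
    unfolding has_derivative_at_alt using \<open>e > 0\<close>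
    by (metis zero_less_divide_iff zero_less_numeral real_norm_def)
  interpret D: linear ?D
    using linear_frechet_derivative[OF twice_diff_onD(2)[OF assms(3,2)]] .
  show ?thesis
  \<comment> \<open>Both points at which \<open>?h\<close> is compared lie within
    \<open>2 * t\<close> of \<open>x\<close>, which explains the factor 1/2.\<close>
  proof (intro exI[of _ "min d r / 2"] conjI allI impI)
    show "0 < min d r / 2"
      using d r by simp
    fix t assume t: "0 < t \<and> t < min d r / 2"
    let ?g = "\<lambda>s. f (x + s *\<^sub>R ?u + t *\<^sub>R ?v) - f (x + s *\<^sub>R ?u)"
    have n1: "norm (s *\<^sub>R ?u + t *\<^sub>R ?v) \<le> 2 * t" "norm (s *\<^sub>R ?u) \<le> t" if "0 \<le> s" "s \<le> t" for s
    proof -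
      show "norm (s *\<^sub>R ?u + t *\<^sub>R ?v) \<le> 2 * t"
        using norm_triangle_ineq[of "s *\<^sub>R ?u" "t *\<^sub>R ?v"] that by simp
      show "norm (s *\<^sub>R ?u) \<le> t"
        using that by simp
    qed
    have inU: "x + w \<in> U" if "norm w \<le> 2 * t" for w
      using that t r(2) by (auto simp: dist_norm subset_iff)
    have der: "((\<lambda>s. f (x + s *\<^sub>R ?u + w)) has_real_derivative ?h (x + s *\<^sub>R ?u + w)) (at s)"
      if "norm (s *\<^sub>R ?u + w) \<le> 2 * t" for s w
    proof -
      have fd: "f differentiable at (x + s *\<^sub>R ?u + w)"
        using twice_diff_onD(1)[OF assms(3)] inU[OF that] by (simp add: add.assoc)
      have l: "((\<lambda>s. x + s *\<^sub>R ?u + w) has_derivative (\<lambda>s. s *\<^sub>R ?u)) (at s)"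
        by (auto intro!: derivative_eq_intros)
      have "((\<lambda>s. f (x + s *\<^sub>R ?u + w)) has_derivative
          (\<lambda>s'. frechet_derivative f (at (x + s *\<^sub>R ?u + w)) (s' *\<^sub>R ?u))) (at s)"
        using has_derivative_compose[OF l has_derivative_frechet[OF fd]] .
      moreover have "frechet_derivative f (at (x + s *\<^sub>R ?u + w)) (s' *\<^sub>R ?u) = s' * ?h (x + s *\<^sub>R ?u + w)" for s'
        using linear_scale[OF linear_frechet_derivative[OF fd]] by (simp add: pderiv_at_def)
      ultimately show ?thesis
        by (simp add: has_field_derivative_def mult_commute_abs)
    qed
    have "\<exists>z. z > 0 \<and> z < t \<and> ?g t - ?g 0 = (t - 0) * (?h (x + z *\<^sub>R ?u + t *\<^sub>R ?v) - ?h (x + z *\<^sub>R ?u))"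
    proof (rule MVT2)
      show "0 < t" using t by simp
      fix s assume s: "0 \<le> s" "s \<le> t"
      have "((\<lambda>s. f (x + s *\<^sub>R ?u + t *\<^sub>R ?v) - f (x + s *\<^sub>R ?u + 0)) has_real_derivative
          (?h (x + s *\<^sub>R ?u + t *\<^sub>R ?v) - ?h (x + s *\<^sub>R ?u + 0))) (at s)"
        using n1[OF s] t by (intro DERIV_diff der) auto
      then show "(?g has_real_derivative (?h (x + s *\<^sub>R ?u + t *\<^sub>R ?v) - ?h (x + s *\<^sub>R ?u))) (at s)"
        by simp
    qed
    then obtain z where z: "0 < z" "z < t"
      and g: "?g t - ?g 0 = t * (?h (x + z *\<^sub>R ?u + t *\<^sub>R ?v) - ?h (x + z *\<^sub>R ?u))"
      by auto
    have nz: "norm (z *\<^sub>R ?u + t *\<^sub>R ?v) \<le> 2 * t" "norm (z *\<^sub>R ?u) \<le> t"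
      using n1 z by simp_all
    have "\<bar>?h (x + (z *\<^sub>R ?u + t *\<^sub>R ?v)) - ?h x - ?D (z *\<^sub>R ?u + t *\<^sub>R ?v)\<bar> \<le> e / 3 * norm (z *\<^sub>R ?u + t *\<^sub>R ?v)"
      using D[of "x + (z *\<^sub>R ?u + t *\<^sub>R ?v)"] nz t by simp
    also have "\<dots> \<le> e / 3 * (2 * t)"
      using nz \<open>e > 0\<close> by (intro mult_left_mono) auto
    finally have 1: "\<bar>?h (x + z *\<^sub>R ?u + t *\<^sub>R ?v) - ?h x - ?D (z *\<^sub>R ?u + t *\<^sub>R ?v)\<bar> \<le> e / 3 * (2 * t)"
      by (simp add: add.assoc)
    have "\<bar>?h (x + z *\<^sub>R ?u) - ?h x - ?D (z *\<^sub>R ?u)\<bar> \<le> e / 3 * norm (z *\<^sub>R ?u)"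
      using D[of "x + z *\<^sub>R ?u"] nz t by simp
    also have "\<dots> \<le> e / 3 * t"
      using nz \<open>e > 0\<close> by (intro mult_left_mono) auto
    finally have 2: "\<bar>?h (x + z *\<^sub>R ?u) - ?h x - ?D (z *\<^sub>R ?u)\<bar> \<le> e / 3 * t" .
    have "?D (z *\<^sub>R ?u + t *\<^sub>R ?v) - ?D (z *\<^sub>R ?u) = t * pderiv_at j ?h x"
      by (simp add: D.add D.scale pderiv_at_def[of j])
    with 1 2 have "\<bar>?h (x + z *\<^sub>R ?u + t *\<^sub>R ?v) - ?h (x + z *\<^sub>R ?u) - t * pderiv_at j ?h x\<bar> \<le> e * t"
      by (simp only: abs_le_iff) linarith
    then have "t * \<bar>?h (x + z *\<^sub>R ?u + t *\<^sub>R ?v) - ?h (x + z *\<^sub>R ?u) - t * pderiv_at j ?h x\<bar> \<le> t * (e * t)"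
      using t by (intro mult_left_mono) auto
    moreover have "t * \<bar>?h (x + z *\<^sub>R ?u + t *\<^sub>R ?v) - ?h (x + z *\<^sub>R ?u) - t * pderiv_at j ?h x\<bar>
        = \<bar>t * (?h (x + z *\<^sub>R ?u + t *\<^sub>R ?v) - ?h (x + z *\<^sub>R ?u) - t * pderiv_at j ?h x)\<bar>"
      using t by (simp add: abs_mult)
    moreover have "t * (?h (x + z *\<^sub>R ?u + t *\<^sub>R ?v) - ?h (x + z *\<^sub>R ?u) - t * pderiv_at j ?h x)
        = f (x + t *\<^sub>R ?u + t *\<^sub>R ?v) - f (x + t *\<^sub>R ?u) - f (x + t *\<^sub>R ?v) + f x - t\<^sup>2 * pderiv_at j ?h x"
      using g by (simp add: algebra_simps power2_eq_square)
    ultimately show "\<bar>f (x + t *\<^sub>R ?u + t *\<^sub>R ?v) - f (x + t *\<^sub>R ?u) - f (x + t *\<^sub>R ?v) + f x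
      - t\<^sup>2 * pderiv_at j ?h x\<bar> \<le> e * t\<^sup>2"
      by (simp add: power2_eq_square mult_ac)
  qed
qed

text \<open>Both mixed derivatives are limits of one and the same difference quotient, which is
  symmetric in \<open>i\<close> and \<open>j\<close>.\<close>

lemma pderiv_at_commute:
  assumes "open U" "x \<in> U" "twice_diff_on U f"
  shows "pderiv_at i (pderiv_at j f) x = pderiv_at j (pderiv_at i f) x"
proof -
  have "\<bar>pderiv_at i (pderiv_at j f) x - pderiv_at j (pderiv_at i f) x\<bar> \<le> 0 + e" if "e > 0" for e
  proof -
    have e2: "e / 2 > 0"
      using that by simp
    obtain d1 where d1: "d1 > 0" and *: "\<And>t. 0 < t \<Longrightarrow> t < d1 \<Longrightarrow> \<bar>f (x + t *\<^sub>R axis i 1 + t *\<^sub>R axis j 1) - f (x + t *\<^sub>R axis i 1)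
        - f (x + t *\<^sub>R axis j 1) + f x - t\<^sup>2 * pderiv_at j (pderiv_at i f) x\<bar> \<le> e / 2 * t\<^sup>2"
      using second_difference_quotient[OF assms e2, of i j] by blast
    obtain d2 where d2: "d2 > 0" and **: "\<And>t. 0 < t \<Longrightarrow> t < d2 \<Longrightarrow> \<bar>f (x + t *\<^sub>R axis j 1 + t *\<^sub>R axis i 1) - f (x + t *\<^sub>R axis j 1)
        - f (x + t *\<^sub>R axis i 1) + f x - t\<^sup>2 * pderiv_at i (pderiv_at j f) x\<bar> \<le> e / 2 * t\<^sup>2"
      using second_difference_quotient[OF assms e2, of j i] by blast
    define t where "t = min d1 d2 / 2"
    have t: "0 < t" "t < d1" "t < d2"
      using d1 d2 by (auto simp: t_def)
    have "x + t *\<^sub>R axis j 1 + t *\<^sub>R axis i 1 = x + t *\<^sub>R axis i 1 + t *\<^sub>R axis j 1"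
      by simp
    with *[OF t(1,2)] **[OF t(1,3)]
    have "\<bar>t\<^sup>2 * pderiv_at i (pderiv_at j f) x - t\<^sup>2 * pderiv_at j (pderiv_at i f) x\<bar> \<le> e / 2 * t\<^sup>2 + e / 2 * t\<^sup>2"
      by (simp only: abs_le_iff) linarith
    then have "t\<^sup>2 * \<bar>pderiv_at i (pderiv_at j f) x - pderiv_at j (pderiv_at i f) x\<bar> \<le> t\<^sup>2 * e"
      by (simp add: abs_mult right_diff_distrib[symmetric] mult.commute)
    then show ?thesis
      using t by simp
  qed
  then have "\<bar>pderiv_at i (pderiv_at j f) x - pderiv_at j (pderiv_at i f) x\<bar> \<le> 0"
    by (rule field_le_epsilon)
  then show ?thesis
    by simp
qed

section \<open>Inverse matrices\<close>

lemma det_differentiable: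
  fixes A :: "real^'a::finite \<Rightarrow> real^'n::finite^'n"
  assumes "\<And>i j. (\<lambda>x. A x $ i $ j) differentiable at a"
  shows "(\<lambda>x. det (A x)) differentiable at a"
proof -
  have p: "(\<lambda>x. \<Prod>i\<in>I. A x $ i $ p i) differentiable at a" if "finite I" for I p
    using that assms by (induction I rule: finite_induct) auto
  then show ?thesis
    unfolding det_def by (intro differentiable_sum) (auto intro!: differentiable_mult)
qed

lemma
  assumes "invertible (A::real^'n::finite^'n)"
  shows matrix_inv_right: "A ** matrix_inv A = mat 1"
    and matrix_inv_left: "matrix_inv A ** A = mat 1"
proof -
  have "\<exists>A'::real^'n^'n. A ** A' = mat 1 \<and> A' ** A = mat 1"
    using assms by (simp add: invertible_def)
  from someI_ex[OF this] show "A ** matrix_inv A = mat 1" "matrix_inv A ** A = mat 1"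
    by (simp_all add: matrix_inv_def)
qed

text \<open>Cramer's rule for the system with right-hand side \<open>axis l 1\<close>. It presents
  the entries of the inverse as quotients of determinants, from which their differentiability
  follows.\<close>

lemma matrix_inv_cramer:
  fixes A :: "real^'n::finite^'n"
  assumes "invertible A"
  shows "matrix_inv A $ k $ l = det (\<chi> i j. if j = k then axis l 1 $ i else A $ i $ j) / det A"
proof -
  have d: "det A \<noteq> 0"
    using assms invertible_det_nz by blast
  have "A *v (matrix_inv A *v axis l 1) = axis l 1"
    by (simp add: matrix_vector_mul_assoc matrix_inv_right[OF assms])
  then have "matrix_inv A *v axis l 1 = (\<chi> k. det (\<chi> i j. if j = k then axis l 1 $ i else A $ i $ j) / det A)"
    using cramer[OF d] by blast
  moreover have "(matrix_inv A *v axis l 1) $ k = matrix_inv A $ k $ l"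
    by (simp add: matrix_vector_mult_basis column_def)
  ultimately show ?thesis
    by simp
qed

lemma matrix_inv_differentiable:
  fixes A :: "real^'a::finite \<Rightarrow> real^'n::finite^'n"
  assumes "open U" "\<And>x. x \<in> U \<Longrightarrow> invertible (A x)" "a \<in> U"
    "\<And>i j. (\<lambda>x. A x $ i $ j) differentiable at a"
  shows "(\<lambda>x. matrix_inv (A x) $ k $ l) differentiable at a"
proof -
  have "(\<lambda>x. (\<chi> i j. if j = k then axis l 1 $ i else A x $ i $ j) $ i $ j) differentiable at a" for i j
    using assms(4)[of i j] by (cases "j = k") simp_all
  then have "(\<lambda>x. det (\<chi> i j. if j = k then axis l 1 $ i else A x $ i $ j) / det (A x)) differentiable at a"
    using assms(2)[OF assms(3)] invertible_det_nz[of "A a"]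
    by (simp add: differentiable_divide det_differentiable assms(4))
  moreover have "matrix_inv (A x) $ k $ l
      = det (\<chi> i j. if j = k then axis l 1 $ i else A x $ i $ j) / det (A x)" if "x \<in> U" for x
    by (rule matrix_inv_cramer[OF assms(2)[OF that]])
  ultimately show ?thesis
    using differentiable_cong_on_open[OF assms(1,3)] by (metis (no_types, lifting))
qed

lemma matrix_mult_eq_1_iff:
  "(A::real^'n::finite^'n) ** B = mat 1 \<longleftrightarrow> (\<forall>i j. (\<Sum>k\<in>UNIV. A $ i $ k * B $ k $ j) = (if i = j then 1 else 0))"
  by (simp add: vec_eq_iff matrix_matrix_mult_def mat_def)

text \<open>In finite dimension a one-sided inverse is two-sided, so exhibiting a right inverse
  suffices to compute \<open>matrix_inv\<close>.\<close>

lemma matrix_inv_eqI: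
  fixes A :: "real^'n::finite^'n"
  assumes "A ** B = mat 1"
  shows "invertible A" "matrix_inv A = B"
proof -
  have BA: "B ** A = mat 1"
    using assms matrix_left_right_inverse by blast
  show "invertible A"
    using assms BA invertible_def by blast
  from matrix_inv_right[OF this] have "(B ** A) ** matrix_inv A = B"
    by (simp add: matrix_mul_assoc[symmetric])
  then show "matrix_inv A = B"
    by (simp add: BA)
qed

lemma symmetric_matrix_inv:
  fixes A :: "real^'n::finite^'n"
  assumes "invertible A" "transpose A = A"
  shows "transpose (matrix_inv A) = matrix_inv A"
proof -
  have "A ** transpose (matrix_inv A) = mat 1"
    using matrix_transpose_mul[of "matrix_inv A" A] matrix_inv_left[OF assms(1)] assms(2)
    by (simp add: transpose_mat)
  from matrix_inv_eqI(2)[OF this] show ?thesis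
    by simp
qed

lemma
  fixes A :: "real^'n::finite^'n"
  assumes "invertible A" "c \<noteq> 0"
  shows invertible_scaleR: "invertible (c *\<^sub>R A)"
    and matrix_inv_scaleR: "matrix_inv (c *\<^sub>R A) = inverse c *\<^sub>R matrix_inv A"
proof -
  have "(c *\<^sub>R A) ** (inverse c *\<^sub>R matrix_inv A) = mat 1"
    using assms(2) matrix_inv_right[OF assms(1)]
    unfolding matrix_mult_eq_1_iff by (simp add: field_simps)
  from matrix_inv_eqI[OF this]
  show "invertible (c *\<^sub>R A)" "matrix_inv (c *\<^sub>R A) = inverse c *\<^sub>R matrix_inv A"
    by auto
qed

section \<open>Metrics on open sets of coordinate space\<close>

text \<open>Nondegenerate rather than positive, because the fibre and the product may be indefinite;
  positivity is added where a maximum principle is applied.\<close>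

definition metric_on :: "(real^'n) set \<Rightarrow> (real^'n::finite \<Rightarrow> real^'n^'n) \<Rightarrow> bool" where
  "metric_on U G \<longleftrightarrow> open U \<and> (\<forall>x\<in>U. invertible (G x) \<and> transpose (G x) = G x) \<and>
     (\<forall>i j. twice_diff_on U (\<lambda>x. G x $ i $ j))"

definition grad :: "(real^'n \<Rightarrow> real^'n^'n) \<Rightarrow> (real^'n \<Rightarrow> real) \<Rightarrow> 'n::finite \<Rightarrow> real^'n \<Rightarrow> real" where
  "grad G \<phi> k x = (\<Sum>l\<in>UNIV. matrix_inv (G x) $ k $ l * pderiv_at l \<phi> x)"

text \<open>The inner product of two gradients, written as one differential applied to the other
  gradient. With equal arguments it is the squared length of the gradient, of either sign if the
  metric is indefinite.\<close>

definition grad_prod ::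
  "(real^'n \<Rightarrow> real^'n^'n) \<Rightarrow> (real^'n \<Rightarrow> real) \<Rightarrow> (real^'n::finite \<Rightarrow> real) \<Rightarrow> real^'n \<Rightarrow> real" where
  "grad_prod G \<phi> \<theta> x = (\<Sum>k\<in>UNIV. pderiv_at k \<phi> x * grad G \<theta> k x)"

definition hess ::
  "(real^'n \<Rightarrow> real^'n^'n) \<Rightarrow> (real^'n \<Rightarrow> real) \<Rightarrow> 'n::finite \<Rightarrow> 'n \<Rightarrow> real^'n \<Rightarrow> real" where
  "hess G \<phi> i j x =
     pderiv_at i (pderiv_at j \<phi>) x - (\<Sum>k\<in>UNIV. christoffel G k i j x * pderiv_at k \<phi> x)"

definition laplacian :: "(real^'n \<Rightarrow> real^'n^'n) \<Rightarrow> (real^'n::finite \<Rightarrow> real) \<Rightarrow> real^'n \<Rightarrow> real" where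
  "laplacian G \<phi> x = (\<Sum>i\<in>UNIV. \<Sum>j\<in>UNIV. matrix_inv (G x) $ i $ j * hess G \<phi> i j x)"

lemma if_zero_mult:
  "(if b then x else 0) * y = (if b then x * y else (0::real))"
  "y * (if b then x else 0) = (if b then y * x else (0::real))"
  by auto

lemma transpose_eq_iff: "transpose (A::real^'n^'n) = A \<longleftrightarrow> (\<forall>i j. A $ i $ j = A $ j $ i)"
  by (auto simp: transpose_def vec_eq_iff)

lemma metric_onD:
  assumes "metric_on U G" "x \<in> U"
  shows "open U" "invertible (G x)" "G x $ i $ j = G x $ j $ i"
    "matrix_inv (G x) $ i $ j = matrix_inv (G x) $ j $ i"
    "(\<Sum>k\<in>UNIV. G x $ i $ k * matrix_inv (G x) $ k $ j) = (if i = j then 1 else 0)"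
    "(\<Sum>k\<in>UNIV. matrix_inv (G x) $ i $ k * G x $ k $ j) = (if i = j then 1 else 0)"
    "twice_diff_on U (\<lambda>x. G x $ i $ j)"
proof -
  show U: "open U" and i: "invertible (G x)" and "twice_diff_on U (\<lambda>x. G x $ i $ j)"
    using assms by (auto simp: metric_on_def)
  have t: "transpose (G x) = G x"
    using assms by (auto simp: metric_on_def)
  then show "G x $ i $ j = G x $ j $ i"
    by (metis transpose_eq_iff)
  show "matrix_inv (G x) $ i $ j = matrix_inv (G x) $ j $ i"
    using symmetric_matrix_inv[OF i t] by (metis transpose_eq_iff)
  show "(\<Sum>k\<in>UNIV. G x $ i $ k * matrix_inv (G x) $ k $ j) = (if i = j then 1 else 0)"
    using matrix_inv_right[OF i] unfolding matrix_mult_eq_1_iff by blast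
  show "(\<Sum>k\<in>UNIV. matrix_inv (G x) $ i $ k * G x $ k $ j) = (if i = j then 1 else 0)"
    using matrix_inv_left[OF i] unfolding matrix_mult_eq_1_iff by blast
qed

lemma metric_differentiable:
  assumes "metric_on U G" "x \<in> U"
  shows "(\<lambda>x. G x $ i $ j) differentiable at x"
    and "pderiv_at k (\<lambda>x. G x $ i $ j) differentiable at x"
    and "(\<lambda>x. matrix_inv (G x) $ i $ j) differentiable at x"
proof -
  note t = twice_diff_onD[OF metric_onD(7)[OF assms] assms(2)]
  show d: "(\<lambda>x. G x $ i $ j) differentiable at x" for i j
    by (rule t)
  show "pderiv_at k (\<lambda>x. G x $ i $ j) differentiable at x"
    by (rule t)
  show "(\<lambda>x. matrix_inv (G x) $ i $ j) differentiable at x"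
    by (rule matrix_inv_differentiable[OF metric_onD(1)[OF assms] metric_onD(2)[OF assms(1)] assms(2) d])
qed

section \<open>Christoffel symbols, gradient and divergence\<close>

lemma pderiv_at_metric_sym:
  assumes "metric_on U G" "x \<in> U"
  shows "pderiv_at k (\<lambda>x. G x $ i $ j) x = pderiv_at k (\<lambda>x. G x $ j $ i) x"
  by (rule pderiv_at_cong_on_open[OF metric_onD(1)[OF assms] assms(2) metric_onD(3)[OF assms(1)]])

lemma christoffel_sym:
  assumes "metric_on U G" "x \<in> U"
  shows "christoffel G k i j x = christoffel G k j i x"
  unfolding christoffel_def using pderiv_at_metric_sym[OF assms]
  by (intro arg_cong[where f="\<lambda>s. 1/2 * s"] sum.cong) auto

lemma metric_sum_inv_cancel:
  assumes "metric_on U G" "x \<in> U"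
  shows "(\<Sum>k\<in>UNIV. G x $ p $ k * (\<Sum>l\<in>UNIV. matrix_inv (G x) $ k $ l * w l)) = w p"
    and "(\<Sum>k\<in>UNIV. matrix_inv (G x) $ p $ k * (\<Sum>l\<in>UNIV. G x $ k $ l * w l)) = w p"
proof -
  have *: "(\<Sum>k\<in>UNIV. A p k * (\<Sum>l\<in>UNIV. C k l * w l)) = w p"
    if "\<And>l. (\<Sum>k\<in>UNIV. A p k * C k l) = (if p = l then 1 else 0)" for A C :: "'a \<Rightarrow> 'a \<Rightarrow> real"
  proof -
    have "(\<Sum>k\<in>UNIV. A p k * (\<Sum>l\<in>UNIV. C k l * w l)) = (\<Sum>l\<in>UNIV. (\<Sum>k\<in>UNIV. A p k * C k l) * w l)"
      unfolding sum_distrib_left sum_distrib_right by (subst sum.swap) (simp add: mult.assoc)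
    also have "\<dots> = w p"
      by (simp add: that if_zero_mult)
    finally show ?thesis .
  qed
  show "(\<Sum>k\<in>UNIV. G x $ p $ k * (\<Sum>l\<in>UNIV. matrix_inv (G x) $ k $ l * w l)) = w p"
    "(\<Sum>k\<in>UNIV. matrix_inv (G x) $ p $ k * (\<Sum>l\<in>UNIV. G x $ k $ l * w l)) = w p"
    using *[of "\<lambda>p k. G x $ p $ k" "\<lambda>k l. matrix_inv (G x) $ k $ l"]
      *[of "\<lambda>p k. matrix_inv (G x) $ p $ k" "\<lambda>k l. G x $ k $ l"]
      metric_onD(5,6)[OF assms] by auto
qed

text \<open>Cancelling the inverse metric in the definition leaves the Christoffel symbols of the
  first kind, from which metric compatibility can be read off.\<close>

lemma lower_christoffel:
  assumes "metric_on U G" "x \<in> U"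
  shows "(\<Sum>k\<in>UNIV. G x $ p $ k * christoffel G k i j x) =
    1/2 * (pderiv_at i (\<lambda>y. G y $ p $ j) x + pderiv_at j (\<lambda>y. G y $ p $ i) x
        - pderiv_at p (\<lambda>y. G y $ i $ j) x)"
  using metric_sum_inv_cancel(1)[OF assms, of p "\<lambda>l. pderiv_at i (\<lambda>y. G y $ l $ j) x +
      pderiv_at j (\<lambda>y. G y $ l $ i) x - pderiv_at l (\<lambda>y. G y $ i $ j) x"]
  unfolding christoffel_def
  by (simp add: mult.left_commute[of _ "1/2"] sum_distrib_left[symmetric] del: times_divide_eq_left mult_1)

text \<open>In the sum of the two symbols of the first kind the derivatives in the directions
  \<open>i\<close> and \<open>j\<close> cancel, and the derivative in direction \<open>k\<close>
  occurs twice with factor 1/2.\<close>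

lemma metric_compatible:
  assumes "metric_on U G" "x \<in> U"
  shows "pderiv_at k (\<lambda>y. G y $ i $ j) x =
    (\<Sum>r\<in>UNIV. christoffel G r k i x * G x $ r $ j) + (\<Sum>r\<in>UNIV. christoffel G r k j x * G x $ i $ r)"
proof -
  have "(\<Sum>r\<in>UNIV. christoffel G r k i x * G x $ r $ j) = (\<Sum>r\<in>UNIV. G x $ j $ r * christoffel G r k i x)"
    using metric_onD(3)[OF assms] by (metis (no_types, lifting) mult.commute)
  moreover have "(\<Sum>r\<in>UNIV. christoffel G r k j x * G x $ i $ r) = (\<Sum>r\<in>UNIV. G x $ i $ r * christoffel G r k j x)"
    by (simp add: mult.commute)
  ultimately show ?thesis
    unfolding lower_christoffel[OF assms]
    using pderiv_at_metric_sym[OF assms, of k j i] pderiv_at_metric_sym[OF assms, of i j k]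
      pderiv_at_metric_sym[OF assms, of j i k]
    by simp
qed

lemma christoffel_differentiable:
  assumes "metric_on U G" "x \<in> U"
  shows "christoffel G k i j differentiable at x"
proof -
  have "(\<lambda>x. 1/2 * (\<Sum>l\<in>UNIV. matrix_inv (G x) $ k $ l *
       (pderiv_at i (\<lambda>y. G y $ l $ j) x + pderiv_at j (\<lambda>y. G y $ l $ i) x
        - pderiv_at l (\<lambda>y. G y $ i $ j) x))) differentiable at x"
    by (intro differentiable_mult differentiable_const differentiable_sum ballI finite
        differentiable_diff differentiable_add metric_differentiable[OF assms])
  then show ?thesis
    unfolding christoffel_def[abs_def] .
qed

lemma grad_differentiable:
  assumes "metric_on U G" "x \<in> U" "twice_diff_on U \<phi>"
  shows "grad G \<phi> k differentiable at x"
  unfolding grad_def[abs_def]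
  by (intro differentiable_mult differentiable_sum ballI finite
      metric_differentiable[OF assms(1,2)] twice_diff_onD[OF assms(3,2)])

lemma lower_grad:
  assumes "metric_on U G" "x \<in> U"
  shows "(\<Sum>k\<in>UNIV. G x $ p $ k * grad G \<phi> k x) = pderiv_at p \<phi> x"
  unfolding grad_def by (rule metric_sum_inv_cancel(1)[OF assms])

lemma grad_prod_sym:
  assumes "metric_on U G" "x \<in> U"
  shows "grad_prod G \<theta> \<eta> x = grad_prod G \<eta> \<theta> x"
  unfolding grad_prod_def grad_def sum_distrib_left
  by (subst sum.swap) (simp add: metric_onD(4)[OF assms] mult_ac)

text \<open>Obtained by differentiating \<open>lower_grad\<close>; it controls the derivatives of
  the gradient without a formula for the derivative of the inverse matrix.\<close>

lemma lower_pderiv_grad: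
  assumes "metric_on U G" "x \<in> U" "twice_diff_on U \<phi>"
  shows "(\<Sum>k\<in>UNIV. pderiv_at i (\<lambda>y. G y $ p $ k) x * grad G \<phi> k x + G x $ p $ k * pderiv_at i (grad G \<phi> k) x)
    = pderiv_at i (pderiv_at p \<phi>) x"
proof -
  note d = metric_differentiable[OF assms(1,2)] grad_differentiable[OF assms]
  have "pderiv_at i (\<lambda>y. \<Sum>k\<in>UNIV. G y $ p $ k * grad G \<phi> k y) x = pderiv_at i (pderiv_at p \<phi>) x"
    by (rule pderiv_at_cong_on_open[OF metric_onD(1)[OF assms(1,2)] assms(2)])
      (rule lower_grad[OF assms(1)])
  then show ?thesis
    by (simp add: pderiv_at_sum pderiv_at_mult d)
qed

text \<open>Metric compatibility turns the Hessian into the covariant derivative of the gradient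
  with its index lowered; tracing with the inverse metric raises the index again. The divergence
  form is the one that appears when conformally changed Christoffel symbols are contracted.\<close>

lemma laplacian_eq_divergence:
  assumes "metric_on U G" "x \<in> U" "twice_diff_on U \<phi>"
  shows "laplacian G \<phi> x = (\<Sum>k\<in>UNIV. pderiv_at k (grad G \<phi> k) x)
     + (\<Sum>k\<in>UNIV. \<Sum>r\<in>UNIV. christoffel G k k r x * grad G \<phi> r x)"
proof -
  let ?i = "\<lambda>i j. matrix_inv (G x) $ i $ j" and ?g = "\<lambda>i j. G x $ i $ j"
  let ?C = "\<lambda>k i j. christoffel G k i j x" and ?X = "\<lambda>k. grad G \<phi> k x"
  let ?DX = "\<lambda>i k. pderiv_at i (grad G \<phi> k) x"
  have h: "hess G \<phi> i j x = (\<Sum>k\<in>UNIV. ?g j k * (\<Sum>r\<in>UNIV. ?C k i r * ?X r)) + (\<Sum>k\<in>UNIV. ?g j k * ?DX i k)" for i j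
  proof -
    have "(\<Sum>r\<in>UNIV. ?C r i j * pderiv_at r \<phi> x) = (\<Sum>r\<in>UNIV. ?C r i j * (\<Sum>k\<in>UNIV. ?g r k * ?X k))"
      by (simp add: lower_grad[OF assms(1,2)])
    also have "\<dots> = (\<Sum>k\<in>UNIV. (\<Sum>r\<in>UNIV. ?C r i j * ?g r k) * ?X k)"
      unfolding sum_distrib_left sum_distrib_right by (subst sum.swap) (simp add: mult.assoc)
    finally have 1: "(\<Sum>r\<in>UNIV. ?C r i j * pderiv_at r \<phi> x) = (\<Sum>k\<in>UNIV. (\<Sum>r\<in>UNIV. ?C r i j * ?g r k) * ?X k)" .
    have 2: "(\<Sum>k\<in>UNIV. ?g j k * (\<Sum>r\<in>UNIV. ?C k i r * ?X r)) = (\<Sum>k\<in>UNIV. (\<Sum>r\<in>UNIV. ?C r i k * ?g j r) * ?X k)"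
      unfolding sum_distrib_left sum_distrib_right by (subst sum.swap) (simp add: mult_ac)
    show ?thesis
      unfolding hess_def lower_pderiv_grad[OF assms, symmetric] 1 2 metric_compatible[OF assms(1,2)]
      by (simp add: sum.distrib distrib_right)
  qed
  have "laplacian G \<phi> x = (\<Sum>i\<in>UNIV. (\<Sum>j\<in>UNIV. ?i i j * (\<Sum>k\<in>UNIV. ?g j k * (\<Sum>r\<in>UNIV. ?C k i r * ?X r)))
       + (\<Sum>j\<in>UNIV. ?i i j * (\<Sum>k\<in>UNIV. ?g j k * ?DX i k)))"
    unfolding laplacian_def h by (simp add: sum.distrib distrib_left)
  also have "\<dots> = (\<Sum>i\<in>UNIV. (\<Sum>r\<in>UNIV. ?C i i r * ?X r) + ?DX i i)"
    unfolding metric_sum_inv_cancel(2)[OF assms(1,2)] ..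
  finally show ?thesis
    by (simp add: sum.distrib)
qed

section \<open>Conformal change of metric\<close>

text \<open>Here \<open>T\<close> is the difference of the Christoffel symbols of \<open>e\<^bsup>2\<phi>\<^esup>g\<close> and \<open>g\<close>, \<open>dT m k i j\<close> is
  \<open>\<partial>\<^sub>m T\<^sup>k\<^sub>i\<^sub>j\<close>, and \<open>p\<close> and \<open>X\<close> are the differential and the gradient of \<open>\<phi>\<close>.\<close>

lemma conformal_ricci_difference:
  fixes C :: "'n::finite \<Rightarrow> 'n \<Rightarrow> 'n \<Rightarrow> real" and g :: "'n \<Rightarrow> 'n \<Rightarrow> real" and p X :: "'n \<Rightarrow> real"
    and dp dX :: "'n \<Rightarrow> 'n \<Rightarrow> real" and dg :: "'n \<Rightarrow> 'n \<Rightarrow> 'n \<Rightarrow> real" and l j :: 'n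
  defines "T \<equiv> \<lambda>k i j. (if k = i then p j else 0) + (if k = j then p i else 0) - g i j * X k"
  defines "dT \<equiv> \<lambda>m k i j. (if k = i then dp m j else 0) + (if k = j then dp m i else 0)
      - (dg m i j * X k + g i j * dX m k)"
  assumes g: "\<And>i j. g i j = g j i" and C: "\<And>k i j. C k i j = C k j i"
    and X: "\<And>l. (\<Sum>k\<in>UNIV. g l k * X k) = p l"
    and dX: "\<And>i l. (\<Sum>k\<in>UNIV. dg i l k * X k + g l k * dX i k) = dp i l"
    and dg: "\<And>k i j. dg k i j = (\<Sum>r\<in>UNIV. C r k i * g r j) + (\<Sum>r\<in>UNIV. C r k j * g i r)"
    and dp: "dp l j = dp j l"
  shows "(\<Sum>k\<in>UNIV. dT k k j l - dT j k k l + (\<Sum>r\<in>UNIV.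
        (C k k r + T k k r) * (C r j l + T r j l) - (C k j r + T k j r) * (C r k l + T r k l)
        - (C k k r * C r j l - C k j r * C r k l)))
     = - (real CARD('n) - 2) * (dp j l - (\<Sum>k\<in>UNIV. C k j l * p k) - p j * p l)
       - ((\<Sum>k\<in>UNIV. dX k k) + (\<Sum>k\<in>UNIV. \<Sum>r\<in>UNIV. C k k r * X r)
          + (real CARD('n) - 2) * (\<Sum>k\<in>UNIV. p k * X k)) * g j l"
proof -
  let ?n = "real CARD('n)"
  let ?div = "\<Sum>k\<in>UNIV. dX k k" and ?CX = "\<Sum>k\<in>UNIV. \<Sum>r\<in>UNIV. C k k r * X r"
  let ?pX = "\<Sum>k\<in>UNIV. p k * X k" and ?Cp = "\<Sum>k\<in>UNIV. C k j l * p k"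
  let ?tr = "\<lambda>i. \<Sum>k\<in>UNIV. C k k i"
  have X': "(\<Sum>k\<in>UNIV. g k l * X k) = p l" for l
    using X[of l] by (simp add: g[of l])
  \<comment> \<open>The gradient term contributes \<open>- p i\<close>, which cancels one of the
    \<open>?n + 1\<close> copies of \<open>p i\<close>.\<close>
  have trT: "(\<Sum>k\<in>UNIV. T k k i) = ?n * p i" for i
    by (simp add: T_def sum.distrib sum_subtractf X')
  have s1: "(\<Sum>k\<in>UNIV. dT k k j l) = 2 * dp j l - (\<Sum>k\<in>UNIV. dg k j l * X k) - g j l * ?div"
    by (simp add: dT_def sum.distrib sum_subtractf sum_distrib_left dp)
  \<comment> \<open>The derivative of \<open>trT\<close> in direction \<open>j\<close>: the terms
    with \<open>dg\<close> and \<open>dX\<close> combine to \<open>dp j l\<close> and remove its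
    extra copy.\<close>
  have s2: "(\<Sum>k\<in>UNIV. dT j k k l) = ?n * dp j l"
  proof -
    have "dg j k l = dg j l k" for k
      unfolding dg by (simp add: add.commute g)
    then have "(\<Sum>k\<in>UNIV. dg j k l * X k + g k l * dX j k) = dp j l"
      using dX[of j l] by (simp add: g[of l])
    then show ?thesis
      by (simp add: dT_def sum.distrib sum_subtractf)
  qed
  have s3: "(\<Sum>k\<in>UNIV. \<Sum>r\<in>UNIV. C k k r * T r j l) = ?tr j * p l + ?tr l * p j - g j l * ?CX"
    by (simp add: T_def sum.distrib sum_subtractf distrib_left right_diff_distrib if_zero_mult
        sum_distrib_left sum_distrib_right mult_ac)
  have s4: "(\<Sum>k\<in>UNIV. \<Sum>r\<in>UNIV. T k k r * C r j l) = ?n * ?Cp"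
  proof -
    have "(\<Sum>k\<in>UNIV. \<Sum>r\<in>UNIV. T k k r * C r j l) = (\<Sum>r\<in>UNIV. ?n * p r * C r j l)"
      by (subst sum.swap) (simp add: sum_distrib_right[symmetric] trT)
    then show ?thesis
      by (simp add: sum_distrib_left mult_ac)
  qed
  have s5: "(\<Sum>k\<in>UNIV. \<Sum>r\<in>UNIV. T k k r * T r j l) = ?n * (2 * p j * p l - g j l * ?pX)"
  proof -
    have "(\<Sum>k\<in>UNIV. \<Sum>r\<in>UNIV. T k k r * T r j l) = (\<Sum>r\<in>UNIV. ?n * p r * T r j l)"
      by (subst sum.swap) (simp add: sum_distrib_right[symmetric] trT)
    also have "\<dots> = ?n * (2 * p j * p l - g j l * ?pX)"
      by (simp add: T_def sum.distrib sum_subtractf algebra_simps if_zero_mult sum_distrib_left)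
    finally show ?thesis .
  qed
  have s6: "(\<Sum>k\<in>UNIV. \<Sum>r\<in>UNIV. C k j r * T r k l)
      = ?tr j * p l + ?Cp - (\<Sum>k\<in>UNIV. \<Sum>r\<in>UNIV. C k j r * g k l * X r)"
  proof -
    have "(\<Sum>k\<in>UNIV. p l * C k j k) = (\<Sum>k\<in>UNIV. p l * C k k j)"
      by (rule sum.cong) (simp_all add: C[of _ j])
    then show ?thesis
      by (simp add: T_def sum.distrib sum_subtractf distrib_left right_diff_distrib if_zero_mult
        sum_distrib_left sum_distrib_right mult_ac)
  qed
  have s7: "(\<Sum>k\<in>UNIV. \<Sum>r\<in>UNIV. T k j r * C r k l)
      = ?Cp + ?tr l * p j - (\<Sum>k\<in>UNIV. \<Sum>r\<in>UNIV. C r k l * g j r * X k)"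
  proof -
    have "(\<Sum>r\<in>UNIV. T k j r * C r k l) = (if k = j then ?Cp else 0) + p j * C k k l
        - (\<Sum>r\<in>UNIV. C r k l * g j r * X k)" for k
      by (cases "k = j") (simp_all add: T_def sum.distrib sum_subtractf algebra_simps if_zero_mult)
    then show ?thesis
      by (simp add: sum.distrib sum_subtractf sum_distrib_left mult.commute)
  qed
  have s8: "(\<Sum>k\<in>UNIV. \<Sum>r\<in>UNIV. T k j r * T r k l) = (?n + 2) * p j * p l - 2 * g j l * ?pX"
  proof -
    have 1: "(\<Sum>r\<in>UNIV. T k j r * T r k l) = (if k = j then 2 * p k * p l - g k l * ?pX else 0)
       + p j * (p l + (if k = l then p k else 0) - g k l * X k)
       - X k * (g j k * p l + g j l * p k - g k l * p j)" for k
    proof -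
      have "(\<Sum>r\<in>UNIV. T k j r * T r k l) = (\<Sum>r\<in>UNIV. (if k = j then p r * T r k l else 0))
          + (\<Sum>r\<in>UNIV. (if k = r then p j * T r k l else 0)) - X k * (\<Sum>r\<in>UNIV. g j r * T r k l)"
        unfolding sum_distrib_left sum.distrib[symmetric] sum_subtractf[symmetric]
        by (rule sum.cong) (auto simp: T_def algebra_simps)
      moreover have "(\<Sum>r\<in>UNIV. p r * T r k l) = 2 * p k * p l - g k l * ?pX"
        by (simp add: T_def sum.distrib sum_subtractf algebra_simps if_zero_mult sum_distrib_left)
      then have "(\<Sum>r\<in>UNIV. (if k = j then p r * T r k l else 0)) = (if k = j then 2 * p k * p l - g k l * ?pX else 0)"
        by (cases "k = j") auto
      moreover have "(\<Sum>r\<in>UNIV. (if k = r then p j * T r k l else 0))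
          = p j * (p l + (if k = l then p k else 0) - g k l * X k)"
        by (simp add: T_def)
      moreover have "(\<Sum>r\<in>UNIV. g j r * T r k l) = g j k * p l + g j l * p k - g k l * p j"
      proof -
        have "(\<Sum>r\<in>UNIV. g j r * T r k l) = g j k * p l + g j l * p k - g k l * (\<Sum>r\<in>UNIV. g j r * X r)"
          by (simp add: T_def sum.distrib sum_subtractf algebra_simps if_zero_mult sum_distrib_left)
        then show ?thesis by (simp add: X)
      qed
      ultimately show ?thesis
        by simp
    qed
    have 2: "(\<Sum>k\<in>UNIV. X k * (g j k * p l + g j l * p k - g k l * p j)) = g j l * ?pX"
    proof -
      have "(\<Sum>k\<in>UNIV. X k * (g j k * p l + g j l * p k - g k l * p j))
        = (\<Sum>k\<in>UNIV. g j k * X k) * p l + g j l * ?pX - (\<Sum>k\<in>UNIV. g k l * X k) * p j"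
        by (simp add: sum.distrib sum_subtractf algebra_simps sum_distrib_left sum_distrib_right)
      then show ?thesis by (simp add: X X')
    qed
    have 3: "(\<Sum>k\<in>UNIV. p j * (p l + (if k = l then p k else 0) - g k l * X k)) = p j * (?n * p l)"
      by (simp add: sum_distrib_left[symmetric] sum.distrib sum_subtractf X')
    show ?thesis
      unfolding 1 sum_subtractf sum.distrib 2 3 by (simp add: algebra_simps)
  qed
  \<comment> \<open>The left side comes from \<open>s1\<close>, the two sums on the right from
    \<open>s6\<close> and \<open>s7\<close>. By metric compatibility they cancel, and the only
    product of \<open>C\<close>, \<open>g\<close> and \<open>X\<close> that survives is the one in
    the divergence.\<close>
  have cancel: "(\<Sum>k\<in>UNIV. dg k j l * X k) = (\<Sum>k\<in>UNIV. \<Sum>r\<in>UNIV. C k j r * g k l * X r)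
      + (\<Sum>k\<in>UNIV. \<Sum>r\<in>UNIV. C r k l * g j r * X k)"
  proof -
    have "(\<Sum>k\<in>UNIV. \<Sum>r\<in>UNIV. C k j r * g k l * X r) = (\<Sum>k\<in>UNIV. \<Sum>r\<in>UNIV. C r k j * g r l * X k)"
      by (subst sum.swap) (simp add: C)
    then show ?thesis
      unfolding dg by (simp add: sum_distrib_right distrib_right sum.distrib)
  qed
  have "(\<Sum>k\<in>UNIV. dT k k j l - dT j k k l + (\<Sum>r\<in>UNIV.
        (C k k r + T k k r) * (C r j l + T r j l) - (C k j r + T k j r) * (C r k l + T r k l)
        - (C k k r * C r j l - C k j r * C r k l)))
     = (\<Sum>k\<in>UNIV. dT k k j l) - (\<Sum>k\<in>UNIV. dT j k k l) + (\<Sum>k\<in>UNIV. \<Sum>r\<in>UNIV. C k k r * T r j l)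
       + (\<Sum>k\<in>UNIV. \<Sum>r\<in>UNIV. T k k r * C r j l) + (\<Sum>k\<in>UNIV. \<Sum>r\<in>UNIV. T k k r * T r j l)
       - (\<Sum>k\<in>UNIV. \<Sum>r\<in>UNIV. C k j r * T r k l) - (\<Sum>k\<in>UNIV. \<Sum>r\<in>UNIV. T k j r * C r k l)
       - (\<Sum>k\<in>UNIV. \<Sum>r\<in>UNIV. T k j r * T r k l)"
    unfolding sum.distrib[symmetric] sum_subtractf[symmetric]
    by (intro sum.cong refl arg_cong2[where f="(+)"]) (simp add: sum.distrib sum_subtractf algebra_simps)
  then show ?thesis
    unfolding s1 s2 s3 s4 s5 s6 s7 s8 cancel by (simp add: algebra_simps)
qed

context
  fixes U :: "(real^'n::finite) set" and G G' :: "real^'n \<Rightarrow> real^'n^'n" and \<phi> :: "real^'n \<Rightarrow> real"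
  assumes G: "metric_on U G" and \<phi>: "twice_diff_on U \<phi>"
    and G': "\<And>x. x \<in> U \<Longrightarrow> G' x = exp (2 * \<phi> x) *\<^sub>R G x"
begin

lemma conformal_entry: "x \<in> U \<Longrightarrow> G' x $ i $ j = exp (2 * \<phi> x) * G x $ i $ j"
  by (simp add: G')

lemma conformal_inv:
  assumes "x \<in> U"
  shows "matrix_inv (G' x) $ i $ j = exp (- (2 * \<phi> x)) * matrix_inv (G x) $ i $ j"
  using matrix_inv_scaleR[OF metric_onD(2)[OF G assms], of "exp (2 * \<phi> x)"] G'[OF assms]
  by (simp add: exp_minus)

lemma conformal_metric_on: "metric_on U G'"
  unfolding metric_on_def
proof (intro conjI ballI allI)
  show U: "open U"
    using G by (simp add: metric_on_def)
  show "invertible (G' x)" if "x \<in> U" for x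
    using invertible_scaleR[OF metric_onD(2)[OF G that], of "exp (2 * \<phi> x)"] G'[OF that] by simp
  show "transpose (G' x) = G' x" if "x \<in> U" for x
    using metric_onD(3)[OF G that] unfolding transpose_eq_iff conformal_entry[OF that] by simp
  show "twice_diff_on U (\<lambda>x. G' x $ i $ j)" for i j
  proof (rule twice_diff_on_cong[OF U])
    show "twice_diff_on U (\<lambda>x. exp (2 * \<phi> x) * G x $ i $ j)"
      using G by (intro twice_diff_on_mult twice_diff_on_exp twice_diff_on_cmult U \<phi>)
        (simp add: metric_on_def)
  qed (simp add: conformal_entry)
qed

lemma conformal_pderiv:
  assumes x: "x \<in> U"
  shows "pderiv_at m (\<lambda>y. G' y $ i $ j) x
    = exp (2 * \<phi> x) * (2 * pderiv_at m \<phi> x * G x $ i $ j + pderiv_at m (\<lambda>y. G y $ i $ j) x)"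
proof -
  note d = metric_differentiable[OF G x] twice_diff_onD[OF \<phi> x]
  have d2: "(\<lambda>y. 2 * \<phi> y) differentiable at x"
    using d by simp
  have "pderiv_at m (\<lambda>y. G' y $ i $ j) x = pderiv_at m (\<lambda>y. exp (2 * \<phi> y) * G y $ i $ j) x"
    by (rule pderiv_at_cong_on_open[OF metric_onD(1)[OF G x] x conformal_entry])
  also have "\<dots> = pderiv_at m (\<lambda>y. exp (2 * \<phi> y)) x * G x $ i $ j + exp (2 * \<phi> x) * pderiv_at m (\<lambda>y. G y $ i $ j) x"
    by (rule pderiv_at_mult[OF differentiable_exp_compose[OF d2] d(1)])
  also have "pderiv_at m (\<lambda>y. exp (2 * \<phi> y)) x = exp (2 * \<phi> x) * (2 * pderiv_at m \<phi> x)"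
    using pderiv_at_exp[OF d2] pderiv_at_cmult[OF d(4)] by simp
  finally show ?thesis
    by (simp add: algebra_simps)
qed

text \<open>The factor \<open>exp (2 * \<phi> x)\<close> in the derivatives of the metric cancels
  the one in the inverse metric. What is added are first derivatives of \<open>\<phi>\<close> times
  metric entries; contracted with the inverse metric, two of the three terms become Kronecker deltas
  and the third a gradient.\<close>

lemma conformal_christoffel:
  assumes x: "x \<in> U"
  shows "christoffel G' k i j x = christoffel G k i j x
    + ((if k = i then pderiv_at j \<phi> x else 0) + (if k = j then pderiv_at i \<phi> x else 0)
       - G x $ i $ j * grad G \<phi> k x)"
proof -
  let ?i = "\<lambda>k l. matrix_inv (G x) $ k $ l"
  let ?d = "\<lambda>l. pderiv_at i (\<lambda>y. G y $ l $ j) x + pderiv_at j (\<lambda>y. G y $ l $ i) x - pderiv_at l (\<lambda>y. G y $ i $ j) x"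
  have "christoffel G' k i j x = 1/2 * (\<Sum>l\<in>UNIV. ?i k l * ?d l
      + 2 * (?i k l * G x $ l $ j * pderiv_at i \<phi> x + ?i k l * G x $ l $ i * pderiv_at j \<phi> x
         - G x $ i $ j * (?i k l * pderiv_at l \<phi> x)))"
    unfolding christoffel_def conformal_inv[OF x] conformal_pderiv[OF x]
    by (intro arg_cong[where f="\<lambda>s. 1/2 * s"] sum.cong refl) (simp add: field_simps exp_minus)
  also have "\<dots> = christoffel G k i j x + ((\<Sum>l\<in>UNIV. ?i k l * G x $ l $ j) * pderiv_at i \<phi> x
     + (\<Sum>l\<in>UNIV. ?i k l * G x $ l $ i) * pderiv_at j \<phi> x - G x $ i $ j * grad G \<phi> k x)"
    by (simp add: christoffel_def grad_def sum.distrib sum_subtractf algebra_simps sum_distrib_left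
        sum_distrib_right sum_divide_distrib)
  also have "\<dots> = christoffel G k i j x
    + ((if k = i then pderiv_at j \<phi> x else 0) + (if k = j then pderiv_at i \<phi> x else 0)
       - G x $ i $ j * grad G \<phi> k x)"
    by (simp add: metric_onD(6)[OF G x])
  finally show ?thesis .
qed

lemma conformal_pderiv_christoffel:
  assumes x: "x \<in> U"
  shows "pderiv_at m (christoffel G' k i j) x = pderiv_at m (christoffel G k i j) x
    + ((if k = i then pderiv_at m (pderiv_at j \<phi>) x else 0)
     + (if k = j then pderiv_at m (pderiv_at i \<phi>) x else 0)
     - (pderiv_at m (\<lambda>y. G y $ i $ j) x * grad G \<phi> k x + G x $ i $ j * pderiv_at m (grad G \<phi> k) x))"
proof -
  note d = metric_differentiable[OF G x] twice_diff_onD[OF \<phi> x] grad_differentiable[OF G x \<phi>]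
    christoffel_differentiable[OF G x]
  have i: "pderiv_at m (\<lambda>y. if b then f y else 0) x = (if b then pderiv_at m f x else 0)" for b and f :: "real^'n \<Rightarrow> real"
    by simp
  have id: "(\<lambda>y. if b then pderiv_at j \<phi> y else 0) differentiable at x" for b j
    by (cases b) (simp_all add: d)
  have "pderiv_at m (christoffel G' k i j) x = pderiv_at m (\<lambda>x. christoffel G k i j x
    + ((if k = i then pderiv_at j \<phi> x else 0) + (if k = j then pderiv_at i \<phi> x else 0)
       - G x $ i $ j * grad G \<phi> k x)) x"
    by (rule pderiv_at_cong_on_open[OF metric_onD(1)[OF G x] x conformal_christoffel])
  also have "\<dots> = pderiv_at m (christoffel G k i j) x
    + ((if k = i then pderiv_at m (pderiv_at j \<phi>) x else 0)
     + (if k = j then pderiv_at m (pderiv_at i \<phi>) x else 0)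
     - (pderiv_at m (\<lambda>y. G y $ i $ j) x * grad G \<phi> k x + G x $ i $ j * pderiv_at m (grad G \<phi> k) x))"
    by (simp add: pderiv_at_add pderiv_at_diff pderiv_at_mult d id i del: if_split)
  finally show ?thesis .
qed

text \<open>A pointwise application of \<open>conformal_ricci_difference\<close>: symmetry of second
  derivatives supplies its condition on \<open>dp\<close>, and
  \<open>laplacian_eq_divergence\<close> recognises the Laplacian among the contracted
  terms.\<close>

theorem conformal_ricci:
  assumes x: "x \<in> U"
  shows "ricci_coord G' x $ l $ j = ricci_coord G x $ l $ j
    - (real CARD('n) - 2) * (hess G \<phi> j l x - pderiv_at j \<phi> x * pderiv_at l \<phi> x)
    - (laplacian G \<phi> x + (real CARD('n) - 2) * grad_prod G \<phi> \<phi> x) * G x $ j $ l"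
proof -
  have "ricci_coord G' x $ l $ j - ricci_coord G x $ l $ j = (\<Sum>k\<in>UNIV. riemann_coord G' k l k j x - riemann_coord G k l k j x)"
    by (simp add: ricci_coord_def sum_subtractf)
  also have "\<dots> = - (real CARD('n) - 2) * (pderiv_at j (pderiv_at l \<phi>) x
        - (\<Sum>k\<in>UNIV. christoffel G k j l x * pderiv_at k \<phi> x) - pderiv_at j \<phi> x * pderiv_at l \<phi> x)
       - ((\<Sum>k\<in>UNIV. pderiv_at k (grad G \<phi> k) x) + (\<Sum>k\<in>UNIV. \<Sum>r\<in>UNIV. christoffel G k k r x * grad G \<phi> r x)
          + (real CARD('n) - 2) * (\<Sum>k\<in>UNIV. pderiv_at k \<phi> x * grad G \<phi> k x)) * G x $ j $ l"
    unfolding conformal_ricci_difference[of "\<lambda>i j. G x $ i $ j" "\<lambda>k i j. christoffel G k i j x" "\<lambda>k. grad G \<phi> k x"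
      "\<lambda>l. pderiv_at l \<phi> x" "\<lambda>m i j. pderiv_at m (\<lambda>y. G y $ i $ j) x" "\<lambda>m k. pderiv_at m (grad G \<phi> k) x"
      "\<lambda>m i. pderiv_at m (pderiv_at i \<phi>) x" l j, symmetric,
      OF metric_onD(3)[OF G x] christoffel_sym[OF G x] lower_grad[OF G x] lower_pderiv_grad[OF G x \<phi>]
        metric_compatible[OF G x] pderiv_at_commute[OF metric_onD(1)[OF G x] x \<phi>]]
    unfolding riemann_coord_def conformal_pderiv_christoffel[OF x] conformal_christoffel[OF x]
    by (intro sum.cong refl) (simp add: sum_subtractf)
  finally show ?thesis
    unfolding laplacian_eq_divergence[OF G x \<phi>] hess_def grad_prod_def by (simp add: algebra_simps)
qed

lemma conformal_grad: "x \<in> U \<Longrightarrow> grad G' \<theta> k x = exp (- (2 * \<phi> x)) * grad G \<theta> k x"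
  by (simp add: grad_def conformal_inv sum_distrib_left mult.assoc)

lemma conformal_grad_prod: "x \<in> U \<Longrightarrow> grad_prod G' \<theta> \<eta> x = exp (- (2 * \<phi> x)) * grad_prod G \<theta> \<eta> x"
  by (simp add: grad_prod_def conformal_grad sum_distrib_left mult_ac)

lemma conformal_hess:
  assumes x: "x \<in> U"
  shows "hess G' \<theta> i j x = hess G \<theta> i j x - pderiv_at i \<phi> x * pderiv_at j \<theta> x
    - pderiv_at j \<phi> x * pderiv_at i \<theta> x + grad_prod G \<theta> \<phi> x * G x $ i $ j"
  unfolding hess_def conformal_christoffel[OF x] grad_prod_def
  by (simp add: algebra_simps sum.distrib sum_subtractf if_zero_mult sum_distrib_left sum_distrib_right)

text \<open>In the trace of \<open>conformal_hess\<close> the two products of first derivatives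
  contribute -2 times the gradient product, while the metric term contributes the dimension, as the
  trace of the metric.\<close>

lemma conformal_laplacian:
  assumes x: "x \<in> U"
  shows "laplacian G' \<theta> x
    = exp (- (2 * \<phi> x)) * (laplacian G \<theta> x + (real CARD('n) - 2) * grad_prod G \<theta> \<phi> x)"
proof -
  let ?i = "\<lambda>i j. matrix_inv (G x) $ i $ j" and ?p = "\<lambda>i. pderiv_at i \<phi> x" and ?t = "\<lambda>i. pderiv_at i \<theta> x"
  have 1: "(\<Sum>i\<in>UNIV. \<Sum>j\<in>UNIV. ?i i j * (?p i * ?t j)) = grad_prod G \<phi> \<theta> x"
    "(\<Sum>i\<in>UNIV. \<Sum>j\<in>UNIV. ?i i j * (?p j * ?t i)) = grad_prod G \<theta> \<phi> x"
    by (simp_all add: grad_prod_def grad_def sum_distrib_left mult_ac)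
  have "(\<Sum>i\<in>UNIV. \<Sum>j\<in>UNIV. ?i i j * G x $ i $ j) = (\<Sum>i\<in>UNIV. \<Sum>j\<in>UNIV. ?i i j * G x $ j $ i)"
    by (intro sum.cong refl arg_cong2[where f="(*)"] metric_onD(3)[OF G x])
  then have 2: "(\<Sum>i\<in>UNIV. \<Sum>j\<in>UNIV. ?i i j * G x $ i $ j) = real CARD('n)"
    by (simp add: metric_onD(6)[OF G x])
  have "laplacian G' \<theta> x = exp (- (2 * \<phi> x)) * (\<Sum>i\<in>UNIV. \<Sum>j\<in>UNIV. ?i i j * hess G \<theta> i j x
      - ?i i j * (?p i * ?t j) - ?i i j * (?p j * ?t i) + grad_prod G \<theta> \<phi> x * (?i i j * G x $ i $ j))"
    unfolding laplacian_def conformal_inv[OF x] conformal_hess[OF x] sum_distrib_left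
    by (intro sum.cong refl) (simp add: algebra_simps)
  also have "\<dots> = exp (- (2 * \<phi> x)) * (laplacian G \<theta> x + (real CARD('n) - 2) * grad_prod G \<theta> \<phi> x)"
    unfolding sum.distrib sum_subtractf 1 grad_prod_sym[OF G x, of \<phi> \<theta>] sum_distrib_left[symmetric] 2 laplacian_def
    by (simp add: algebra_simps)
  finally show ?thesis .
qed

end

section \<open>Product metrics\<close>

definition fst_vec :: "real^('m::finite + 'k::finite) \<Rightarrow> real^'m" where
  "fst_vec z = (\<chi> i. z $ Inl i)"

definition snd_vec :: "real^('m::finite + 'k::finite) \<Rightarrow> real^'k" where
  "snd_vec z = (\<chi> j. z $ Inr j)"

lemma fst_vec_join [simp]: "fst_vec (join_vec x y) = x"
  and snd_vec_join [simp]: "snd_vec (join_vec x y) = y"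
  and join_fst_snd_vec [simp]: "join_vec (fst_vec z) (snd_vec z) = z"
  by (simp_all add: fst_vec_def snd_vec_def join_vec_def vec_eq_iff split: sum.split)

lemma bounded_linear_fst_vec: "bounded_linear fst_vec"
  and bounded_linear_snd_vec: "bounded_linear snd_vec"
  by (auto intro!: linear_conv_bounded_linear[THEN iffD1] linearI simp: fst_vec_def snd_vec_def vec_eq_iff)

lemma fst_vec_axis [simp]: "fst_vec (axis (Inl i) a) = axis i a" "fst_vec (axis (Inr j) a) = 0"
  and snd_vec_axis [simp]: "snd_vec (axis (Inl i) a) = 0" "snd_vec (axis (Inr j) a) = axis j a"
  by (simp_all add: fst_vec_def snd_vec_def axis_def vec_eq_iff)

lemma sum_UNIV_Plus:
  "(\<Sum>s\<in>UNIV. f s) = (\<Sum>i\<in>UNIV. f (Inl i)) + (\<Sum>j\<in>UNIV. f (Inr j))"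
  for f :: "'m::finite + 'k::finite \<Rightarrow> real"
  by (subst UNIV_Plus_UNIV[symmetric], subst sum.Plus) simp_all

lemma
  assumes "f differentiable at (fst_vec z)"
  shows fst_vec_differentiable: "(\<lambda>z. f (fst_vec z)) differentiable at z"
    and pderiv_at_fst_vec: "pderiv_at (Inl i) (\<lambda>z. f (fst_vec z)) z = pderiv_at i f (fst_vec z)"
      "pderiv_at (Inr j) (\<lambda>z. f (fst_vec z)) z = 0"
proof -
  have *: "((\<lambda>z. f (fst_vec z)) has_derivative (\<lambda>v. frechet_derivative f (at (fst_vec z)) (fst_vec v))) (at z)"
    by (rule has_derivative_compose[OF bounded_linear_imp_has_derivative[OF bounded_linear_fst_vec]
      has_derivative_frechet[OF assms]])
  from differentiableI[OF this] show "(\<lambda>z. f (fst_vec z)) differentiable at z" .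
  show "pderiv_at (Inl i) (\<lambda>z. f (fst_vec z)) z = pderiv_at i f (fst_vec z)"
    using pderiv_at_eq[OF *, of "Inl i"] by (simp add: pderiv_at_def)
  show "pderiv_at (Inr j) (\<lambda>z. f (fst_vec z)) z = 0"
    using pderiv_at_eq[OF *, of "Inr j"] linear_0[OF linear_frechet_derivative[OF assms]] by simp
qed

lemma
  assumes "f differentiable at (snd_vec z)"
  shows snd_vec_differentiable: "(\<lambda>z. f (snd_vec z)) differentiable at z"
    and pderiv_at_snd_vec: "pderiv_at (Inr j) (\<lambda>z. f (snd_vec z)) z = pderiv_at j f (snd_vec z)"
      "pderiv_at (Inl i) (\<lambda>z. f (snd_vec z)) z = 0"
proof -
  have *: "((\<lambda>z. f (snd_vec z)) has_derivative (\<lambda>v. frechet_derivative f (at (snd_vec z)) (snd_vec v))) (at z)"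
    by (rule has_derivative_compose[OF bounded_linear_imp_has_derivative[OF bounded_linear_snd_vec]
      has_derivative_frechet[OF assms]])
  from differentiableI[OF this] show "(\<lambda>z. f (snd_vec z)) differentiable at z" .
  show "pderiv_at (Inr j) (\<lambda>z. f (snd_vec z)) z = pderiv_at j f (snd_vec z)"
    using pderiv_at_eq[OF *, of "Inr j"] by (simp add: pderiv_at_def)
  show "pderiv_at (Inl i) (\<lambda>z. f (snd_vec z)) z = 0"
    using pderiv_at_eq[OF *, of "Inl i"] linear_0[OF linear_frechet_derivative[OF assms]] by simp
qed

text \<open>Product charts take values in \<open>real^('m + 'k)\<close> and not in a pair type, so a
  product of coordinate domains is described through the two projections.\<close>

definition prod_set :: "(real^'m::finite) set \<Rightarrow> (real^'k::finite) set \<Rightarrow> (real^('m + 'k)) set" where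
  "prod_set U V = {z. fst_vec z \<in> U \<and> snd_vec z \<in> V}"

lemma join_in_prod_set [simp]: "join_vec x y \<in> prod_set U V \<longleftrightarrow> x \<in> U \<and> y \<in> V"
  by (simp add: prod_set_def)

lemma open_prod_set: "open U \<Longrightarrow> open V \<Longrightarrow> open (prod_set U V)"
proof -
  assume "open U" "open V"
  then have "open (fst_vec -` U)" "open (snd_vec -` V)"
    using linear_continuous_on[OF bounded_linear_fst_vec] linear_continuous_on[OF bounded_linear_snd_vec]
      open_vimage by blast+
  moreover have "prod_set U V = fst_vec -` U \<inter> snd_vec -` V"
    by (auto simp: prod_set_def)
  ultimately show ?thesis
    by auto
qed

lemma twice_diff_on_fst_vec:
  assumes "open U" "open V" "twice_diff_on U f"
  shows "twice_diff_on (prod_set U V) (\<lambda>z. f (fst_vec z))"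
  unfolding twice_diff_on_def
proof (intro ballI conjI allI)
  note d = twice_diff_onD[OF assms(3)]
  fix z s assume z: "z \<in> prod_set U V"
  show "(\<lambda>z. f (fst_vec z)) differentiable at z"
    using z d by (auto simp: prod_set_def intro: fst_vec_differentiable)
  show "pderiv_at s (\<lambda>z. f (fst_vec z)) differentiable at z"
  proof (cases s)
    case (Inl i)
    have "(\<lambda>z. pderiv_at i f (fst_vec z)) differentiable at z"
      using z d by (auto simp: prod_set_def intro: fst_vec_differentiable)
    then show ?thesis
      using differentiable_cong_on_open[OF open_prod_set[OF assms(1,2)] z,
        of "pderiv_at s (\<lambda>z. f (fst_vec z))" "\<lambda>z. pderiv_at i f (fst_vec z)"] d Inl
      by (simp add: prod_set_def pderiv_at_fst_vec)
  next
    case (Inr j)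
    then show ?thesis
      using differentiable_cong_on_open[OF open_prod_set[OF assms(1,2)] z,
        of "pderiv_at s (\<lambda>z. f (fst_vec z))" "\<lambda>z. 0"] d
      by (simp add: prod_set_def pderiv_at_fst_vec)
  qed
qed

lemma twice_diff_on_snd_vec:
  assumes "open U" "open V" "twice_diff_on V f"
  shows "twice_diff_on (prod_set U V) (\<lambda>z. f (snd_vec z))"
  unfolding twice_diff_on_def
proof (intro ballI conjI allI)
  note d = twice_diff_onD[OF assms(3)]
  fix z s assume z: "z \<in> prod_set U V"
  show "(\<lambda>z. f (snd_vec z)) differentiable at z"
    using z d by (auto simp: prod_set_def intro: snd_vec_differentiable)
  show "pderiv_at s (\<lambda>z. f (snd_vec z)) differentiable at z"
  proof (cases s)
    case (Inr i)
    have "(\<lambda>z. pderiv_at i f (snd_vec z)) differentiable at z"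
      using z d by (auto simp: prod_set_def intro: snd_vec_differentiable)
    then show ?thesis
      using differentiable_cong_on_open[OF open_prod_set[OF assms(1,2)] z,
        of "pderiv_at s (\<lambda>z. f (snd_vec z))" "\<lambda>z. pderiv_at i f (snd_vec z)"] d Inr
      by (simp add: prod_set_def pderiv_at_snd_vec)
  next
    case (Inl j)
    then show ?thesis
      using differentiable_cong_on_open[OF open_prod_set[OF assms(1,2)] z,
        of "pderiv_at s (\<lambda>z. f (snd_vec z))" "\<lambda>z. 0"] d
      by (simp add: prod_set_def pderiv_at_snd_vec)
  qed
qed

section \<open>Block diagonal metrics and their curvature\<close>

definition block_diag :: "real^'m::finite^'m \<Rightarrow> real^'k::finite^'k \<Rightarrow> real^('m + 'k)^('m + 'k)" where
  "block_diag A C = (\<chi> s t. case (s, t) of (Inl i, Inl j) \<Rightarrow> A $ i $ j | (Inr i, Inr j) \<Rightarrow> C $ i $ j | _ \<Rightarrow> 0)"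

lemma block_diag_nth [simp]:
  "block_diag A C $ Inl i $ Inl j = A $ i $ j" "block_diag A C $ Inr i' $ Inr j' = C $ i' $ j'"
  "block_diag A C $ Inl i $ Inr j' = 0" "block_diag A C $ Inr i' $ Inl j = 0"
  by (simp_all add: block_diag_def)

lemma
  assumes "invertible A" "invertible C"
  shows invertible_block_diag: "invertible (block_diag A C)"
    and matrix_inv_block_diag: "matrix_inv (block_diag A C) = block_diag (matrix_inv A) (matrix_inv C)"
proof -
  have "block_diag A C ** block_diag (matrix_inv A) (matrix_inv C) = mat 1"
    using matrix_inv_right[OF assms(1)] matrix_inv_right[OF assms(2)]
    unfolding matrix_mult_eq_1_iff by (auto simp: sum_UNIV_Plus split_sum_all)
  from matrix_inv_eqI[OF this] show "invertible (block_diag A C)"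
    "matrix_inv (block_diag A C) = block_diag (matrix_inv A) (matrix_inv C)"
    by auto
qed

definition prod_metric ::
  "(real^'m::finite \<Rightarrow> real^'m^'m) \<Rightarrow> (real^'k::finite \<Rightarrow> real^'k^'k) \<Rightarrow> real^('m + 'k) \<Rightarrow> real^('m + 'k)^('m + 'k)"
  where "prod_metric G H z = block_diag (G (fst_vec z)) (H (snd_vec z))"

context
  fixes U :: "(real^'m::finite) set" and V :: "(real^'k::finite) set" and G H
  assumes G: "metric_on U G" and H: "metric_on V H"
begin

lemma open_prod_domain: "open (prod_set U V)"
  using G H by (simp add: metric_on_def open_prod_set)

lemma metric_on_prod: "metric_on (prod_set U V) (prod_metric G H)"
  unfolding metric_on_def
proof (intro conjI ballI allI)
  have o: "open U" "open V"
    using G H by (auto simp: metric_on_def)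
  show "open (prod_set U V)"
    by (rule open_prod_domain)
  fix z assume z: "z \<in> prod_set U V"
  show "invertible (prod_metric G H z)"
    unfolding prod_metric_def using z
    by (intro invertible_block_diag metric_onD(2)[OF G] metric_onD(2)[OF H]) (auto simp: prod_set_def)
  show "transpose (prod_metric G H z) = prod_metric G H z"
    using z metric_onD(3)[OF G, of "fst_vec z"] metric_onD(3)[OF H, of "snd_vec z"]
    unfolding transpose_eq_iff by (auto simp: prod_metric_def prod_set_def split_sum_all)
next
  fix s t
  have o: "open U" "open V" and g: "twice_diff_on U (\<lambda>x. G x $ i $ j)" "twice_diff_on V (\<lambda>x. H x $ i' $ j')" for i j i' j'
    using G H by (auto simp: metric_on_def)
  show "twice_diff_on (prod_set U V) (\<lambda>z. prod_metric G H z $ s $ t)"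
    by (cases s; cases t) (simp_all add: prod_metric_def twice_diff_on_const
        twice_diff_on_fst_vec[OF o g(1)] twice_diff_on_snd_vec[OF o g(2)])
qed

text \<open>Each block depends only on its own coordinates and the inverse matrix is again block
  diagonal, so every symbol with indices of both kinds vanishes. The index \<open>s\<close> stands
  for either kind.\<close>

lemma prod_christoffel:
  assumes z: "z \<in> prod_set U V"
  shows "christoffel (prod_metric G H) (Inl k) (Inl i) (Inl j) z = christoffel G k i j (fst_vec z)"
    and "christoffel (prod_metric G H) (Inr k') (Inr i') (Inr j') z = christoffel H k' i' j' (snd_vec z)"
    and "christoffel (prod_metric G H) (Inl k) s (Inr j') z = 0"
    and "christoffel (prod_metric G H) (Inl k) (Inr i') s z = 0"
    and "christoffel (prod_metric G H) (Inr k') s (Inl j) z = 0"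
    and "christoffel (prod_metric G H) (Inr k') (Inl i) s z = 0"
proof -
  have z': "fst_vec z \<in> U" "snd_vec z \<in> V"
    using z by (auto simp: prod_set_def)
  note simps = christoffel_def sum_UNIV_Plus prod_metric_def metric_onD(2)[OF G z'(1)] metric_onD(2)[OF H z'(2)]
    matrix_inv_block_diag pderiv_at_fst_vec[OF metric_differentiable(1)[OF G z'(1)]]
    pderiv_at_snd_vec[OF metric_differentiable(1)[OF H z'(2)]]
  show "christoffel (prod_metric G H) (Inl k) (Inl i) (Inl j) z = christoffel G k i j (fst_vec z)"
    "christoffel (prod_metric G H) (Inr k') (Inr i') (Inr j') z = christoffel H k' i' j' (snd_vec z)"
    by (simp_all add: simps)
  show "christoffel (prod_metric G H) (Inl k) s (Inr j') z = 0"
    "christoffel (prod_metric G H) (Inl k) (Inr i') s z = 0"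
    "christoffel (prod_metric G H) (Inr k') s (Inl j) z = 0"
    "christoffel (prod_metric G H) (Inr k') (Inl i) s z = 0"
    by (cases s; simp add: simps)+
qed

lemma prod_pderiv_christoffel:
  assumes z: "z \<in> prod_set U V"
  shows "pderiv_at (Inl m) (christoffel (prod_metric G H) (Inl k) (Inl i) (Inl j)) z
      = pderiv_at m (christoffel G k i j) (fst_vec z)"
    and "pderiv_at (Inr m') (christoffel (prod_metric G H) (Inl k) (Inl i) (Inl j)) z = 0"
    and "pderiv_at (Inr m') (christoffel (prod_metric G H) (Inr k') (Inr i') (Inr j')) z
      = pderiv_at m' (christoffel H k' i' j') (snd_vec z)"
    and "pderiv_at (Inl m) (christoffel (prod_metric G H) (Inr k') (Inr i') (Inr j')) z = 0"
    and "pderiv_at t (christoffel (prod_metric G H) (Inl k) s (Inr j')) z = 0"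
    and "pderiv_at t (christoffel (prod_metric G H) (Inl k) (Inr i') s) z = 0"
    and "pderiv_at t (christoffel (prod_metric G H) (Inr k') s (Inl j)) z = 0"
    and "pderiv_at t (christoffel (prod_metric G H) (Inr k') (Inl i) s) z = 0"
proof -
  have z': "fst_vec z \<in> U" "snd_vec z \<in> V"
    using z by (auto simp: prod_set_def)
  note c = pderiv_at_cong_on_open[OF open_prod_domain z]
  note d = pderiv_at_fst_vec[OF christoffel_differentiable[OF G z'(1)]]
    pderiv_at_snd_vec[OF christoffel_differentiable[OF H z'(2)]]
  show "pderiv_at (Inl m) (christoffel (prod_metric G H) (Inl k) (Inl i) (Inl j)) z
      = pderiv_at m (christoffel G k i j) (fst_vec z)"
    "pderiv_at (Inr m') (christoffel (prod_metric G H) (Inl k) (Inl i) (Inl j)) z = 0"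
    using c[of "christoffel (prod_metric G H) (Inl k) (Inl i) (Inl j)" "\<lambda>z. christoffel G k i j (fst_vec z)"]
    by (simp_all add: prod_christoffel d)
  show "pderiv_at (Inr m') (christoffel (prod_metric G H) (Inr k') (Inr i') (Inr j')) z
      = pderiv_at m' (christoffel H k' i' j') (snd_vec z)"
    "pderiv_at (Inl m) (christoffel (prod_metric G H) (Inr k') (Inr i') (Inr j')) z = 0"
    using c[of "christoffel (prod_metric G H) (Inr k') (Inr i') (Inr j')" "\<lambda>z. christoffel H k' i' j' (snd_vec z)"]
    by (simp_all add: prod_christoffel d)
  show "pderiv_at t (christoffel (prod_metric G H) (Inl k) s (Inr j')) z = 0"
    "pderiv_at t (christoffel (prod_metric G H) (Inl k) (Inr i') s) z = 0"
    "pderiv_at t (christoffel (prod_metric G H) (Inr k') s (Inl j)) z = 0"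
    "pderiv_at t (christoffel (prod_metric G H) (Inr k') (Inl i) s) z = 0"
    using c[of _ "\<lambda>_. 0"] by (simp_all add: prod_christoffel)
qed

theorem ricci_prod:
  assumes z: "z \<in> prod_set U V"
  shows "ricci_coord (prod_metric G H) z = block_diag (ricci_coord G (fst_vec z)) (ricci_coord H (snd_vec z))"
  unfolding vec_eq_iff split_sum_all
  by (simp add: ricci_coord_def riemann_coord_def sum_UNIV_Plus prod_christoffel[OF z] prod_pderiv_christoffel[OF z])

end

section \<open>Base conformal warped products\<close>

text \<open>The metric \<open>e\<^bsup>2\<mu>f\<^esup> g\<^sub>B + e\<^bsup>2f\<^esup> g\<^sub>F\<close> is the conformal change by \<open>f\<close> of the product of
  \<open>e\<^bsup>2(\<mu>-1)f\<^esup> g\<^sub>B\<close> and \<open>g\<^sub>F\<close>, so the conformal formula applied twice gives its Ricci tensor.\<close>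

context
  fixes U :: "(real^'m::finite) set" and V :: "(real^'k::finite) set" and G H
    and f :: "real^'m \<Rightarrow> real" and \<mu> :: real and W :: "real^('m + 'k) \<Rightarrow> real^('m + 'k)^('m + 'k)"
  assumes G: "metric_on U G" and H: "metric_on V H" and f: "twice_diff_on U f"
    and W: "\<And>x y. x \<in> U \<Longrightarrow> y \<in> V \<Longrightarrow>
      W (join_vec x y) = block_diag (exp (2 * (\<mu> * f x)) *\<^sub>R G x) (exp (2 * f x) *\<^sub>R H y)"
begin

private definition "\<theta> x = (\<mu> - 1) * f x"
private definition "G1 x = exp (2 * \<theta> x) *\<^sub>R G x"
private definition "\<phi> z = f (fst_vec z)" for z :: "real^('m + 'k)"
private abbreviation "P \<equiv> prod_metric G1 H"

private lemma open_UV: "open U" "open V"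
  using G H by (auto simp: metric_on_def)

private lemma \<theta>: "twice_diff_on U \<theta>"
  unfolding \<theta>_def[abs_def] by (rule twice_diff_on_cmult[OF open_UV(1) f])

private lemma G1: "metric_on U G1"
  by (rule conformal_metric_on[OF G \<theta> G1_def])

private lemma P: "metric_on (prod_set U V) P"
  by (rule metric_on_prod[OF G1 H])

private lemma \<phi>: "twice_diff_on (prod_set U V) \<phi>"
  unfolding \<phi>_def[abs_def] by (rule twice_diff_on_fst_vec[OF open_UV f])

private lemma W_conformal: "z \<in> prod_set U V \<Longrightarrow> W z = exp (2 * \<phi> z) *\<^sub>R P z"
proof -
  assume "z \<in> prod_set U V"
  then have "W z = block_diag (exp (2 * (\<mu> * f (fst_vec z))) *\<^sub>R G (fst_vec z)) (exp (2 * f (fst_vec z)) *\<^sub>R H (snd_vec z))"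
    using W[of "fst_vec z" "snd_vec z"] by (simp add: prod_set_def)
  moreover have "exp (2 * f (fst_vec z)) * exp (2 * ((\<mu> - 1) * f (fst_vec z))) = exp (2 * (\<mu> * f (fst_vec z)))"
    by (simp add: exp_add[symmetric] algebra_simps)
  ultimately show ?thesis
    unfolding vec_eq_iff split_sum_all
    by (simp add: \<phi>_def \<theta>_def G1_def prod_metric_def mult.assoc[symmetric])
qed

private lemma \<phi>_derivs:
  assumes z: "z \<in> prod_set U V"
  shows "pderiv_at (Inl i) \<phi> z = pderiv_at i f (fst_vec z)" "pderiv_at (Inr j') \<phi> z = 0"
    "pderiv_at (Inl i) (pderiv_at (Inl j) \<phi>) z = pderiv_at i (pderiv_at j f) (fst_vec z)"
    "pderiv_at (Inr i') (pderiv_at (Inl j) \<phi>) z = 0" "pderiv_at s (pderiv_at (Inr j') \<phi>) z = 0"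
proof -
  have d: "f differentiable at (fst_vec z)" "pderiv_at j f differentiable at (fst_vec z)"
    if "z \<in> prod_set U V" for z j
    using that twice_diff_onD[OF f] by (auto simp: prod_set_def)
  have 1: "pderiv_at (Inl i) \<phi> z = pderiv_at i f (fst_vec z)" "pderiv_at (Inr j') \<phi> z = 0"
    if "z \<in> prod_set U V" for z i j'
    unfolding \<phi>_def[abs_def] using pderiv_at_fst_vec[OF d(1)[OF that]] by auto
  show "pderiv_at (Inl i) \<phi> z = pderiv_at i f (fst_vec z)" "pderiv_at (Inr j') \<phi> z = 0"
    using 1[OF z] by auto
  note c = pderiv_at_cong_on_open[OF open_prod_set[OF open_UV] z]
  have "pderiv_at s (pderiv_at (Inl j) \<phi>) z = pderiv_at s (\<lambda>z. pderiv_at j f (fst_vec z)) z" for s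
    by (rule c) (simp add: 1)
  then show "pderiv_at (Inl i) (pderiv_at (Inl j) \<phi>) z = pderiv_at i (pderiv_at j f) (fst_vec z)"
    "pderiv_at (Inr i') (pderiv_at (Inl j) \<phi>) z = 0"
    using pderiv_at_fst_vec[OF d(2)[OF z]] by auto
  have "pderiv_at s (pderiv_at (Inr j') \<phi>) z = pderiv_at s (\<lambda>z. 0) z"
    by (rule c) (simp add: 1)
  then show "pderiv_at s (pderiv_at (Inr j') \<phi>) z = 0"
    by simp
qed

text \<open>A function of the base coordinates has no derivative along the fibre and the mixed
  Christoffel symbols vanish, so its Hessian lives on the base block.\<close>

private lemma hess_\<phi>:
  assumes z: "z \<in> prod_set U V"
  shows "hess P \<phi> (Inl i) (Inl j) z = hess G1 f i j (fst_vec z)"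
    and "hess P \<phi> s (Inr j') z = 0" and "hess P \<phi> (Inr i') s z = 0"
proof -
  note simps = hess_def sum_UNIV_Plus \<phi>_derivs[OF z] prod_christoffel[OF G1 H z]
  show "hess P \<phi> (Inl i) (Inl j) z = hess G1 f i j (fst_vec z)"
    by (simp add: simps)
  show "hess P \<phi> s (Inr j') z = 0" "hess P \<phi> (Inr i') s z = 0"
    by (cases s; simp add: simps)+
qed

private lemma
  assumes z: "z \<in> prod_set U V"
  shows laplacian_\<phi>: "laplacian P \<phi> z = laplacian G1 f (fst_vec z)"
    and grad_prod_\<phi>: "grad_prod P \<phi> \<phi> z = grad_prod G1 f f (fst_vec z)"
proof -
  have "fst_vec z \<in> U" "snd_vec z \<in> V"
    using z by (auto simp: prod_set_def)
  then have i: "matrix_inv (P z) = block_diag (matrix_inv (G1 (fst_vec z))) (matrix_inv (H (snd_vec z)))"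
    unfolding prod_metric_def by (intro matrix_inv_block_diag metric_onD(2)[OF G1] metric_onD(2)[OF H])
  show "laplacian P \<phi> z = laplacian G1 f (fst_vec z)"
    by (simp add: laplacian_def sum_UNIV_Plus hess_\<phi>[OF z] i)
  show "grad_prod P \<phi> \<phi> z = grad_prod G1 f f (fst_vec z)"
    by (simp add: grad_prod_def grad_def sum_UNIV_Plus \<phi>_derivs[OF z] i)
qed

private lemma \<theta>_derivs:
  assumes x: "x \<in> U"
  shows "pderiv_at i \<theta> x = (\<mu> - 1) * pderiv_at i f x"
    and "grad_prod G f \<theta> x = (\<mu> - 1) * grad_prod G f f x"
    and "grad_prod G \<theta> \<theta> x = (\<mu> - 1)\<^sup>2 * grad_prod G f f x"
    and "hess G \<theta> i j x = (\<mu> - 1) * hess G f i j x"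
    and "laplacian G \<theta> x = (\<mu> - 1) * laplacian G f x"
proof -
  note d = twice_diff_onD[OF f]
  have 1: "pderiv_at i \<theta> x = (\<mu> - 1) * pderiv_at i f x" if "x \<in> U" for x i
    unfolding \<theta>_def[abs_def] by (rule pderiv_at_cmult[OF d(1)[OF that]])
  then show "pderiv_at i \<theta> x = (\<mu> - 1) * pderiv_at i f x"
    using x .
  show "grad_prod G f \<theta> x = (\<mu> - 1) * grad_prod G f f x"
    "grad_prod G \<theta> \<theta> x = (\<mu> - 1)\<^sup>2 * grad_prod G f f x"
    by (simp_all add: grad_prod_def grad_def 1[OF x] sum_distrib_left mult_ac power2_eq_square)
  have "pderiv_at i (pderiv_at j \<theta>) x = pderiv_at i (\<lambda>x. (\<mu> - 1) * pderiv_at j f x) x" for i j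
    by (rule pderiv_at_cong_on_open[OF open_UV(1) x 1])
  then show h: "hess G \<theta> i j x = (\<mu> - 1) * hess G f i j x" for i j
    by (simp add: hess_def 1[OF x] pderiv_at_cmult[OF d(2)[OF x]] right_diff_distrib sum_distrib_left mult_ac)
  show "laplacian G \<theta> x = (\<mu> - 1) * laplacian G f x"
    by (simp add: laplacian_def h sum_distrib_left mult_ac)
qed

private lemma ricci_W:
  assumes z: "z \<in> prod_set U V"
  shows "ricci_coord W z $ s $ t = ricci_coord P z $ s $ t
    - (real CARD('m) + real CARD('k) - 2) * (hess P \<phi> t s z - pderiv_at t \<phi> z * pderiv_at s \<phi> z)
    - (laplacian G1 f (fst_vec z) + (real CARD('m) + real CARD('k) - 2) * grad_prod G1 f f (fst_vec z)) * P z $ t $ s"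
  using conformal_ricci[where G = P and G' = W and \<phi> = \<phi>, OF P \<phi> W_conformal z]
  unfolding laplacian_\<phi>[OF z] grad_prod_\<phi>[OF z] by simp

text \<open>Along the fibre the differential and the Hessian of \<open>\<phi>\<close> vanish, so
  only the trace term of the conformal formula acts. With \<open>m\<close> and \<open>k\<close> the
  dimensions, the coefficient of the gradient term is the sum of
  \<open>(m - 2) * (\<mu> - 1)\<close>, from the Laplacian of the rescaled base metric, and
  \<open>m + k - 2\<close>, from the change by \<open>f\<close>.\<close>

theorem warped_ricci_fiber:
  assumes x: "x \<in> U" and y: "y \<in> V"
  shows "ricci_coord W (join_vec x y) $ Inr i $ Inr j = ricci_coord H y $ i $ j
    - exp (- (2 * ((\<mu> - 1) * f x))) * (laplacian G f x
        + ((real CARD('m) - 2) * \<mu> + real CARD('k)) * grad_prod G f f x) * H y $ i $ j"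
proof -
  let ?z = "join_vec x y"
  have z: "?z \<in> prod_set U V"
    using x y by simp
  show ?thesis
    unfolding ricci_W[OF z] ricci_prod[OF G1 H z] hess_\<phi>[OF z] \<phi>_derivs[OF z]
    using metric_onD(3)[OF H y, of j i]
    by (simp add: prod_metric_def conformal_laplacian[OF G \<theta> G1_def x] conformal_grad_prod[OF G \<theta> G1_def x]
        \<theta>_derivs[OF x] \<theta>_def[of x]) (simp add: algebra_simps)
qed

lemma warped_ricci_mixed:
  assumes x: "x \<in> U" and y: "y \<in> V"
  shows "ricci_coord W (join_vec x y) $ Inl i $ Inr j' = 0"
    and "ricci_coord W (join_vec x y) $ Inr j' $ Inl i = 0"
proof -
  have z: "join_vec x y \<in> prod_set U V"
    using x y by simp
  show "ricci_coord W (join_vec x y) $ Inl i $ Inr j' = 0"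
    "ricci_coord W (join_vec x y) $ Inr j' $ Inl i = 0"
    unfolding ricci_W[OF z] ricci_prod[OF G1 H z] hess_\<phi>[OF z] \<phi>_derivs[OF z]
    by (simp_all add: prod_metric_def)
qed

text \<open>The two conformal changes add up. With \<open>m\<close> and \<open>k\<close> the
  dimensions, the Hessian receives \<open>(m - 2) * (\<mu> - 1)\<close> from the change of the base
  metric and \<open>m + k - 2\<close> from the change by \<open>f\<close>; the Laplacian receives
  \<open>\<mu> - 1\<close> and 1. Terms quadratic in first derivatives vanish at a critical
  point.\<close>

theorem warped_ricci_base_critical:
  assumes x: "x \<in> U" and y: "y \<in> V" and crit: "\<And>i. pderiv_at i f x = 0"
  shows "ricci_coord W (join_vec x y) $ Inl i $ Inl j = ricci_coord G x $ i $ j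
    - ((real CARD('m) - 2) * \<mu> + real CARD('k)) * hess G f j i x - \<mu> * laplacian G f x * G x $ i $ j"
proof -
  let ?z = "join_vec x y"
  have z: "?z \<in> prod_set U V"
    using x y by simp
  have g: "grad_prod G f f x = 0"
    by (simp add: grad_prod_def crit)
  have e: "exp (- (2 * \<theta> x)) * (c * (exp (2 * \<theta> x) * d)) = c * d" for c d
    by (simp add: exp_minus)
  show ?thesis
    unfolding ricci_W[OF z] ricci_prod[OF G1 H z] hess_\<phi>[OF z] \<phi>_derivs[OF z]
    using metric_onD(3)[OF G x, of j i]
    by (simp add: prod_metric_def conformal_laplacian[OF G \<theta> G1_def x] conformal_grad_prod[OF G \<theta> G1_def x]
        conformal_ricci[OF G \<theta> G1_def x] conformal_hess[OF G \<theta> G1_def x] \<theta>_derivs[OF x] g crit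
        conformal_entry[OF G \<theta> G1_def x] mult.assoc e) (simp add: algebra_simps)
qed

end

section \<open>Maximum principles\<close>

lemma quadratic_form_insert:
  fixes A :: "'a \<Rightarrow> 'a \<Rightarrow> real"
  assumes "finite S" "s \<notin> S"
  shows "(\<Sum>i\<in>insert s S. \<Sum>j\<in>insert s S. A i j) = A s s + (\<Sum>j\<in>S. A s j) + (\<Sum>i\<in>S. A i s) + (\<Sum>i\<in>S. \<Sum>j\<in>S. A i j)"
  using assms by (simp add: sum.distrib)

text \<open>Induction on the index set, with the Schur complement of a diagonal entry of \<open>A\<close>.\<close>

lemma trace_psd_nsd_nonpos:
  fixes A H :: "'a \<Rightarrow> 'a \<Rightarrow> real"
  assumes "finite S" "\<And>i j. A i j = A j i"
    and "\<And>v. 0 \<le> (\<Sum>i\<in>S. \<Sum>j\<in>S. A i j * v i * v j)"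
    and "\<And>v. (\<Sum>i\<in>S. \<Sum>j\<in>S. H i j * v i * v j) \<le> 0"
  shows "(\<Sum>i\<in>S. \<Sum>j\<in>S. A i j * H i j) \<le> 0"
  using assms
proof (induction S arbitrary: A rule: finite_induct)
  case (insert s S)
  have nsdS: "(\<Sum>i\<in>S. \<Sum>j\<in>S. H i j * v i * v j) \<le> 0" for v
  proof -
    have "(\<Sum>i\<in>S. \<Sum>j\<in>S. H i j * v i * v j) = (\<Sum>i\<in>S. \<Sum>j\<in>S. H i j * (v(s := 0)) i * (v(s := 0)) j)"
      using insert.hyps by (intro sum.cong refl) auto
    also have "\<dots> = (\<Sum>i\<in>insert s S. \<Sum>j\<in>insert s S. H i j * (v(s := 0)) i * (v(s := 0)) j)"
      unfolding quadratic_form_insert[OF insert.hyps] by simp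
    finally show ?thesis
      using insert.prems(3)[of "v(s := 0)"] by linarith
  qed
  have form: "(\<Sum>i\<in>insert s S. \<Sum>j\<in>insert s S. A i j * w i * w j)
      = A s s * (w s)\<^sup>2 + 2 * w s * (\<Sum>j\<in>S. A s j * w j) + (\<Sum>i\<in>S. \<Sum>j\<in>S. A i j * w i * w j)" for w
  proof -
    have "(\<Sum>i\<in>S. A i s * w i * w s) = (\<Sum>j\<in>S. A s j * w s * w j)"
      using insert.prems(1) by (intro sum.cong refl) (metis mult.assoc mult.commute)
    then show ?thesis
      unfolding quadratic_form_insert[OF insert.hyps] by (simp add: power2_eq_square sum_distrib_left mult_ac)
  qed
  have vS: "(\<Sum>j\<in>S. A s j * (v(s := c)) j) = (\<Sum>j\<in>S. A s j * v j)"
    "(\<Sum>i\<in>S. \<Sum>j\<in>S. A i j * (v(s := c)) i * (v(s := c)) j) = (\<Sum>i\<in>S. \<Sum>j\<in>S. A i j * v i * v j)" for v c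
    using insert.hyps by (auto intro!: sum.cong)
  have ge0: "0 \<le> A s s * c\<^sup>2 + 2 * c * (\<Sum>j\<in>S. A s j * v j) + (\<Sum>i\<in>S. \<Sum>j\<in>S. A i j * v i * v j)" for v c
    using insert.prems(2)[of "v(s := c)"] unfolding form vS by simp
  have Ass: "A s s \<ge> 0"
    using ge0[of 1 "\<lambda>_. 0"] by simp
  show ?case
  proof (cases "A s s = 0")
    case True
    \<comment> \<open>A vanishing diagonal entry makes the form affine in the coordinate
      \<open>c\<close> at \<open>s\<close>; as it is bounded below, it has no linear term.\<close>
    have "A s j = 0" if "j \<in> S" for j
    proof (rule ccontr)
      assume n: "A s j \<noteq> 0"
      let ?v = "\<lambda>i. if i = j then 1 else 0 :: real"
      have "(\<Sum>i\<in>S. A s i * ?v i) = A s j"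
        using that insert.hyps by (simp add: if_zero_mult)
      then have "0 \<le> 2 * c * A s j + (\<Sum>i\<in>S. \<Sum>k\<in>S. A i k * ?v i * ?v k)" for c
        using ge0[of c ?v] True by simp
      \<comment> \<open>For this \<open>c\<close> the affine function takes the value -1.\<close>
      from this[of "- (1 + (\<Sum>i\<in>S. \<Sum>k\<in>S. A i k * ?v i * ?v k)) / (2 * A s j)"] n
      moreover have "2 * (- (1 + q) / (2 * A s j)) * A s j = - (1 + q)" for q
        using n by (simp add: field_simps)
      ultimately have "0 \<le> - (1 + (\<Sum>i\<in>S. \<Sum>k\<in>S. A i k * ?v i * ?v k)) + (\<Sum>i\<in>S. \<Sum>k\<in>S. A i k * ?v i * ?v k)"
        by metis
      then show False
        by linarith
    qed
    moreover from this have "A i s = 0" if "i \<in> S" for i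
      using that insert.prems(1) by metis
    ultimately have "(\<Sum>i\<in>insert s S. \<Sum>j\<in>insert s S. A i j * H i j) = (\<Sum>i\<in>S. \<Sum>j\<in>S. A i j * H i j)"
      unfolding quadratic_form_insert[OF insert.hyps] by (simp add: True)
    moreover have "(\<Sum>i\<in>S. \<Sum>j\<in>S. A i j * H i j) \<le> 0"
      using ge0[of 0] by (intro insert.IH insert.prems(1) nsdS) simp
    ultimately show ?thesis
      by simp
  next
    case False
    let ?A = "\<lambda>i j. A i j - A i s * A s j / A s s"
    have "(\<Sum>i\<in>S. \<Sum>j\<in>S. ?A i j * H i j) \<le> 0"
    proof (rule insert.IH[OF _ _ nsdS])
      show "?A i j = ?A j i" for i j
        using insert.prems(1)[of i j] insert.prems(1)[of i s] insert.prems(1)[of j s] by (simp add: mult.commute)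
      fix v
      let ?a = "\<Sum>j\<in>S. A s j * v j"
      have "(\<Sum>i\<in>S. \<Sum>j\<in>S. ?A i j * v i * v j) = (\<Sum>i\<in>S. \<Sum>j\<in>S. A i j * v i * v j) - (\<Sum>i\<in>S. A s i * v i) * ?a / A s s"
        unfolding sum_product sum_divide_distrib sum_subtractf[symmetric]
      proof (intro sum.cong refl)
        fix i j
        show "?A i j * v i * v j = A i j * v i * v j - A s i * v i * (A s j * v j) / A s s"
          using insert.prems(1)[of i s] by (simp add: algebra_simps)
      qed
      \<comment> \<open>For given \<open>v\<close> the value \<open>- ?a / A s s\<close> of the
        coordinate at \<open>s\<close> minimises the form, and the minimum is the form of the Schur
        complement.\<close>
      moreover have "0 \<le> A s s * (- ?a / A s s)\<^sup>2 + 2 * (- ?a / A s s) * ?a + (\<Sum>i\<in>S. \<Sum>j\<in>S. A i j * v i * v j)"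
        by (rule ge0)
      moreover have "A s s * (- ?a / A s s)\<^sup>2 + 2 * (- ?a / A s s) * ?a = - (?a * ?a / A s s)"
        using False by (simp add: power2_eq_square field_simps)
      ultimately show "0 \<le> (\<Sum>i\<in>S. \<Sum>j\<in>S. ?A i j * v i * v j)"
        by simp
    qed
    moreover have "(\<Sum>i\<in>insert s S. \<Sum>j\<in>insert s S. ?A i j * H i j) = (\<Sum>i\<in>S. \<Sum>j\<in>S. ?A i j * H i j)"
      unfolding quadratic_form_insert[OF insert.hyps] using False by simp
    \<comment> \<open>The difference of the two matrices has rank one and is built from the row
      \<open>A s\<close>; its pairing with \<open>H\<close> is the form of \<open>H\<close> at that
      row, divided by \<open>A s s\<close>.\<close>
    moreover have "(\<Sum>i\<in>insert s S. \<Sum>j\<in>insert s S. A i j * H i j) = (\<Sum>i\<in>insert s S. \<Sum>j\<in>insert s S. ?A i j * H i j)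
        + (\<Sum>i\<in>insert s S. \<Sum>j\<in>insert s S. H i j * A s i * A s j) / A s s"
      unfolding sum_divide_distrib sum.distrib[symmetric]
    proof (intro sum.cong refl)
      fix i j
      show "A i j * H i j = ?A i j * H i j + H i j * A s i * A s j / A s s"
        using insert.prems(1)[of i s] by (simp add: algebra_simps)
    qed
    moreover have "(\<Sum>i\<in>insert s S. \<Sum>j\<in>insert s S. H i j * A s i * A s j) / A s s \<le> 0"
      using insert.prems(3) Ass by (intro divide_nonpos_nonneg)
    ultimately show ?thesis
      by linarith
  qed
qed simp

section \<open>Necessary conditions at an interior maximum\<close>

lemma gradient_zero_at_max:
  assumes "open U" "x \<in> U" "f differentiable at x" "\<And>y. y \<in> U \<Longrightarrow> f y \<le> f x"
  shows "pderiv_at i f x = 0"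
  using differential_zero_maxmin[OF assms(2,1) has_derivative_frechet[OF assms(3)]] assms(4)
  by (auto simp: pderiv_at_def)

text \<open>If the form were positive at \<open>v\<close>, the derivative along \<open>v\<close>,
  which vanishes at \<open>x\<close>, would be positive shortly after \<open>x\<close>, and by the
  mean value theorem \<open>f\<close> would exceed its maximum.\<close>

lemma hessian_nonpos_at_max:
  assumes "open U" "x \<in> U" "twice_diff_on U f" "\<And>y. y \<in> U \<Longrightarrow> f y \<le> f x"
  shows "(\<Sum>i\<in>UNIV. \<Sum>j\<in>UNIV. pderiv_at i (pderiv_at j f) x * v $ i * v $ j) \<le> 0"
proof (rule ccontr)
  assume "\<not> ?thesis"
  then have pos: "0 < (\<Sum>i\<in>UNIV. \<Sum>j\<in>UNIV. pderiv_at i (pderiv_at j f) x * v $ i * v $ j)" (is "0 < ?Q")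
    by simp
  note d = twice_diff_onD[OF assms(3)]
  have der: "((\<lambda>t. h (x + t *\<^sub>R v)) has_real_derivative (\<Sum>i\<in>UNIV. v $ i * pderiv_at i h (x + t *\<^sub>R v))) (at t)"
    if "h differentiable at (x + t *\<^sub>R v)" for h :: "real^'a \<Rightarrow> real" and t
  proof -
    have l: "((\<lambda>t. x + t *\<^sub>R v) has_derivative (\<lambda>t. t *\<^sub>R v)) (at t)"
      by (auto intro!: derivative_eq_intros)
    have "(\<lambda>s. \<Sum>i\<in>UNIV. (s *\<^sub>R v) $ i * pderiv_at i h (x + t *\<^sub>R v))
        = (*) (\<Sum>i\<in>UNIV. v $ i * pderiv_at i h (x + t *\<^sub>R v))"
      by (rule ext) (simp add: sum_distrib_left mult_ac)
    with has_derivative_compose[OF l has_derivative_pderiv_at[OF that]]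
    show ?thesis
      by (simp only: has_field_derivative_def)
  qed
  let ?g' = "\<lambda>t. \<Sum>i\<in>UNIV. v $ i * pderiv_at i f (x + t *\<^sub>R v)"
  have g'0: "?g' 0 = 0"
    using gradient_zero_at_max[OF assms(1,2) d(1)[OF assms(2)] assms(4)] by simp
  have "(?g' has_real_derivative (\<Sum>j\<in>UNIV. v $ j * (\<Sum>i\<in>UNIV. v $ i * pderiv_at i (pderiv_at j f) (x + 0 *\<^sub>R v)))) (at 0)"
    using d(2)[OF assms(2)] by (intro DERIV_sum DERIV_cmult der) simp
  moreover have "(\<Sum>j\<in>UNIV. v $ j * (\<Sum>i\<in>UNIV. v $ i * pderiv_at i (pderiv_at j f) (x + 0 *\<^sub>R v))) = ?Q"
    by (subst sum.swap) (simp add: sum_distrib_left mult_ac)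
  ultimately obtain e where e: "e > 0" "\<And>t. 0 < t \<Longrightarrow> t < e \<Longrightarrow> ?g' 0 < ?g' (0 + t)"
    using DERIV_pos_inc_right[of ?g' ?Q 0] pos by auto
  have "((\<lambda>t. x + t *\<^sub>R v) \<longlongrightarrow> x + 0 *\<^sub>R v) (at 0)"
    by (intro tendsto_intros)
  then have "\<forall>\<^sub>F t in at 0. x + t *\<^sub>R v \<in> U"
    using assms(1,2) topological_tendstoD by fastforce
  then obtain r where r: "r > 0" "\<And>t. t \<noteq> 0 \<Longrightarrow> \<bar>t\<bar> < r \<Longrightarrow> x + t *\<^sub>R v \<in> U"
    unfolding eventually_at by (auto simp: dist_real_def)
  define t where "t = min e r / 2"
  have t: "0 < t" "t < e" "t < r"
    using e r by (auto simp: t_def)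
  have inU: "x + s *\<^sub>R v \<in> U" if "0 \<le> s" "s \<le> t" for s
    using that t r(2)[of s] assms(2) by (cases "s = 0") auto
  have "\<exists>z. z > 0 \<and> z < t \<and> f (x + t *\<^sub>R v) - f (x + 0 *\<^sub>R v) = (t - 0) * ?g' z"
    using d(1)[OF inU] by (intro MVT2[OF t(1)] der) auto
  then obtain z where z: "0 < z" "z < t" "f (x + t *\<^sub>R v) - f x = t * ?g' z"
    by auto
  have "?g' z > 0"
    using e(2)[of z] z t g'0 by simp
  then have "t * ?g' z > 0"
    using t by simp
  moreover have "f (x + t *\<^sub>R v) \<le> f x"
    using inU[of t] t assms(4) by simp
  ultimately show False
    using z by linarith
qed

lemma elliptic_nonpos_at_max:
  fixes f :: "real^'n::finite \<Rightarrow> real"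
  assumes "open U" "x \<in> U" "twice_diff_on U f" "\<And>y. y \<in> U \<Longrightarrow> f y \<le> f x"
    and "\<And>i j. A i j = A j i" "\<And>v. 0 \<le> (\<Sum>i\<in>UNIV. \<Sum>j\<in>UNIV. A i j * v i * v j)"
  shows "(\<Sum>i\<in>UNIV. \<Sum>j\<in>UNIV. A i j * pderiv_at i (pderiv_at j f) x) \<le> (0::real)"
proof (rule trace_psd_nsd_nonpos)
  show "(\<Sum>i\<in>UNIV. \<Sum>j\<in>UNIV. pderiv_at i (pderiv_at j f) x * v i * v j) \<le> 0" for v :: "'n::finite \<Rightarrow> real"
    using hessian_nonpos_at_max[OF assms(1-4), of "\<chi> i. v i"] by simp
qed (use assms in auto)

text \<open>The part of the second derivatives that is quadratic in \<open>\<alpha>\<close>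
  dominates, away from \<open>c\<close>, everything linear in \<open>\<alpha>\<close>; this is what
  qualifies a Gaussian as a barrier.\<close>

lemma gaussian_derivs:
  fixes c x :: "real^'n::finite" and \<alpha> :: real
  defines "h \<equiv> \<lambda>x. exp (- \<alpha> * (norm (x - c))\<^sup>2)"
  shows "twice_diff_on U h"
    and "pderiv_at i h x = - 2 * \<alpha> * (x - c) $ i * h x"
    and "pderiv_at i (pderiv_at j h) x = (4 * \<alpha>\<^sup>2 * (x - c) $ i * (x - c) $ j - (if i = j then 2 * \<alpha> else 0)) * h x"
proof -
  define q where "q = (\<lambda>x. - \<alpha> * (norm (x - c))\<^sup>2)"
  have hq: "h = (\<lambda>x. exp (q x))"
    by (simp add: h_def q_def)
  have dq: "(q has_derivative (\<lambda>v. - \<alpha> * (2 * ((x - c) \<bullet> v)))) (at x)" for x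
    unfolding q_def power2_norm_eq_inner
    by (auto intro!: derivative_eq_intros simp: inner_commute)
  have dq': "q differentiable at x" for x
    using dq differentiableI by blast
  have pq: "pderiv_at i q = (\<lambda>x. - 2 * \<alpha> * (x $ i - c $ i))" for i
    using pderiv_at_eq[OF dq] by (simp add: fun_eq_iff inner_axis)
  have comp: "(\<lambda>x. x $ i) differentiable at x" for x :: "real^'n" and i
    by (rule differentiableI[OF bounded_linear_imp_has_derivative[OF bounded_linear_vec_nth]])
  have dpq: "pderiv_at i q differentiable at x" for i x
    unfolding pq by (intro differentiable_mult differentiable_diff differentiable_const comp)
  show td: "twice_diff_on U h" for U
    unfolding hq using twice_diff_on_exp[OF open_UNIV, of q] dq' dpq by (auto simp: twice_diff_on_def)
  have ph: "pderiv_at i h = (\<lambda>x. pderiv_at i q x * h x)" for i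
    unfolding hq using pderiv_at_exp[OF dq'] by (simp add: fun_eq_iff)
  then show "pderiv_at i h x = - 2 * \<alpha> * (x - c) $ i * h x"
    by (simp add: pq)
  have "pderiv_at i (pderiv_at j h) x = pderiv_at i (pderiv_at j q) x * h x + pderiv_at j q x * pderiv_at i h x"
    unfolding ph[of j] using twice_diff_onD(1)[OF td] by (intro pderiv_at_mult dpq) auto
  moreover have "pderiv_at i (pderiv_at j q) x = - 2 * \<alpha> * (if i = j then 1 else 0)"
    unfolding pq[of j] pderiv_at_cmult[OF differentiable_diff[OF comp differentiable_const]]
      pderiv_at_diff[OF comp differentiable_const] by (simp add: pderiv_at_component)
  ultimately show "pderiv_at i (pderiv_at j h) x = (4 * \<alpha>\<^sup>2 * (x - c) $ i * (x - c) $ j - (if i = j then 2 * \<alpha> else 0)) * h x"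
    unfolding ph[of i] pq by (cases "i = j") (simp_all add: algebra_simps power2_eq_square)
qed

text \<open>Hopf's barrier argument: if the maximum \<open>M\<close> were not attained on a whole neighbourhood of \<open>y\<close>,
  some ball on which \<open>f < M\<close> would touch \<open>{f = M}\<close> in exactly one point \<open>z\<close>; adding a small multiple of
  a Gaussian \<open>h\<close> centred in that ball makes \<open>f\<close> a strict subsolution near \<open>z\<close> with an interior maximum.\<close>

theorem strong_maximum_principle:
  fixes f :: "real^'n::finite \<Rightarrow> real" and A :: "'n \<Rightarrow> 'n \<Rightarrow> real^'n \<Rightarrow> real" and b :: "'n \<Rightarrow> real^'n \<Rightarrow> real"
  assumes U: "open U" and f: "twice_diff_on U f"
    and A: "\<And>i j. continuous_on U (A i j)" "\<And>x i j. x \<in> U \<Longrightarrow> A i j x = A j i x"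
    and Apos: "\<And>x v. x \<in> U \<Longrightarrow> v \<noteq> 0 \<Longrightarrow> 0 < (\<Sum>i\<in>UNIV. \<Sum>j\<in>UNIV. A i j x * (v $ i * v $ j))"
    and b: "\<And>i. continuous_on U (b i)"
    and L: "\<And>x. x \<in> U \<Longrightarrow> 0 \<le> (\<Sum>i\<in>UNIV. \<Sum>j\<in>UNIV. A i j x * pderiv_at i (pderiv_at j f) x)
        + (\<Sum>i\<in>UNIV. b i x * pderiv_at i f x)"
    and M: "\<And>x. x \<in> U \<Longrightarrow> f x \<le> M" and y: "y \<in> U" "f y = M"
  shows "\<exists>r>0. ball y r \<subseteq> U \<and> (\<forall>x\<in>ball y r. f x = M)"
proof -
  obtain r0 where r0: "r0 > 0" "cball y r0 \<subseteq> U"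
    using U y(1) open_contains_cball by blast
  \<comment> \<open>Halving the radius ensures that a ball of radius less than \<open>r\<close>
    about a point of \<open>ball y r\<close> stays in \<open>cball y (2 * r)\<close>, the ball over
    which \<open>K\<close> is formed.\<close>
  define r where "r = r0 / 2"
  have r: "r > 0" "cball y (2 * r) \<subseteq> U"
    using r0 by (auto simp: r_def)
  have cf: "continuous_on U f"
    using twice_diff_onD(1)[OF f] by (meson continuous_at_imp_continuous_on differentiable_imp_continuous_within)
  have "f x0 = M" if x0: "x0 \<in> ball y r" for x0
  proof (rule ccontr)
    assume ne: "f x0 \<noteq> M"
    define K where "K = {x \<in> cball y (2 * r). f x = M}"
    have "closed K"
      unfolding K_def using continuous_closed_preimage_constant[of "cball y (2 * r)" f M] cf r(2)
      by (meson closed_cball continuous_on_subset)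
    moreover have "y \<in> K"
      using r y by (simp add: K_def)
    ultimately obtain z where z: "z \<in> K" and zmin: "\<And>x. x \<in> K \<Longrightarrow> dist x0 z \<le> dist x0 x"
      using distance_attains_inf[of K x0] by blast
    define d where "d = norm (z - x0)"
    have d: "0 < d" "d < r"
      using ne z zmin[OF \<open>y \<in> K\<close>] x0 unfolding K_def d_def by (auto simp: dist_norm norm_minus_commute)
    have less: "f x < M" if "norm (x - x0) < d" for x
    proof -
      have "dist y x \<le> dist y x0 + dist x0 x"
        by (rule dist_triangle)
      then have x: "x \<in> cball y (2 * r)"
        using x0 that d by (simp add: dist_norm norm_minus_commute)
      moreover have "x \<notin> K"
        using zmin[of x] that unfolding d_def by (auto simp: dist_norm norm_minus_commute)
      ultimately show ?thesis
        using M[of x] r(2) unfolding K_def by force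
    qed
    \<comment> \<open>The large ball about \<open>x0\<close> may touch \<open>K\<close> in several
      points. The ball of half the radius about \<open>x1\<close> touches the large one from inside
      at \<open>z\<close>, so its closure meets \<open>K\<close> in \<open>z\<close> alone.\<close>
    define x1 where "x1 = x0 + (1/2) *\<^sub>R (z - x0)"
    define R where "R = norm (z - x1)"
    have z1: "z - x1 = (1/2) *\<^sub>R (z - x0)" "x1 - x0 = z - x1"
      by (simp_all add: x1_def vec_eq_iff field_simps)
    have "R = d / 2"
      unfolding R_def z1(1) d_def by simp
    then have dR: "d = 2 * R" and R: "R > 0"
      using d(1) by simp_all
    have touch: "f x < M" if "norm (x - x1) \<le> R" "x \<noteq> z" for x
    proof (rule less)
      \<comment> \<open>Parallelogram law for \<open>x - x1\<close> and \<open>z - x1\<close>: the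
        squared distances of \<open>x\<close> from \<open>x0\<close> and from \<open>z\<close> sum
        to at most \<open>d\<^sup>2\<close>, so \<open>x\<close> lies strictly inside the large ball
        unless it is \<open>z\<close>.\<close>
      have "x - x0 = (x - x1) + (z - x1)" "x - z = (x - x1) - (z - x1)"
        using z1(2) by (simp_all add: algebra_simps)
      moreover have "(norm (a + c))\<^sup>2 + (norm (a - c))\<^sup>2 = 2 * (norm a)\<^sup>2 + 2 * (norm c)\<^sup>2" for a c :: "real^'n"
        by (simp add: power2_norm_eq_inner inner_simps inner_commute)
      ultimately have "(norm (x - x0))\<^sup>2 + (norm (x - z))\<^sup>2 = 2 * (norm (x - x1))\<^sup>2 + 2 * R\<^sup>2"
        unfolding R_def by metis
      moreover have "(norm (x - x1))\<^sup>2 \<le> R\<^sup>2"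
        using that by (intro power_mono) auto
      moreover have "(norm (x - z))\<^sup>2 > 0"
        using that by simp
      ultimately have "(norm (x - x0))\<^sup>2 < d\<^sup>2"
        unfolding dR by (simp add: power2_eq_square)
      then show "norm (x - x0) < d"
        using d by (simp add: power2_less_imp_less)
    qed
    have zy: "dist y z < 2 * r"
      using dist_triangle[of y z x0] x0 d by (simp add: dist_norm norm_minus_commute d_def)
    \<comment> \<open>The bound \<open>R / 2\<close> keeps the centre \<open>x1\<close> of the
      Gaussian, where its gradient vanishes, out of \<open>cball z \<rho>\<close>; the other bound
      keeps this ball inside \<open>U\<close>.\<close>
    define \<rho> where "\<rho> = min (2 * r - dist y z) (R / 2)"
    have \<rho>: "\<rho> > 0" "\<rho> \<le> R / 2" "\<rho> \<le> 2 * r - dist y z"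
      using zy R unfolding \<rho>_def by linarith+
    have C: "cball z \<rho> \<subseteq> U"
    proof
      fix x assume "x \<in> cball z \<rho>"
      then have "dist y x \<le> 2 * r"
        using dist_triangle[of y x z] \<rho> by simp
      then show "x \<in> U"
        using r(2) by auto
    qed
    have ne1: "x - x1 \<noteq> 0" if "x \<in> cball z \<rho>" for x
      using that \<rho> R unfolding R_def by (auto simp: dist_norm)
    let ?E = "\<lambda>x. \<Sum>i\<in>UNIV. \<Sum>j\<in>UNIV. A i j x * ((x - x1) $ i * (x - x1) $ j)"
    let ?F = "\<lambda>x. (\<Sum>i\<in>UNIV. A i i x) + (\<Sum>i\<in>UNIV. b i x * (x - x1) $ i)"
    have AC: "continuous_on (cball z \<rho>) (A i j)" "continuous_on (cball z \<rho>) (b i)" for i j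
      using A(1) b C continuous_on_subset by blast+
    have cE: "continuous_on (cball z \<rho>) ?E" and cF: "continuous_on (cball z \<rho>) ?F"
      by (intro continuous_intros AC)+
    have cne: "compact (cball z \<rho>)" "cball z \<rho> \<noteq> {}"
      using \<rho> by auto
    obtain p0 where p0: "p0 \<in> cball z \<rho>" "\<And>x. x \<in> cball z \<rho> \<Longrightarrow> ?E p0 \<le> ?E x"
      using continuous_attains_inf[OF cne cE] by blast
    obtain p1 where p1: "p1 \<in> cball z \<rho>" "\<And>x. x \<in> cball z \<rho> \<Longrightarrow> ?F x \<le> ?F p1"
      using continuous_attains_sup[OF cne cF] by blast
    have E0: "?E p0 > 0"
      using Apos[OF _ ne1] p0(1) C by blast
    \<comment> \<open>The operator applied to \<open>h\<close> is
      \<open>2 * \<alpha> * h x * (2 * (\<alpha> * ?E x) - ?F x)\<close>. With this choice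
      \<open>\<alpha> * ?E x\<close> is at least \<open>\<bar>?F p1\<bar> + 1\<close> on the whole
      ball, where \<open>?F p1\<close> is the maximum of \<open>?F\<close>.\<close>
    define \<alpha> where "\<alpha> = (\<bar>?F p1\<bar> + 1) / ?E p0"
    have \<alpha>: "\<alpha> > 0" and \<alpha>E: "\<alpha> * ?E p0 = \<bar>?F p1\<bar> + 1"
      using E0 unfolding \<alpha>_def by auto
    define h where "h = (\<lambda>x. exp (- \<alpha> * (norm (x - x1))\<^sup>2))"
    have gd: "twice_diff_on S h" "pderiv_at i h x = - 2 * \<alpha> * (x - x1) $ i * h x"
      "pderiv_at i (pderiv_at j h) x = (4 * \<alpha>\<^sup>2 * (x - x1) $ i * (x - x1) $ j - (if i = j then 2 * \<alpha> else 0)) * h x"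
      for S i j x
      unfolding h_def by (rule gaussian_derivs)+
    have Lh: "0 < (\<Sum>i\<in>UNIV. \<Sum>j\<in>UNIV. A i j x * pderiv_at i (pderiv_at j h) x) + (\<Sum>i\<in>UNIV. b i x * pderiv_at i h x)"
      if x: "x \<in> cball z \<rho>" for x
    proof -
      define w where "w = x - x1"
      have "(\<Sum>i\<in>UNIV. \<Sum>j\<in>UNIV. A i j x * pderiv_at i (pderiv_at j h) x) + (\<Sum>i\<in>UNIV. b i x * pderiv_at i h x)
        = h x * (4 * \<alpha>\<^sup>2 * ?E x - 2 * \<alpha> * (\<Sum>i\<in>UNIV. A i i x) - 2 * \<alpha> * (\<Sum>i\<in>UNIV. b i x * (x - x1) $ i))"
        unfolding gd w_def[symmetric]
        by (simp add: algebra_simps sum.distrib sum_subtractf sum_negf sum_distrib_left if_zero_mult)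
      moreover have "4 * \<alpha>\<^sup>2 * ?E x - 2 * \<alpha> * (\<Sum>i\<in>UNIV. A i i x) - 2 * \<alpha> * (\<Sum>i\<in>UNIV. b i x * (x - x1) $ i)
        = 2 * \<alpha> * (2 * (\<alpha> * ?E x) - ?F x)"
        by (simp add: algebra_simps power2_eq_square)
      moreover have "\<alpha> * ?E p0 \<le> \<alpha> * ?E x"
        using p0(2)[OF x] \<alpha> by (intro mult_left_mono) auto
      then have "0 < 2 * (\<alpha> * ?E x) - ?F x"
        using \<alpha>E p1(2)[OF x] by linarith
      ultimately show ?thesis
        using \<alpha> by (simp add: h_def)
    qed
    define h0 where "h0 = exp (- \<alpha> * R\<^sup>2)"
    have hz: "h z = h0"
      by (simp add: h_def h0_def R_def)
    let ?S = "sphere z \<rho> \<inter> cball x1 R"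
    \<comment> \<open>The point \<open>z\<close> is not on the sphere, so \<open>f\<close> stays
      below \<open>M\<close> on the compact set \<open>?S\<close> by a fixed amount. If
      \<open>?S\<close> is empty, any positive number will do.\<close>
    obtain \<delta> where \<delta>: "\<delta> > 0" "\<And>x. x \<in> ?S \<Longrightarrow> f x \<le> M - \<delta>"
    proof (cases "?S = {}")
      case True
      then show ?thesis
        using that[of 1] by auto
    next
      case False
      have "compact ?S"
        by (simp add: compact_Int)
      moreover have "continuous_on ?S f"
        using C by (intro continuous_on_subset[OF cf]) auto
      ultimately obtain s where s: "s \<in> ?S" "\<And>x. x \<in> ?S \<Longrightarrow> f x \<le> f s"
        using continuous_attains_sup[of ?S f] False by blast
      have "f s < M"
        using s(1) \<rho>(1) by (intro touch) (auto simp: dist_norm norm_minus_commute)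
      then show ?thesis
        using that[of "M - f s"] s(2) by auto
    qed
    let ?u = "\<lambda>x. f x + \<delta> * h x"
    have tdh: "twice_diff_on U (\<lambda>x. \<delta> * h x)"
      by (rule twice_diff_on_cmult[OF U gd(1)])
    have tdu: "twice_diff_on U ?u"
      by (rule twice_diff_on_add[OF U f tdh])
    have cu: "continuous_on (cball z \<rho>) ?u"
      using C cf by (auto simp: h_def intro!: continuous_intros intro: continuous_on_subset)
    obtain p where p: "p \<in> cball z \<rho>" "\<And>x. x \<in> cball z \<rho> \<Longrightarrow> ?u x \<le> ?u p"
      using continuous_attains_sup[OF cne cu] by blast
    \<comment> \<open>Comparison on the sphere with the value \<open>M + \<delta> * h0\<close> of
      \<open>?u\<close> at \<open>z\<close>: inside the ball about \<open>x1\<close> the gap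
      \<open>\<delta>\<close> absorbs \<open>\<delta> * h x\<close>, and outside it the Gaussian is
      smaller than at \<open>z\<close>. The maximum of \<open>?u\<close> is therefore attained in
      the interior.\<close>
    have "?u x < M + \<delta> * h0" if x: "x \<in> sphere z \<rho>" for x
    proof (cases "norm (x - x1) \<le> R")
      case True
      then have "f x \<le> M - \<delta>"
        using x by (intro \<delta>(2)) (auto simp: dist_norm norm_minus_commute)
      moreover have "h x \<le> 1"
        using \<alpha> by (simp add: h_def)
      then have "\<delta> * h x \<le> \<delta> * 1"
        using \<delta>(1) by (intro mult_left_mono) auto
      moreover have "0 < \<delta> * h0"
        using \<delta>(1) by (simp add: h0_def)
      ultimately show ?thesis
        by linarith
    next
      case False
      then have "R\<^sup>2 < (norm (x - x1))\<^sup>2"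
        using R by (intro power_strict_mono) auto
      then have "h x < h0"
        using \<alpha> by (simp add: h_def h0_def)
      then have "\<delta> * h x < \<delta> * h0"
        using \<delta>(1) by simp
      moreover have "f x \<le> M"
        using x C by (intro M) auto
      ultimately show ?thesis
        by linarith
    qed
    moreover have "M + \<delta> * h0 \<le> ?u p"
      using p(2)[of z] z \<rho>(1) hz unfolding K_def by simp
    ultimately have pb: "p \<in> ball z \<rho>"
      using p(1) by (metis linorder_not_less mem_ball mem_cball mem_sphere order_le_less)
    have B: "ball z \<rho> \<subseteq> U"
      using C ball_subset_cball by blast
    have pU: "p \<in> U"
      using pb B by blast
    have tduB: "twice_diff_on (ball z \<rho>) ?u"
      using tdu B unfolding twice_diff_on_def by blast
    have maxB: "?u x \<le> ?u p" if "x \<in> ball z \<rho>" for x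
      using p(2) that ball_subset_cball by blast
    have "0 \<le> (\<Sum>i\<in>UNIV. \<Sum>j\<in>UNIV. A i j p * v i * v j)" for v
      using Apos[OF pU, of "\<chi> i. v i"] by (cases "(\<chi> i. v i) = (0::real^'n)") (auto simp: vec_eq_iff mult.assoc)
    then have "(\<Sum>i\<in>UNIV. \<Sum>j\<in>UNIV. A i j p * pderiv_at i (pderiv_at j ?u) p) \<le> 0"
      using elliptic_nonpos_at_max[OF open_ball pb tduB maxB, of "\<lambda>i j. A i j p"] A(2)[OF pU] by blast
    moreover have "pderiv_at i ?u p = 0" for i
      by (rule gradient_zero_at_max[OF open_ball pb twice_diff_onD(1)[OF tdu pU] maxB])
    moreover have pu: "pderiv_at i ?u x = pderiv_at i f x + \<delta> * pderiv_at i h x" if "x \<in> U" for i x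
      using pderiv_at_add[OF twice_diff_onD(1)[OF f that] twice_diff_onD(1)[OF tdh that]]
        pderiv_at_cmult[OF twice_diff_onD(1)[OF gd(1) that]] by simp
    moreover have "pderiv_at i (pderiv_at j ?u) p = pderiv_at i (pderiv_at j f) p + \<delta> * pderiv_at i (pderiv_at j h) p" for i j
    proof -
      have dh: "pderiv_at j h differentiable at p"
        by (rule twice_diff_onD(2)[OF gd(1) UNIV_I])
      have "pderiv_at i (pderiv_at j ?u) p = pderiv_at i (\<lambda>x. pderiv_at j f x + \<delta> * pderiv_at j h x) p"
        by (rule pderiv_at_cong_on_open[OF U pU pu])
      also have "\<dots> = pderiv_at i (pderiv_at j f) p + pderiv_at i (\<lambda>x. \<delta> * pderiv_at j h x) p"
        using dh by (intro pderiv_at_add twice_diff_onD(2)[OF f pU]) simp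
      finally show ?thesis
        by (simp add: pderiv_at_cmult[OF dh])
    qed
    ultimately have "(\<Sum>i\<in>UNIV. \<Sum>j\<in>UNIV. A i j p * (pderiv_at i (pderiv_at j f) p + \<delta> * pderiv_at i (pderiv_at j h) p)) \<le> 0"
      and g0: "\<And>i. pderiv_at i f p + \<delta> * pderiv_at i h p = 0"
      using pU by (simp_all add: pu)
    moreover have "(\<Sum>i\<in>UNIV. b i p * pderiv_at i f p) + \<delta> * (\<Sum>i\<in>UNIV. b i p * pderiv_at i h p)
        = (\<Sum>i\<in>UNIV. b i p * (pderiv_at i f p + \<delta> * pderiv_at i h p))"
      by (simp add: sum.distrib distrib_left sum_distrib_left mult_ac)
    \<comment> \<open>At the interior maximum the operator is nonpositive on \<open>?u\<close>,
      although it is nonnegative on \<open>f\<close> and positive on \<open>h\<close>.\<close>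
    ultimately have "(\<Sum>i\<in>UNIV. \<Sum>j\<in>UNIV. A i j p * pderiv_at i (pderiv_at j f) p) + (\<Sum>i\<in>UNIV. b i p * pderiv_at i f p)
      + \<delta> * ((\<Sum>i\<in>UNIV. \<Sum>j\<in>UNIV. A i j p * pderiv_at i (pderiv_at j h) p) + (\<Sum>i\<in>UNIV. b i p * pderiv_at i h p)) \<le> 0"
      by (simp add: g0 sum.distrib distrib_left sum_distrib_left mult_ac)
    moreover have "0 < \<delta> * ((\<Sum>i\<in>UNIV. \<Sum>j\<in>UNIV. A i j p * pderiv_at i (pderiv_at j h) p) + (\<Sum>i\<in>UNIV. b i p * pderiv_at i h p))"
      using Lh[OF p(1)] \<delta>(1) by simp
    ultimately show False
      using L[OF pU] by linarith
  qed
  moreover have "ball y r \<subseteq> U"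
    using r by (auto simp: subset_iff)
  ultimately show ?thesis
    using r(1) by blast
qed

section \<open>Smooth functions\<close>

text \<open>On an open set derivatives depend only on the values there; the induction varies
  \<open>f\<close> and \<open>g\<close> because it continues with their directional
  derivatives.\<close>

lemma Ck_on_cong:
  assumes "open S" "\<And>x. x \<in> S \<Longrightarrow> f x = g x" "Ck_on n S f"
  shows "Ck_on n S g"
  using assms(2,3)
proof (induction n arbitrary: f g)
  case 0
  then show ?case
    by (metis Ck_on.simps(1) continuous_on_cong)
next
  case (Suc n)
  have "Ck_on n S (\<lambda>x. frechet_derivative g (at x) v)" for v
  proof (rule Suc.IH)
    show "Ck_on n S (\<lambda>x. frechet_derivative f (at x) v)"
      using Suc.prems(2) by simp
    show "frechet_derivative f (at x) v = frechet_derivative g (at x) v" if "x \<in> S" for x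
      using frechet_derivative_cong_on_open[OF assms(1) that Suc.prems(1)] by simp
  qed
  moreover have "g differentiable at x" if "x \<in> S" for x
    using Suc.prems(2) has_derivative_iff_on_open[where f = f and g = g, OF assms(1) that Suc.prems(1)] that
    by (metis Ck_on.simps(2) differentiable_def)
  ultimately show ?case
    by simp
qed

text \<open>The derivative of the composite in direction \<open>v\<close> is the derivative of
  \<open>f\<close> in the fixed direction \<open>l v\<close>, again composed with \<open>l\<close>,
  so the induction hypothesis applies directly. The case of interest is a projection of a product
  chart.\<close>

lemma Ck_on_compose_linear:
  fixes l :: "'a::euclidean_space \<Rightarrow> 'b::euclidean_space" and f :: "'b \<Rightarrow> 'c::real_normed_vector"
  assumes l: "bounded_linear l" and "open S" "l ` S \<subseteq> T" "Ck_on n T f"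
  shows "Ck_on n S (\<lambda>x. f (l x))"
  using assms(4)
proof (induction n arbitrary: f)
  case 0
  then show ?case
    using assms(3) linear_continuous_on[OF l] by (auto intro: continuous_on_compose2)
next
  case (Suc n)
  have d: "((\<lambda>x. f (l x)) has_derivative (\<lambda>v. frechet_derivative f (at (l x)) (l v))) (at x)" if "x \<in> S" for x
    using has_derivative_compose[OF bounded_linear_imp_has_derivative[OF l], of f _ x]
      Suc.prems assms(3) that frechet_derivative_works by fastforce
  have "Ck_on n S (\<lambda>x. frechet_derivative (\<lambda>x. f (l x)) (at x) v)" for v
  proof (rule Ck_on_cong[OF assms(2)])
    show "Ck_on n S (\<lambda>x. frechet_derivative f (at (l x)) (l v))"
      using Suc.IH[of "\<lambda>x. frechet_derivative f (at x) (l v)"] Suc.prems by simp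
    show "frechet_derivative f (at (l x)) (l v) = frechet_derivative (\<lambda>x. f (l x)) (at x) v" if "x \<in> S" for x
      using frechet_derivative_at[OF d[OF that]] by metis
  qed
  then show ?case
    using d by (auto intro: differentiableI)
qed

lemma Ck_on_linear_compose:
  fixes f :: "'a::euclidean_space \<Rightarrow> 'b::real_normed_vector" and l :: "'b \<Rightarrow> 'c::real_normed_vector"
  assumes l: "bounded_linear l" and "open S" "Ck_on n S f"
  shows "Ck_on n S (\<lambda>x. l (f x))"
  using assms(3)
proof (induction n arbitrary: f)
  case 0
  then show ?case
    using bounded_linear.continuous_on[OF l] by auto
next
  case (Suc n)
  have d: "((\<lambda>x. l (f x)) has_derivative (\<lambda>v. l (frechet_derivative f (at x) v))) (at x)" if "x \<in> S" for x
    using bounded_linear.has_derivative[OF l, of f _ "at x"]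
      Suc.prems that frechet_derivative_works by fastforce
  have "Ck_on n S (\<lambda>x. frechet_derivative (\<lambda>x. l (f x)) (at x) v)" for v
  proof (rule Ck_on_cong[OF assms(2)])
    show "Ck_on n S (\<lambda>x. l (frechet_derivative f (at x) v))"
      using Suc by simp
    show "l (frechet_derivative f (at x) v) = frechet_derivative (\<lambda>x. l (f x)) (at x) v" if "x \<in> S" for x
      using frechet_derivative_at[OF d[OF that]] by metis
  qed
  then show ?case
    using d by (auto intro: differentiableI)
qed

lemma smooth_on_const: "smooth_on S (\<lambda>_. c)"
proof -
  have "Ck_on n S (\<lambda>_. c)" for n and c :: 'b
    by (induction n arbitrary: c) auto
  then show ?thesis
    by (simp add: smooth_on_def)
qed

lemma smooth_on_imp_differentiable: "smooth_on S f \<Longrightarrow> x \<in> S \<Longrightarrow> f differentiable at x"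
  unfolding smooth_on_def by (metis Ck_on.simps(2))

section \<open>Charts and tangent vectors\<close>

locale smooth_mf =
  fixes M :: "('p, 'n::finite) manifold"
  assumes mf: "smooth_manifold M"
begin

lemma chart_open:
  assumes "c \<in> atlas M"
  shows "openin (mtop M) (chart_dom c)" "open (chart_img c)"
    "homeomorphic_map (subtopology (mtop M) (chart_dom c)) (top_of_set (chart_img c)) (chart_map c)"
  using mf assms by (auto simp: smooth_manifold_def)

lemma chart_topspace: "c \<in> atlas M \<Longrightarrow> topspace (subtopology (mtop M) (chart_dom c)) = chart_dom c"
  using chart_open(1) openin_subset by (metis topspace_subtopology_subset)

lemma chart_inj: "c \<in> atlas M \<Longrightarrow> inj_on (chart_map c) (chart_dom c)"
  using chart_open(3) chart_topspace by (metis homeomorphic_map_def)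

lemma chart_inv_map: "c \<in> atlas M \<Longrightarrow> p \<in> chart_dom c \<Longrightarrow> chart_inv c (chart_map c p) = p"
  using chart_inj by (simp add: chart_inv_def)

lemma
  assumes "x \<in> chart_img c"
  shows chart_map_inv: "chart_map c (chart_inv c x) = x" and chart_inv_in_dom: "chart_inv c x \<in> chart_dom c"
  using assms by (auto simp: chart_img_def chart_inv_def f_inv_into_f inv_into_into)

lemma chart_map_in_img: "p \<in> chart_dom c \<Longrightarrow> chart_map c p \<in> chart_img c"
  by (simp add: chart_img_def)

lemma chart_dom_subset: "c \<in> atlas M \<Longrightarrow> chart_dom c \<subseteq> points M"
  using chart_open(1) openin_subset by blast

lemma chart_exists: "p \<in> points M \<Longrightarrow> \<exists>c\<in>atlas M. p \<in> chart_dom c"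
  using mf unfolding smooth_manifold_def by blast

lemma open_chart_image:
  assumes c: "c \<in> atlas M" and W: "openin (mtop M) W"
  shows "open (chart_map c ` (chart_dom c \<inter> W))"
proof -
  have "openin (subtopology (mtop M) (chart_dom c)) (chart_dom c \<inter> W)"
    using W by (simp add: openin_subtopology_Int2)
  then have "openin (top_of_set (chart_img c)) (chart_map c ` (chart_dom c \<inter> W))"
    using chart_open(3)[OF c] by (meson homeomorphic_imp_open_map open_map_def)
  then show ?thesis
    using chart_open(2)[OF c] openin_open_trans by blast
qed

lemma openin_chart_preimage:
  assumes c: "c \<in> atlas M" and S: "open S"
  shows "openin (mtop M) {p \<in> chart_dom c. chart_map c p \<in> S}"
proof -
  have "continuous_map (subtopology (mtop M) (chart_dom c)) (top_of_set (chart_img c)) (chart_map c)"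
    using chart_open(3)[OF c] homeomorphic_imp_continuous_map by blast
  moreover have "openin (top_of_set (chart_img c)) (chart_img c \<inter> S)"
    using S by (simp add: openin_open_Int)
  ultimately have "openin (subtopology (mtop M) (chart_dom c)) {p \<in> chart_dom c. chart_map c p \<in> chart_img c \<inter> S}"
    using chart_topspace[OF c] unfolding continuous_map_def by metis
  moreover have "{p \<in> chart_dom c. chart_map c p \<in> chart_img c \<inter> S} = {p \<in> chart_dom c. chart_map c p \<in> S}"
    by (auto simp: chart_img_def)
  ultimately show ?thesis
    using chart_open(1)[OF c] openin_trans_full by metis
qed

lemma smooth_nearE:
  assumes "smooth_near M p f" "c \<in> atlas M" "p \<in> chart_dom c"
  obtains S where "open S" "chart_map c p \<in> S" "S \<subseteq> chart_img c" "smooth_on S (f \<circ> chart_inv c)"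
proof -
  obtain W where W: "openin (mtop M) W" "p \<in> W" "smooth_fun_on M W f"
    using assms(1) by (auto simp: smooth_near_def)
  show ?thesis
    using that[of "chart_map c ` (chart_dom c \<inter> W)"] open_chart_image[OF assms(2) W(1)] W assms
    by (auto simp: smooth_fun_on_def chart_img_def)
qed

lemma smooth_near_differentiable:
  assumes "smooth_near M p f" "c \<in> atlas M" "p \<in> chart_dom c"
  shows "(f \<circ> chart_inv c) differentiable at (chart_map c p)"
  using smooth_nearE[OF assms] smooth_on_imp_differentiable by metis

lemma smooth_fun_chart:
  assumes "smooth_fun M f" "c \<in> atlas M"
  shows "smooth_on (chart_img c) (f \<circ> chart_inv c)"
proof -
  have "chart_dom c \<inter> points M = chart_dom c"
    using chart_dom_subset[OF assms(2)] by blast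
  then show ?thesis
    using assms unfolding smooth_fun_on_def chart_img_def by metis
qed

lemma transition_smooth:
  assumes "c \<in> atlas M" "d \<in> atlas M"
  shows "smooth_on (chart_map d ` (chart_dom d \<inter> chart_dom c)) (chart_map c \<circ> chart_inv d)"
  using mf assms unfolding smooth_manifold_def by blast

text \<open>In another chart a coordinate function is a component of a transition map. Coordinate
  functions are the test functions that detect the coefficients of tangent vectors.\<close>

lemma smooth_near_coordinate:
  assumes c: "c \<in> atlas M" and p: "p \<in> chart_dom c"
  shows "smooth_near M p (\<lambda>q. chart_map c q $ j)"
proof -
  have "smooth_on (chart_map d ` (chart_dom d \<inter> chart_dom c)) ((\<lambda>q. chart_map c q $ j) \<circ> chart_inv d)"
    if d: "d \<in> atlas M" for d
    using Ck_on_linear_compose[OF bounded_linear_vec_nth open_chart_image[OF d chart_open(1)[OF c]]]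
      transition_smooth[OF c d] by (auto simp: smooth_on_def comp_def)
  then show ?thesis
    unfolding smooth_near_def smooth_fun_on_def using chart_open(1)[OF c] p by blast
qed

lemma coord_vec_coordinate:
  assumes c: "c \<in> atlas M" and p: "p \<in> chart_dom c"
  shows "coord_vec M c p i (\<lambda>q. chart_map c q $ j) = (if i = j then 1 else 0)"
proof -
  have "pderiv_at i ((\<lambda>q. chart_map c q $ j) \<circ> chart_inv c) (chart_map c p) = pderiv_at i (\<lambda>x. x $ j) (chart_map c p)"
    by (rule pderiv_at_cong_on_open[OF chart_open(2)[OF c] chart_map_in_img[OF p]]) (simp add: chart_map_inv)
  then show ?thesis
    using smooth_near_coordinate[OF c p, of j] by (simp add: coord_vec_def pderiv_at_component)
qed

text \<open>The chain rule through the transition map, whose Jacobian entries are written as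
  coordinate vectors applied to coordinate functions. On functions that are not smooth near
  \<open>p\<close> both sides are 0 by convention.\<close>

lemma coord_vec_change:
  assumes c: "c \<in> atlas M" "p \<in> chart_dom c" and d: "d \<in> atlas M" "p \<in> chart_dom d"
  shows "coord_vec M d p i = (\<lambda>f. \<Sum>j\<in>UNIV. coord_vec M d p i (\<lambda>q. chart_map c q $ j) * coord_vec M c p j f)"
proof
  fix f
  show "coord_vec M d p i f = (\<Sum>j\<in>UNIV. coord_vec M d p i (\<lambda>q. chart_map c q $ j) * coord_vec M c p j f)"
  proof (cases "smooth_near M p f")
    case True
    let ?F = "f \<circ> chart_inv c" and ?T = "chart_map c \<circ> chart_inv d" and ?y = "chart_map d p"
    let ?S = "chart_map d ` (chart_dom d \<inter> chart_dom c)"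
    have oS: "open ?S" and yS: "?y \<in> ?S"
      using open_chart_image[OF d(1) chart_open(1)[OF c(1)]] c d by auto
    have Ty: "?T ?y = chart_map c p"
      using chart_inv_map[OF d] by simp
    have F: "?F differentiable at (?T ?y)"
      unfolding Ty by (rule smooth_near_differentiable[OF True c])
    have T: "(?T has_derivative frechet_derivative ?T (at ?y)) (at ?y)"
      using smooth_on_imp_differentiable[OF transition_smooth[OF c(1) d(1)] yS] frechet_derivative_works by blast
    have "((\<lambda>x. ?F (?T x)) has_derivative
        (\<lambda>v. \<Sum>j\<in>UNIV. frechet_derivative ?T (at ?y) v $ j * pderiv_at j ?F (?T ?y))) (at ?y)"
      by (rule has_derivative_compose[OF T has_derivative_pderiv_at[OF F]])
    from pderiv_at_eq[OF this]
    have "pderiv_at i (\<lambda>x. ?F (?T x)) ?y = (\<Sum>j\<in>UNIV. frechet_derivative ?T (at ?y) (axis i 1) $ j * pderiv_at j ?F (?T ?y))" .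
    moreover have "pderiv_at i (f \<circ> chart_inv d) ?y = pderiv_at i (\<lambda>x. ?F (?T x)) ?y"
      by (rule pderiv_at_cong_on_open[OF oS yS]) (auto simp: chart_inv_map[OF c(1)] chart_inv_map[OF d(1)])
    moreover have "((\<lambda>x. ?T x $ j) has_derivative (\<lambda>v. frechet_derivative ?T (at ?y) v $ j)) (at ?y)" for j
      by (rule bounded_linear.has_derivative[OF bounded_linear_vec_nth T])
    then have "pderiv_at i ((\<lambda>q. chart_map c q $ j) \<circ> chart_inv d) ?y = frechet_derivative ?T (at ?y) (axis i 1) $ j" for j
      using pderiv_at_eq by (fastforce simp: comp_def)
    ultimately show ?thesis
      using True smooth_near_coordinate[OF c] by (simp add: coord_vec_def chart_inv_map[OF d])
  next
    case False
    then show ?thesis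
      by (simp add: coord_vec_def)
  qed
qed

text \<open>The definition lets every tangent vector choose its own chart; the change of coordinates
  permits one fixed chart for all of them.\<close>

lemma tangent_space_eq:
  assumes c: "c \<in> atlas M" "p \<in> chart_dom c"
  shows "tangent_space M p = range (\<lambda>a::real^'n. \<lambda>f. \<Sum>i\<in>UNIV. a $ i * coord_vec M c p i f)"
proof
  show "range (\<lambda>a::real^'n. \<lambda>f. \<Sum>i\<in>UNIV. a $ i * coord_vec M c p i f) \<subseteq> tangent_space M p"
    using c by (auto simp: tangent_space_def)
  show "tangent_space M p \<subseteq> range (\<lambda>a::real^'n. \<lambda>f. \<Sum>i\<in>UNIV. a $ i * coord_vec M c p i f)"
  proof
    fix v assume "v \<in> tangent_space M p"
    then obtain d and a :: "real^'n" where d: "d \<in> atlas M" "p \<in> chart_dom d"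
      and v: "v = (\<lambda>f. \<Sum>i\<in>UNIV. a $ i * coord_vec M d p i f)"
      by (auto simp: tangent_space_def)
    let ?J = "\<lambda>i j. coord_vec M d p i (\<lambda>q. chart_map c q $ j)"
    have "v = (\<lambda>f. \<Sum>j\<in>UNIV. (\<chi> j. \<Sum>i\<in>UNIV. a $ i * ?J i j) $ j * coord_vec M c p j f)"
    proof
      fix f
      have "v f = (\<Sum>i\<in>UNIV. a $ i * (\<Sum>j\<in>UNIV. ?J i j * coord_vec M c p j f))"
        unfolding v using coord_vec_change[OF c d, THEN fun_cong, of _ f] by simp
      also have "\<dots> = (\<Sum>j\<in>UNIV. (\<chi> j. \<Sum>i\<in>UNIV. a $ i * ?J i j) $ j * coord_vec M c p j f)"
        unfolding sum_distrib_left by (subst sum.swap) (simp add: sum_distrib_right mult.assoc)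
      finally show "v f = (\<Sum>j\<in>UNIV. (\<chi> j. \<Sum>i\<in>UNIV. a $ i * ?J i j) $ j * coord_vec M c p j f)" .
    qed
    then show "v \<in> range (\<lambda>a::real^'n. \<lambda>f. \<Sum>i\<in>UNIV. a $ i * coord_vec M c p i f)"
      by blast
  qed
qed

text \<open>An arbitrary index set makes room for inductions over sums; the empty set yields the
  zero vector.\<close>

lemma coord_comb_in_tangent_space:
  assumes c: "c \<in> atlas M" "p \<in> chart_dom c"
  shows "(\<lambda>f. \<Sum>i\<in>I. a i * coord_vec M c p i f) \<in> tangent_space M p"
proof -
  have "(\<lambda>f. \<Sum>i\<in>I. a i * coord_vec M c p i f)
      = (\<lambda>f. \<Sum>i\<in>UNIV. (\<chi> i. if i \<in> I then a i else 0) $ i * coord_vec M c p i f)"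
    by (simp add: if_zero_mult sum.If_cases)
  then show ?thesis
    unfolding tangent_space_eq[OF c] by blast
qed

lemma coord_vec_in_tangent_space:
  assumes c: "c \<in> atlas M" "p \<in> chart_dom c"
  shows "coord_vec M c p i \<in> tangent_space M p"
  using coord_comb_in_tangent_space[OF c, of "\<lambda>_. 1" "{i}"] by simp

end

section \<open>Metrics in charts\<close>

locale pseudo_riemannian_mf = smooth_mf M for M :: "('p, 'n::finite) manifold" +
  fixes g :: "'p tensor2"
  assumes pr: "pseudo_riemannian M g"
begin

lemma metric_linear:
  assumes "p \<in> points M" "u \<in> tangent_space M p" "v \<in> tangent_space M p" "w \<in> tangent_space M p"
  shows "g p (\<lambda>f. a * u f + b * v f) w = a * g p u w + b * g p v w" "g p u v = g p v u"
  using pr assms by (auto simp: pseudo_riemannian_def)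

lemma metric_zero:
  assumes "p \<in> points M" "w \<in> tangent_space M p"
  shows "g p (\<lambda>f. 0) w = 0" "g p w (\<lambda>f. 0) = 0"
proof -
  show 1: "g p (\<lambda>f. 0) w = 0"
    using metric_linear(1)[OF assms(1,2,2,2), of 0 0] by simp
  obtain c where c: "c \<in> atlas M" "p \<in> chart_dom c"
    using chart_exists[OF assms(1)] by blast
  have "(\<lambda>f. 0) \<in> tangent_space M p"
    using coord_comb_in_tangent_space[OF c, of undefined "{}"] by simp
  then show "g p w (\<lambda>f. 0) = 0"
    using metric_linear(2)[OF assms(1,2) _ assms(2)] 1 by simp
qed

lemma metric_coord_comb:
  assumes c: "c \<in> atlas M" "p \<in> chart_dom c" and w: "w \<in> tangent_space M p"
  shows "g p (\<lambda>f. \<Sum>i\<in>UNIV. a i * coord_vec M c p i f) w = (\<Sum>i\<in>UNIV. a i * g p (coord_vec M c p i) w)"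
proof -
  have p: "p \<in> points M"
    using c chart_dom_subset by blast
  have "g p (\<lambda>f. \<Sum>i\<in>I. a i * coord_vec M c p i f) w = (\<Sum>i\<in>I. a i * g p (coord_vec M c p i) w)" if "finite I" for I
    using that
  proof (induction I rule: finite_induct)
    case empty
    then show ?case
      using metric_zero(1)[OF p w] by simp
  next
    case (insert i I)
    have "g p (\<lambda>f. \<Sum>i\<in>insert i I. a i * coord_vec M c p i f) w
        = g p (\<lambda>f. a i * coord_vec M c p i f + 1 * (\<Sum>i\<in>I. a i * coord_vec M c p i f)) w"
      using insert.hyps by simp
    also have "\<dots> = a i * g p (coord_vec M c p i) w + 1 * g p (\<lambda>f. \<Sum>i\<in>I. a i * coord_vec M c p i f) w"
      by (rule metric_linear(1)[OF p coord_vec_in_tangent_space[OF c] coord_comb_in_tangent_space[OF c] w])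
    finally show ?case
      using insert by simp
  qed
  then show ?thesis
    by simp
qed

lemma metric_in_chart:
  assumes c: "c \<in> atlas M" and x: "x \<in> chart_img c"
  shows "g (chart_inv c x) (\<lambda>f. \<Sum>i\<in>UNIV. a $ i * coord_vec M c (chart_inv c x) i f)
      (\<lambda>f. \<Sum>i\<in>UNIV. b $ i * coord_vec M c (chart_inv c x) i f)
    = (\<Sum>i\<in>UNIV. \<Sum>j\<in>UNIV. components M g c x $ i $ j * (a $ i * b $ j))"
proof -
  let ?p = "chart_inv c x" and ?e = "\<lambda>i. coord_vec M c (chart_inv c x) i"
  have p: "?p \<in> chart_dom c"
    using x by (rule chart_inv_in_dom)
  have pM: "?p \<in> points M"
    using p c chart_dom_subset by blast
  note T = coord_vec_in_tangent_space[OF c p] coord_comb_in_tangent_space[OF c p]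
  have "g ?p (?e i) (\<lambda>f. \<Sum>i\<in>UNIV. b $ i * ?e i f) = (\<Sum>j\<in>UNIV. b $ j * g ?p (?e i) (?e j))" for i
    using metric_linear(2)[OF pM T(1) T(2) T(1)] metric_coord_comb[OF c p T(1), of "\<lambda>i. b $ i"]
      metric_linear(2)[OF pM T(1) T(1) T(1)] by simp
  then show ?thesis
    unfolding metric_coord_comb[OF c p T(2)]
    by (simp add: components_def sum_distrib_left mult_ac)
qed

text \<open>Evaluation at the coordinate functions, which are dual to the coordinate vectors,
  extracts the coefficients.\<close>

lemma coord_comb_eq_0:
  assumes "c \<in> atlas M" "p \<in> chart_dom c" "(\<lambda>f. \<Sum>i\<in>UNIV. a $ i * coord_vec M c p i f) = (\<lambda>f. 0)"
  shows "a = 0"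
proof -
  have "a $ j = 0" for j
    using fun_cong[OF assms(3), of "\<lambda>q. chart_map c q $ j"]
    by (simp add: coord_vec_coordinate[OF assms(1,2)] if_zero_mult)
  then show ?thesis
    by (simp add: vec_eq_iff)
qed

text \<open>A kernel vector of the component matrix would give a tangent vector orthogonal to the
  whole tangent space, which is zero by nondegeneracy; independence of the coordinate vectors then
  makes the kernel trivial.\<close>

theorem components_metric_on:
  assumes c: "c \<in> atlas M"
  shows "metric_on (chart_img c) (components M g c)"
  unfolding metric_on_def
proof (intro conjI ballI allI)
  show "open (chart_img c)"
    by (rule chart_open(2)[OF c])
  show "twice_diff_on (chart_img c) (\<lambda>x. components M g c x $ i $ j)" for i j
    using pr c by (intro twice_diff_on_smooth) (auto simp: pseudo_riemannian_def)
  fix x assume x: "x \<in> chart_img c"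
  let ?p = "chart_inv c x"
  have p: "?p \<in> chart_dom c"
    using x by (rule chart_inv_in_dom)
  have pM: "?p \<in> points M"
    using p c chart_dom_subset by blast
  note T = coord_vec_in_tangent_space[OF c p] coord_comb_in_tangent_space[OF c p]
  show t: "transpose (components M g c x) = components M g c x"
    unfolding transpose_eq_iff components_def using metric_linear(2)[OF pM T(1) T(1) T(1)] by simp
  have "a = 0" if a: "components M g c x *v a = 0" for a
  proof (rule coord_comb_eq_0[OF c p])
    let ?v = "\<lambda>f. \<Sum>i\<in>UNIV. a $ i * coord_vec M c ?p i f"
    have "g ?p ?v w = 0" if w: "w \<in> tangent_space M ?p" for w
    proof -
      obtain b :: "real^'n" where w: "w = (\<lambda>f. \<Sum>i\<in>UNIV. b $ i * coord_vec M c ?p i f)"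
        using w unfolding tangent_space_eq[OF c p] by blast
      have "(\<Sum>j\<in>UNIV. components M g c x $ i $ j * a $ j) = 0" for i
        using a by (simp add: vec_eq_iff matrix_vector_mult_def)
      then have "(\<Sum>i\<in>UNIV. b $ i * (\<Sum>j\<in>UNIV. components M g c x $ i $ j * a $ j)) = 0"
        by simp
      then have "g ?p w ?v = 0"
        unfolding w metric_in_chart[OF c x] by (simp add: sum_distrib_left mult_ac)
      then show ?thesis
        using metric_linear(2)[OF pM T(2) that T(2)] by simp
    qed
    then show "?v = (\<lambda>f. 0)"
      using pr pM T(2) unfolding pseudo_riemannian_def by blast
  qed
  then show "invertible (components M g c x)"
    using matrix_left_invertible_ker invertible_left_inverse by blast
qed

end

lemma riemannian_components_pos:
  fixes M :: "('p, 'n::finite) manifold"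
  assumes "riemannian M g" "c \<in> atlas M" "x \<in> chart_img c" "a \<noteq> 0"
  shows "0 < (\<Sum>i\<in>UNIV. \<Sum>j\<in>UNIV. components M g c x $ i $ j * (a $ i * a $ j))"
proof -
  interpret pseudo_riemannian_mf M g
    using assms(1) by unfold_locales (auto simp: riemannian_def pseudo_riemannian_def)
  let ?p = "chart_inv c x"
  have p: "?p \<in> chart_dom c"
    using assms(3) by (rule chart_inv_in_dom)
  let ?v = "\<lambda>f. \<Sum>i\<in>UNIV. a $ i * coord_vec M c ?p i f"
  have "?v \<noteq> (\<lambda>f. 0)"
    using coord_comb_eq_0[OF assms(2) p] assms(4) by blast
  moreover have "?v \<in> tangent_space M ?p"
    by (rule coord_comb_in_tangent_space[OF assms(2) p])
  moreover have "?p \<in> points M"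
    using p assms(2) chart_dom_subset by blast
  ultimately have "g ?p ?v ?v > 0"
    using assms(1) unfolding riemannian_def by blast
  then show ?thesis
    unfolding metric_in_chart[OF assms(2,3)] .
qed

section \<open>Product charts\<close>

lemma join_vec_eq_iff [simp]: "join_vec x y = join_vec x' y' \<longleftrightarrow> x = x' \<and> y = y'"
  by (metis fst_vec_join snd_vec_join)

locale product_mf = B: smooth_mf B + F: smooth_mf F
  for B :: "('p, 'm::finite) manifold" and F :: "('q, 'k::finite) manifold"
begin

abbreviation "BF \<equiv> prod_manifold B F"

lemma prod_chart_simps [simp]:
  "chart_dom (prod_chart c d) = chart_dom c \<times> chart_dom d"
  "chart_map (prod_chart c d) (p, q) = join_vec (chart_map c p) (chart_map d q)"
  by (simp_all add: prod_chart_def)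

lemma prod_chart_image:
  "chart_map (prod_chart c d) ` (P \<times> Q) = prod_set (chart_map c ` P) (chart_map d ` Q)"
proof
  show "chart_map (prod_chart c d) ` (P \<times> Q) \<subseteq> prod_set (chart_map c ` P) (chart_map d ` Q)"
    by auto
  show "prod_set (chart_map c ` P) (chart_map d ` Q) \<subseteq> chart_map (prod_chart c d) ` (P \<times> Q)"
  proof
    fix z assume "z \<in> prod_set (chart_map c ` P) (chart_map d ` Q)"
    then obtain p q where "p \<in> P" "q \<in> Q" "fst_vec z = chart_map c p" "snd_vec z = chart_map d q"
      by (auto simp: prod_set_def)
    then have "z = chart_map (prod_chart c d) (p, q)"
      using join_fst_snd_vec[of z] by simp
    then show "z \<in> chart_map (prod_chart c d) ` (P \<times> Q)"
      using \<open>p \<in> P\<close> \<open>q \<in> Q\<close> by blast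
  qed
qed

lemma chart_img_prod: "chart_img (prod_chart c d) = prod_set (chart_img c) (chart_img d)"
  unfolding chart_img_def prod_chart_simps by (rule prod_chart_image)

lemma chart_inv_prod:
  assumes c: "c \<in> atlas B" and d: "d \<in> atlas F" and z: "z \<in> prod_set (chart_img c) (chart_img d)"
  shows "chart_inv (prod_chart c d) z = (chart_inv c (fst_vec z), chart_inv d (snd_vec z))"
  unfolding chart_inv_def[of "prod_chart c d"]
proof (rule inv_into_f_eq)
  show "inj_on (chart_map (prod_chart c d)) (chart_dom (prod_chart c d))"
  proof (rule inj_onI)
    fix s t assume "s \<in> chart_dom (prod_chart c d)" "t \<in> chart_dom (prod_chart c d)"
      "chart_map (prod_chart c d) s = chart_map (prod_chart c d) t"
    then have "fst s \<in> chart_dom c" "snd s \<in> chart_dom d" "fst t \<in> chart_dom c" "snd t \<in> chart_dom d"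
      "chart_map c (fst s) = chart_map c (fst t)" "chart_map d (snd s) = chart_map d (snd t)"
      by (auto simp: prod_chart_def)
    then show "s = t"
      using B.chart_inj[OF c] F.chart_inj[OF d] by (metis inj_onD prod_eqI)
  qed
  have "fst_vec z \<in> chart_img c" "snd_vec z \<in> chart_img d"
    using z by (auto simp: prod_set_def)
  then show "(chart_inv c (fst_vec z), chart_inv d (snd_vec z)) \<in> chart_dom (prod_chart c d)"
    "chart_map (prod_chart c d) (chart_inv c (fst_vec z), chart_inv d (snd_vec z)) = z"
    by (simp_all add: B.chart_inv_in_dom F.chart_inv_in_dom B.chart_map_inv F.chart_map_inv)
qed

text \<open>\<open>coord_vec\<close> returns 0 on functions that are not smooth near the point, so
  the pulled back test function must be known to be smooth before its derivative can be
  computed.\<close>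

lemma smooth_near_fst:
  assumes f: "smooth_near B p f" and q: "q \<in> points F"
  shows "smooth_near BF (p, q) (f \<circ> fst)"
proof -
  obtain W where W: "openin (mtop B) W" "p \<in> W" "smooth_fun_on B W f"
    using f by (auto simp: smooth_near_def)
  have "smooth_fun_on BF (W \<times> points F) (f \<circ> fst)"
    unfolding smooth_fun_on_def
  proof
    fix e assume "e \<in> atlas BF"
    then obtain c d where c: "c \<in> atlas B" and d: "d \<in> atlas F" and e: "e = prod_chart c d"
      by (auto simp: prod_manifold_def)
    let ?S = "chart_map c ` (chart_dom c \<inter> W)" and ?V = "chart_img d"
    have dom: "chart_dom e \<inter> (W \<times> points F) = (chart_dom c \<inter> W) \<times> chart_dom d"
      using F.chart_dom_subset[OF d] by (auto simp: e)
    have im: "chart_map e ` (chart_dom e \<inter> (W \<times> points F)) = prod_set ?S ?V"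
      unfolding dom unfolding e prod_chart_image chart_img_def ..
    have oS: "open ?S"
      by (rule B.open_chart_image[OF c W(1)])
    have o: "open (prod_set ?S ?V)"
      by (rule open_prod_set[OF oS F.chart_open(2)[OF d]])
    have "Ck_on n (prod_set ?S ?V) ((f \<circ> fst) \<circ> chart_inv e)" for n
    proof (rule Ck_on_cong[OF o])
      show "Ck_on n (prod_set ?S ?V) (\<lambda>z. (f \<circ> chart_inv c) (fst_vec z))"
        using W(3) c by (intro Ck_on_compose_linear[where f = "f \<circ> chart_inv c", OF bounded_linear_fst_vec o, of ?S])
          (auto simp: prod_set_def smooth_fun_on_def smooth_on_def)
      fix z assume "z \<in> prod_set ?S ?V"
      then have "z \<in> prod_set (chart_img c) (chart_img d)"
        by (auto simp: prod_set_def chart_img_def)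
      then show "(f \<circ> chart_inv c) (fst_vec z) = ((f \<circ> fst) \<circ> chart_inv e) z"
        by (simp add: e chart_inv_prod[OF c d])
    qed
    then show "smooth_on (chart_map e ` (chart_dom e \<inter> (W \<times> points F))) ((f \<circ> fst) \<circ> chart_inv e)"
      by (simp add: im smooth_on_def)
  qed
  moreover have "openin (mtop BF) (W \<times> points F)"
    using W(1) by (simp add: prod_manifold_def openin_prod_Times_iff)
  ultimately show ?thesis
    using W(2) q by (auto simp: smooth_near_def)
qed

lemma smooth_near_snd:
  assumes f: "smooth_near F q f" and p: "p \<in> points B"
  shows "smooth_near BF (p, q) (f \<circ> snd)"
proof -
  obtain W where W: "openin (mtop F) W" "q \<in> W" "smooth_fun_on F W f"
    using f by (auto simp: smooth_near_def)
  have "smooth_fun_on BF (points B \<times> W) (f \<circ> snd)"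
    unfolding smooth_fun_on_def
  proof
    fix e assume "e \<in> atlas BF"
    then obtain c d where c: "c \<in> atlas B" and d: "d \<in> atlas F" and e: "e = prod_chart c d"
      by (auto simp: prod_manifold_def)
    let ?S = "chart_map d ` (chart_dom d \<inter> W)" and ?V = "chart_img c"
    have dom: "chart_dom e \<inter> (points B \<times> W) = chart_dom c \<times> (chart_dom d \<inter> W)"
      using B.chart_dom_subset[OF c] by (auto simp: e)
    have im: "chart_map e ` (chart_dom e \<inter> (points B \<times> W)) = prod_set ?V ?S"
      unfolding dom unfolding e prod_chart_image chart_img_def ..
    have oS: "open ?S"
      by (rule F.open_chart_image[OF d W(1)])
    have o: "open (prod_set ?V ?S)"
      by (rule open_prod_set[OF B.chart_open(2)[OF c] oS])
    have "Ck_on n (prod_set ?V ?S) ((f \<circ> snd) \<circ> chart_inv e)" for n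
    proof (rule Ck_on_cong[OF o])
      show "Ck_on n (prod_set ?V ?S) (\<lambda>z. (f \<circ> chart_inv d) (snd_vec z))"
        using W(3) d by (intro Ck_on_compose_linear[where f = "f \<circ> chart_inv d", OF bounded_linear_snd_vec o, of ?S])
          (auto simp: prod_set_def smooth_fun_on_def smooth_on_def)
      fix z assume "z \<in> prod_set ?V ?S"
      then have "z \<in> prod_set (chart_img c) (chart_img d)"
        by (auto simp: prod_set_def chart_img_def)
      then show "(f \<circ> chart_inv d) (snd_vec z) = ((f \<circ> snd) \<circ> chart_inv e) z"
        by (simp add: e chart_inv_prod[OF c d])
    qed
    then show "smooth_on (chart_map e ` (chart_dom e \<inter> (points B \<times> W))) ((f \<circ> snd) \<circ> chart_inv e)"
      by (simp add: im smooth_on_def)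
  qed
  moreover have "openin (mtop BF) (points B \<times> W)"
    using W(1) by (simp add: prod_manifold_def openin_prod_Times_iff)
  ultimately show ?thesis
    using W(2) p by (auto simp: smooth_near_def)
qed

text \<open>A test function pulled back from one factor does not depend on the coordinates of the
  other. This is what makes the two pulled back metrics block diagonal.\<close>

lemma
  assumes c: "c \<in> atlas B" "p \<in> chart_dom c" and d: "d \<in> atlas F" "q \<in> chart_dom d"
  shows tangent_map_fst:
      "tangent_map B fst (p, q) (coord_vec BF (prod_chart c d) (p, q) (Inl i)) = coord_vec B c p i"
      "tangent_map B fst (p, q) (coord_vec BF (prod_chart c d) (p, q) (Inr j)) = (\<lambda>f. 0)"
    and tangent_map_snd:
      "tangent_map F snd (p, q) (coord_vec BF (prod_chart c d) (p, q) (Inl i)) = (\<lambda>f. 0)"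
      "tangent_map F snd (p, q) (coord_vec BF (prod_chart c d) (p, q) (Inr j)) = coord_vec F d q j"
proof -
  let ?e = "prod_chart c d" and ?z = "join_vec (chart_map c p) (chart_map d q)"
  let ?O = "prod_set (chart_img c) (chart_img d)"
  have o: "open ?O"
    by (rule open_prod_set[OF B.chart_open(2)[OF c(1)] F.chart_open(2)[OF d(1)]])
  have z: "?z \<in> ?O"
    using c d by (simp add: B.chart_map_in_img F.chart_map_in_img)
  have pts: "p \<in> points B" "q \<in> points F"
    using c d B.chart_dom_subset F.chart_dom_subset by blast+
  have 1: "pderiv_at s ((f \<circ> fst) \<circ> chart_inv ?e) ?z = pderiv_at s (\<lambda>z. (f \<circ> chart_inv c) (fst_vec z)) ?z" for s f
    by (rule pderiv_at_cong_on_open[OF o z]) (simp add: chart_inv_prod[OF c(1) d(1)])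
  have 2: "pderiv_at s ((f \<circ> snd) \<circ> chart_inv ?e) ?z = pderiv_at s (\<lambda>z. (f \<circ> chart_inv d) (snd_vec z)) ?z" for s f
    by (rule pderiv_at_cong_on_open[OF o z]) (simp add: chart_inv_prod[OF c(1) d(1)])
  have fst: "coord_vec BF ?e (p, q) s (f \<circ> fst) = pderiv_at s (\<lambda>z. (f \<circ> chart_inv c) (fst_vec z)) ?z"
    "(f \<circ> chart_inv c) differentiable at (fst_vec ?z)" if "smooth_near B p f" for s f
    using smooth_near_fst[OF that pts(2)] 1 B.smooth_near_differentiable[OF that c] by (simp_all add: coord_vec_def)
  have snd: "coord_vec BF ?e (p, q) s (f \<circ> snd) = pderiv_at s (\<lambda>z. (f \<circ> chart_inv d) (snd_vec z)) ?z"
    "(f \<circ> chart_inv d) differentiable at (snd_vec ?z)" if "smooth_near F q f" for s f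
    using smooth_near_snd[OF that pts(1)] 2 F.smooth_near_differentiable[OF that d] by (simp_all add: coord_vec_def)
  show "tangent_map B fst (p, q) (coord_vec BF (prod_chart c d) (p, q) (Inl i)) = coord_vec B c p i"
    "tangent_map B fst (p, q) (coord_vec BF (prod_chart c d) (p, q) (Inr j)) = (\<lambda>f. 0)"
    using fst(1) pderiv_at_fst_vec[OF fst(2)] by (auto simp: fun_eq_iff tangent_map_def coord_vec_def[of B])
  show "tangent_map F snd (p, q) (coord_vec BF (prod_chart c d) (p, q) (Inl i)) = (\<lambda>f. 0)"
    "tangent_map F snd (p, q) (coord_vec BF (prod_chart c d) (p, q) (Inr j)) = coord_vec F d q j"
    using snd(1) pderiv_at_snd_vec[OF snd(2)] by (auto simp: fun_eq_iff tangent_map_def coord_vec_def[of F])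
qed

end

locale product_metric_mf = product_mf B F + B: pseudo_riemannian_mf B gB + F: pseudo_riemannian_mf F gF
  for B :: "('p, 'm::finite) manifold" and F :: "('q, 'k::finite) manifold" and gB gF
begin

text \<open>The powers of \<open>\<psi>\<close> are written as exponentials of
  \<open>ln \<psi>\<close>, the form to which the conformal formulas apply.\<close>

lemma components_bcwp:
  assumes c: "c \<in> atlas B" and d: "d \<in> atlas F" and x: "x \<in> chart_img c" and y: "y \<in> chart_img d"
    and \<psi>: "\<psi> (chart_inv c x) > 0"
  shows "components BF (bcwp_metric B gB F gF \<mu> \<psi>) (prod_chart c d) (join_vec x y)
    = block_diag (exp (2 * (\<mu> * ln (\<psi> (chart_inv c x)))) *\<^sub>R components B gB c x)
        (exp (2 * ln (\<psi> (chart_inv c x))) *\<^sub>R components F gF d y)"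
proof -
  let ?p = "chart_inv c x" and ?q = "chart_inv d y"
  have p: "?p \<in> chart_dom c" and q: "?q \<in> chart_dom d"
    using x y by (auto intro: B.chart_inv_in_dom F.chart_inv_in_dom)
  have pts: "?p \<in> points B" "?q \<in> points F"
    using p q B.chart_dom_subset[OF c] F.chart_dom_subset[OF d] by blast+
  have inv: "chart_inv (prod_chart c d) (join_vec x y) = (?p, ?q)"
    using x y by (simp add: chart_inv_prod[OF c d])
  have zB: "gB ?p (\<lambda>f. 0) (coord_vec B c ?p i) = 0" "gB ?p (coord_vec B c ?p i) (\<lambda>f. 0) = 0" "gB ?p (\<lambda>f. 0) (\<lambda>f. 0) = 0" for i
    using B.metric_zero[OF pts(1) B.coord_vec_in_tangent_space[OF c p]]
      B.metric_zero[OF pts(1) B.coord_comb_in_tangent_space[OF c p, of undefined "{}"]] by simp_all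
  have zF: "gF ?q (\<lambda>f. 0) (coord_vec F d ?q i) = 0" "gF ?q (coord_vec F d ?q i) (\<lambda>f. 0) = 0" "gF ?q (\<lambda>f. 0) (\<lambda>f. 0) = 0" for i
    using F.metric_zero[OF pts(2) F.coord_vec_in_tangent_space[OF d q]]
      F.metric_zero[OF pts(2) F.coord_comb_in_tangent_space[OF d q, of undefined "{}"]] by simp_all
  have e: "\<psi> ?p powr (2 * \<mu>) = exp (2 * (\<mu> * ln (\<psi> ?p)))" "(\<psi> ?p)\<^sup>2 = exp (2 * ln (\<psi> ?p))"
    using \<psi> by (simp_all add: powr_def mult.assoc exp_double)
  show ?thesis
    unfolding vec_eq_iff split_sum_all
    by (simp add: components_def inv bcwp_metric_def pullback_def tangent_map_fst[OF c p d q]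
        tangent_map_snd[OF c p d q] zB zF e)
qed

end

section \<open>The Laplacian at extrema\<close>

text \<open>Substituting \<open>v\<close> as the metric applied to \<open>u\<close> turns the form
  of the inverse matrix at \<open>v\<close> into the form of the metric at \<open>u\<close>.\<close>

lemma inverse_metric_pos:
  assumes G: "metric_on U G" and x: "x \<in> U" and v: "v \<noteq> 0"
    and pos: "\<And>a. a \<noteq> 0 \<Longrightarrow> 0 < (\<Sum>i\<in>UNIV. \<Sum>j\<in>UNIV. G x $ i $ j * (a $ i * a $ j))"
  shows "0 < (\<Sum>i\<in>UNIV. \<Sum>j\<in>UNIV. matrix_inv (G x) $ i $ j * (v $ i * v $ j))"
proof -
  define u where "u = (\<chi> i. \<Sum>j\<in>UNIV. matrix_inv (G x) $ i $ j * v $ j)"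
  have Gu: "(\<Sum>j\<in>UNIV. G x $ i $ j * u $ j) = v $ i" for i
    unfolding u_def using metric_sum_inv_cancel(1)[OF G x, of i "\<lambda>j. v $ j"] by simp
  have "u \<noteq> 0"
  proof
    assume "u = 0"
    then have "v $ i = 0" for i
      using Gu[of i] by simp
    then show False
      using v by (simp add: vec_eq_iff)
  qed
  then have "0 < (\<Sum>i\<in>UNIV. \<Sum>j\<in>UNIV. G x $ i $ j * (u $ i * u $ j))"
    by (rule pos)
  also have "\<dots> = (\<Sum>i\<in>UNIV. u $ i * (\<Sum>j\<in>UNIV. G x $ i $ j * u $ j))"
    by (simp add: sum_distrib_left mult_ac)
  also have "\<dots> = (\<Sum>i\<in>UNIV. \<Sum>j\<in>UNIV. matrix_inv (G x) $ i $ j * (v $ i * v $ j))"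
    unfolding Gu by (simp add: u_def sum_distrib_left sum_distrib_right mult_ac)
  finally show ?thesis .
qed

lemma laplacian_at_critical:
  assumes "\<And>i. pderiv_at i f x = 0"
  shows "laplacian G f x = (\<Sum>i\<in>UNIV. \<Sum>j\<in>UNIV. matrix_inv (G x) $ i $ j * pderiv_at i (pderiv_at j f) x)"
    and "grad_prod G f f x = 0"
  by (simp_all add: laplacian_def hess_def grad_prod_def assms)

lemma
  assumes "open U" "x \<in> U" "\<And>y. y \<in> U \<Longrightarrow> f y = b"
  shows pderiv_at_locally_const: "pderiv_at i f x = 0"
    and hess_locally_const: "hess G f i j x = 0"
    and laplacian_locally_const: "laplacian G f x = 0"
proof -
  have 1: "pderiv_at i f y = 0" if "y \<in> U" for i y
    using pderiv_at_cong_on_open[OF assms(1) that assms(3)] by simp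
  then show "pderiv_at i f x = 0"
    using assms(2) .
  have "pderiv_at i (pderiv_at j f) x = 0" for i j
    using pderiv_at_cong_on_open[OF assms(1,2) 1] by simp
  then show h: "hess G f i j x = 0" for i j
    by (simp add: hess_def 1[OF assms(2)])
  show "laplacian G f x = 0"
    by (simp add: laplacian_def h)
qed

context
  fixes U :: "(real^'n::finite) set" and G
  assumes G: "metric_on U G"
    and pos: "\<And>x a. x \<in> U \<Longrightarrow> a \<noteq> 0 \<Longrightarrow> 0 < (\<Sum>i\<in>UNIV. \<Sum>j\<in>UNIV. G x $ i $ j * (a $ i * a $ j))"
begin

lemma laplacian_nonpos_at_max:
  assumes f: "twice_diff_on U f" and x: "x \<in> U" and max: "\<And>y. y \<in> U \<Longrightarrow> f y \<le> f x"
  shows "pderiv_at i f x = 0" "laplacian G f x \<le> 0"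
proof -
  have U: "open U"
    using G by (simp add: metric_on_def)
  show 0: "pderiv_at i f x = 0" for i
    by (rule gradient_zero_at_max[OF U x twice_diff_onD(1)[OF f x] max])
  have "0 \<le> (\<Sum>i\<in>UNIV. \<Sum>j\<in>UNIV. matrix_inv (G x) $ i $ j * v i * v j)" for v
    using inverse_metric_pos[OF G x _ pos[OF x], of "\<chi> i. v i"]
    by (cases "(\<chi> i. v i) = (0::real^'n)") (auto simp: vec_eq_iff mult.assoc)
  then show "laplacian G f x \<le> 0"
    unfolding laplacian_at_critical(1)[of f, OF 0]
    by (intro elliptic_nonpos_at_max[OF U x f max] metric_onD(4)[OF G x])
qed

lemma laplacian_nonneg_at_min:
  assumes f: "twice_diff_on U f" and x: "x \<in> U" and min: "\<And>y. y \<in> U \<Longrightarrow> f x \<le> f y"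
  shows "pderiv_at i f x = 0" "0 \<le> laplacian G f x"
proof -
  have U: "open U"
    using G by (simp add: metric_on_def)
  let ?f = "\<lambda>x. (- 1) * f x"
  note d = twice_diff_onD[OF f]
  have 1: "pderiv_at i ?f y = (- 1) * pderiv_at i f y" if "y \<in> U" for y i
    by (rule pderiv_at_cmult[OF d(1)[OF that]])
  have 2: "pderiv_at i (pderiv_at j ?f) x = (- 1) * pderiv_at i (pderiv_at j f) x" for i j
  proof -
    have "pderiv_at i (pderiv_at j ?f) x = pderiv_at i (\<lambda>y. (- 1) * pderiv_at j f y) x"
      by (rule pderiv_at_cong_on_open[OF U x 1])
    also have "\<dots> = (- 1) * pderiv_at i (pderiv_at j f) x"
      by (rule pderiv_at_cmult[OF d(2)[OF x]])
    finally show ?thesis .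
  qed
  have max: "?f y \<le> ?f x" if "y \<in> U" for y
    using min[OF that] by simp
  note m = laplacian_nonpos_at_max[OF twice_diff_on_cmult[OF U f, of "- 1"] x max]
  show 0: "pderiv_at i f x = 0" for i
    using m(1) 1[OF x] by simp
  have "laplacian G ?f x = (\<Sum>i\<in>UNIV. \<Sum>j\<in>UNIV. matrix_inv (G x) $ i $ j * pderiv_at i (pderiv_at j ?f) x)"
    by (rule laplacian_at_critical(1)) (rule m(1))
  also have "\<dots> = - laplacian G f x"
    unfolding laplacian_at_critical(1)[of f, OF 0] 2 by (simp add: sum_negf)
  finally have "laplacian G ?f x = - laplacian G f x" .
  then show "0 \<le> laplacian G f x"
    using m(2) by simp
qed

lemma laplacian_strong_maximum:
  assumes f: "twice_diff_on U f"
    and L: "\<And>x. x \<in> U \<Longrightarrow> 0 \<le> laplacian G f x + \<eta> * grad_prod G f f x"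
    and M: "\<And>x. x \<in> U \<Longrightarrow> f x \<le> M" and y: "y \<in> U" "f y = M"
  shows "\<exists>r>0. ball y r \<subseteq> U \<and> (\<forall>x\<in>ball y r. f x = M)"
proof (rule strong_maximum_principle[OF _ f _ _ _ _ _ M y])
  let ?A = "\<lambda>i j x. matrix_inv (G x) $ i $ j"
  \<comment> \<open>The squared gradient is linear in the derivatives of \<open>f\<close> once one
    factor is kept as coefficient \<open>grad G f\<close>; the Christoffel symbols account for the
    first-order part of the Laplacian.\<close>
  let ?b = "\<lambda>k x. \<eta> * grad G f k x - (\<Sum>i\<in>UNIV. \<Sum>j\<in>UNIV. ?A i j x * christoffel G k i j x)"
  have cont: "continuous_on U h" if "\<And>x. x \<in> U \<Longrightarrow> h differentiable at x" for h :: "real^'n \<Rightarrow> real"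
    using that by (meson continuous_at_imp_continuous_on differentiable_imp_continuous_within)
  show "open U"
    using G by (simp add: metric_on_def)
  show cA: "continuous_on U (?A i j)" for i j
    by (rule cont[OF metric_differentiable(3)[OF G]])
  show "?A i j x = ?A j i x" if "x \<in> U" for x i j
    by (rule metric_onD(4)[OF G that])
  show "0 < (\<Sum>i\<in>UNIV. \<Sum>j\<in>UNIV. ?A i j x * (v $ i * v $ j))" if "x \<in> U" "v \<noteq> 0" for x v
    by (rule inverse_metric_pos[OF G that pos[OF that(1)]])
  show "continuous_on U (?b k)" for k
    by (intro continuous_intros cA cont[OF grad_differentiable[OF G _ f]] cont[OF christoffel_differentiable[OF G]])
  fix x assume x: "x \<in> U"
  have "(\<Sum>k\<in>UNIV. (\<Sum>i\<in>UNIV. \<Sum>j\<in>UNIV. ?A i j x * christoffel G k i j x) * pderiv_at k f x)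
      = (\<Sum>i\<in>UNIV. \<Sum>j\<in>UNIV. ?A i j x * (\<Sum>k\<in>UNIV. christoffel G k i j x * pderiv_at k f x))"
    unfolding sum_distrib_left sum_distrib_right
    by (subst sum.swap, rule sum.cong[OF refl], subst sum.swap) (simp add: mult.assoc)
  then have "(\<Sum>i\<in>UNIV. \<Sum>j\<in>UNIV. ?A i j x * pderiv_at i (pderiv_at j f) x) + (\<Sum>k\<in>UNIV. ?b k x * pderiv_at k f x)
    = laplacian G f x + \<eta> * grad_prod G f f x"
    by (simp add: laplacian_def hess_def grad_prod_def right_diff_distrib left_diff_distrib sum_subtractf
        sum_distrib_left mult_ac)
  then show "0 \<le> (\<Sum>i\<in>UNIV. \<Sum>j\<in>UNIV. ?A i j x * pderiv_at i (pderiv_at j f) x) + (\<Sum>k\<in>UNIV. ?b k x * pderiv_at k f x)"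
    using L[OF x] by simp
qed

end

text \<open>Continuity is checked chart by chart, the chart domains being an open cover. It provides
  extrema on compact manifolds and closed level sets.\<close>

lemma (in smooth_mf) continuous_map_smooth_fun:
  assumes "smooth_fun M f"
  shows "continuous_map (mtop M) euclidean f"
  unfolding continuous_map_def
proof (intro conjI allI impI)
  fix S :: "real set" assume "openin euclidean S"
  then have S: "open S"
    by simp
  have "openin (mtop M) {p \<in> chart_dom c. f p \<in> S}" if c: "c \<in> atlas M" for c
  proof -
    have "continuous_on (chart_img c) (f \<circ> chart_inv c)"
      using smooth_fun_chart[OF assms c] unfolding smooth_on_def by (metis Ck_on.simps(1))
    then have "open (chart_img c \<inter> (f \<circ> chart_inv c) -` S)"
      using continuous_open_preimage[OF _ chart_open(2)[OF c] S] by blast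
    from openin_chart_preimage[OF c this]
    have "openin (mtop M) {p \<in> chart_dom c. chart_map c p \<in> chart_img c \<inter> (f \<circ> chart_inv c) -` S}" .
    moreover have "{p \<in> chart_dom c. chart_map c p \<in> chart_img c \<inter> (f \<circ> chart_inv c) -` S} = {p \<in> chart_dom c. f p \<in> S}"
      using chart_inv_map[OF c] chart_map_in_img by auto
    ultimately show ?thesis
      by simp
  qed
  then have "openin (mtop M) (\<Union>c\<in>atlas M. {p \<in> chart_dom c. f p \<in> S})"
    by (intro openin_Union) auto
  moreover have "(\<Union>c\<in>atlas M. {p \<in> chart_dom c. f p \<in> S}) = {p \<in> points M. f p \<in> S}"
    using chart_exists chart_dom_subset by blast
  ultimately show "openin (mtop M) {p \<in> points M. f p \<in> S}"
    by simp
qed auto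

section \<open>The Einstein equation on the warped product\<close>

locale warped_mf = product_metric_mf B F gB gF
  for B :: "('p, 'm::finite) manifold" and F :: "('q, 'k::finite) manifold" and gB gF +
  fixes \<mu> :: real and \<psi> :: "'p \<Rightarrow> real"
  assumes psi_smooth: "smooth_fun B \<psi>" and psi_pos: "\<And>p. p \<in> points B \<Longrightarrow> \<psi> p > 0"
begin

abbreviation "GB \<equiv> components B gB"
abbreviation "GF \<equiv> components F gF"
abbreviation "W c d \<equiv> components BF (bcwp_metric B gB F gF \<mu> \<psi>) (prod_chart c d)"

definition ln_psi :: "('p, 'm) chart \<Rightarrow> real^'m \<Rightarrow> real" where
  "ln_psi c x = ln (\<psi> (chart_inv c x))"

lemma inv_in_points: "c \<in> atlas B \<Longrightarrow> x \<in> chart_img c \<Longrightarrow> chart_inv c x \<in> points B"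
  using B.chart_inv_in_dom B.chart_dom_subset by blast

lemma psi_chart_pos: "c \<in> atlas B \<Longrightarrow> x \<in> chart_img c \<Longrightarrow> \<psi> (chart_inv c x) > 0"
  using inv_in_points psi_pos by blast

lemma ln_psi_twice_diff:
  assumes c: "c \<in> atlas B"
  shows "twice_diff_on (chart_img c) (ln_psi c)"
  unfolding ln_psi_def[abs_def]
  using twice_diff_on_smooth[OF B.smooth_fun_chart[OF psi_smooth c]] psi_chart_pos[OF c]
  by (intro twice_diff_on_ln B.chart_open(2)[OF c]) (auto simp: comp_def)

lemma W_eq:
  assumes "c \<in> atlas B" "d \<in> atlas F" "x \<in> chart_img c" "y \<in> chart_img d"
  shows "W c d (join_vec x y)
    = block_diag (exp (2 * (\<mu> * ln_psi c x)) *\<^sub>R GB c x) (exp (2 * ln_psi c x) *\<^sub>R GF d y)"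
  unfolding ln_psi_def by (rule components_bcwp[where \<psi> = \<psi>, OF assms psi_chart_pos[OF assms(1,3)]])

lemma ln_psi_eq_iff:
  assumes "c \<in> atlas B" "x \<in> chart_img c" "p \<in> points B"
  shows "ln_psi c x = ln (\<psi> p) \<longleftrightarrow> \<psi> (chart_inv c x) = \<psi> p"
    "ln_psi c x \<le> ln (\<psi> p) \<longleftrightarrow> \<psi> (chart_inv c x) \<le> \<psi> p"
    "ln (\<psi> p) \<le> ln_psi c x \<longleftrightarrow> \<psi> p \<le> \<psi> (chart_inv c x)"
  using psi_chart_pos[OF assms(1,2)] psi_pos[OF assms(3)] by (simp_all add: ln_psi_def)

lemma einstein_prod_iff:
  "einstein BF (bcwp_metric B gB F gF \<mu> \<psi>) (\<lambda>_. lam) \<longleftrightarrow>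
    (\<forall>c\<in>atlas B. \<forall>d\<in>atlas F. \<forall>x\<in>chart_img c. \<forall>y\<in>chart_img d.
      ricci_coord (W c d) (join_vec x y) = lam *\<^sub>R W c d (join_vec x y))"
proof -
  have "smooth_fun BF (\<lambda>_. lam)"
    by (simp add: smooth_fun_on_def comp_def smooth_on_const)
  moreover have "(\<forall>z\<in>prod_set U V. P z) \<longleftrightarrow> (\<forall>x\<in>U. \<forall>y\<in>V. P (join_vec x y))"
    for U :: "(real^'m) set" and V :: "(real^'k) set" and P
    by (metis (mono_tags, lifting) join_fst_snd_vec join_in_prod_set)
  moreover have "(\<forall>e\<in>atlas BF. P e) \<longleftrightarrow> (\<forall>c\<in>atlas B. \<forall>d\<in>atlas F. P (prod_chart c d))" for P
    by (auto simp: prod_manifold_def)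
  ultimately show ?thesis
    by (simp add: einstein_def chart_img_prod)
qed

text \<open>All derivatives of \<open>ln_psi\<close> vanish, so the correction terms of the warped
  formulas do; constant rescaling of either factor leaves its Ricci tensor unchanged.\<close>

lemma ricci_W_const:
  assumes const: "\<And>p. p \<in> points B \<Longrightarrow> \<psi> p = a"
    and c: "c \<in> atlas B" and d: "d \<in> atlas F" and x: "x \<in> chart_img c" and y: "y \<in> chart_img d"
  shows "ricci_coord (W c d) (join_vec x y) = block_diag (ricci_coord (GB c) x) (ricci_coord (GF d) y)"
proof -
  have "ln_psi c x = ln a" if "x \<in> chart_img c" for x
    using const[OF inv_in_points[OF c that]] by (simp add: ln_psi_def)
  note lc = pderiv_at_locally_const[OF B.chart_open(2)[OF c] x this] hess_locally_const[OF B.chart_open(2)[OF c] x this]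
    laplacian_locally_const[OF B.chart_open(2)[OF c] x this]
  note w = B.components_metric_on[OF c] F.components_metric_on[OF d] ln_psi_twice_diff[OF c] W_eq[OF c d]
  show ?thesis
    unfolding vec_eq_iff split_sum_all
    using warped_ricci_base_critical[OF w x y lc(1)] warped_ricci_mixed[OF w x y] warped_ricci_fiber[OF w x y]
    by (simp add: lc laplacian_at_critical(2)[OF lc(1)])
qed

lemma block_diag_eq_0_iff: "block_diag A C = 0 \<longleftrightarrow> A = 0 \<and> C = 0"
  unfolding vec_eq_iff split_sum_all by simp

text \<open>The two diagonal blocks depend on one factor each. Since both factors are nonempty, a
  point of one can be held fixed to read off the equation on the other.\<close>

lemma einstein_prod_const_iff:
  assumes const: "\<And>p. p \<in> points B \<Longrightarrow> \<psi> p = a"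
  shows "einstein BF (bcwp_metric B gB F gF \<mu> \<psi>) (\<lambda>_. 0) \<longleftrightarrow> ricci_flat B gB \<and> einstein F gF (\<lambda>_. 0)"
proof -
  have "smooth_fun F (\<lambda>_. 0)"
    by (simp add: smooth_fun_on_def comp_def smooth_on_const)
  moreover have "\<exists>c\<in>atlas B. \<exists>x. x \<in> chart_img c" "\<exists>d\<in>atlas F. \<exists>y. y \<in> chart_img d"
    using B.mf F.mf B.chart_exists F.chart_exists B.chart_map_in_img F.chart_map_in_img
    unfolding smooth_manifold_def by (metis ex_in_conv)+
  ultimately show ?thesis
    unfolding einstein_prod_iff by (auto simp: ricci_W_const[OF const] block_diag_eq_0_iff einstein_def ricci_flat_def)
qed

text \<open>The left-hand side involves only \<open>F\<close> and the right-hand factor only \<open>B\<close>.\<close>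

lemma einstein_prod_fiber:
  assumes E: "einstein BF (bcwp_metric B gB F gF \<mu> \<psi>) (\<lambda>_. lam)"
    and c: "c \<in> atlas B" and d: "d \<in> atlas F" and x: "x \<in> chart_img c" and y: "y \<in> chart_img d"
  shows "ricci_coord (GF d) y $ i $ j = (lam * exp (2 * ln_psi c x) + exp (- (2 * ((\<mu> - 1) * ln_psi c x))) *
    (laplacian (GB c) (ln_psi c) x + ((real CARD('m) - 2) * \<mu> + real CARD('k)) * grad_prod (GB c) (ln_psi c) (ln_psi c) x)) * GF d y $ i $ j"
proof -
  note w = B.components_metric_on[OF c] F.components_metric_on[OF d] ln_psi_twice_diff[OF c] W_eq[OF c d]
  have "ricci_coord (W c d) (join_vec x y) $ Inr i $ Inr j = lam * (exp (2 * ln_psi c x) * GF d y $ i $ j)"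
    using E c d x y by (simp add: einstein_prod_iff W_eq)
  then show ?thesis
    using warped_ricci_fiber[OF w x y, of i j] by (simp add: algebra_simps)
qed

text \<open>Contraction of the base block with the inverse metric: the Ricci term becomes the scalar
  curvature of \<open>B\<close>, the Hessian becomes the Laplacian, and the metric becomes the
  dimension.\<close>

lemma einstein_prod_base_trace:
  assumes E: "einstein BF (bcwp_metric B gB F gF \<mu> \<psi>) (\<lambda>_. lam)" and S: "scalar_flat B gB"
    and c: "c \<in> atlas B" and d: "d \<in> atlas F" and x: "x \<in> chart_img c" and y: "y \<in> chart_img d"
    and crit: "\<And>i. pderiv_at i (ln_psi c) x = 0"
  shows "- (((real CARD('m) - 2) * \<mu> + real CARD('k)) + real CARD('m) * \<mu>) * laplacian (GB c) (ln_psi c) x = real CARD('m) * lam * exp (2 * (\<mu> * ln_psi c x))"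
proof -
  note w = B.components_metric_on[OF c] F.components_metric_on[OF d] ln_psi_twice_diff[OF c] W_eq[OF c d]
  let ?i = "\<lambda>i j. matrix_inv (GB c x) $ i $ j" and ?h = "\<lambda>i j. hess (GB c) (ln_psi c) i j x"
  let ?l = "laplacian (GB c) (ln_psi c) x" and ?e = "exp (2 * (\<mu> * ln_psi c x))"
  note m = metric_onD[OF w(1) x]
  have eq: "ricci_coord (GB c) x $ i $ j = ((real CARD('m) - 2) * \<mu> + real CARD('k)) * ?h j i + (\<mu> * ?l + lam * ?e) * GB c x $ j $ i" for i j
  proof -
    have "ricci_coord (W c d) (join_vec x y) $ Inl i $ Inl j = lam * (?e * GB c x $ i $ j)"
      using E c d x y by (simp add: einstein_prod_iff W_eq)
    then show ?thesis
      using warped_ricci_base_critical[OF w x y crit, of i j] m(3)[of j i] by (simp add: algebra_simps)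
  qed
  have "0 = (\<Sum>i\<in>UNIV. \<Sum>j\<in>UNIV. ?i i j * ricci_coord (GB c) x $ i $ j)"
    using S c x by (simp add: scalar_flat_def scalar_coord_def)
  also have "\<dots> = ((real CARD('m) - 2) * \<mu> + real CARD('k)) * (\<Sum>i\<in>UNIV. \<Sum>j\<in>UNIV. ?i i j * ?h j i) + (\<mu> * ?l + lam * ?e) * (\<Sum>i\<in>UNIV. \<Sum>j\<in>UNIV. ?i i j * GB c x $ j $ i)"
    unfolding eq sum_distrib_left sum.distrib[symmetric]
    by (intro sum.cong refl) (simp add: algebra_simps)
  also have "(\<Sum>i\<in>UNIV. \<Sum>j\<in>UNIV. ?i i j * ?h j i) = ?l"
    unfolding laplacian_def by (subst sum.swap, intro sum.cong refl) (simp add: m(4))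
  also have "(\<Sum>i\<in>UNIV. \<Sum>j\<in>UNIV. ?i i j * GB c x $ j $ i) = real CARD('m)"
    by (simp add: m(6))
  finally show ?thesis
    by (simp add: algebra_simps)
qed

theorem einstein_prod_imp_const:
  assumes E: "einstein BF (bcwp_metric B gB F gF \<mu> \<psi>) (\<lambda>_. lam)" and S: "scalar_flat B gB"
    and R: "riemannian B gB" and K: "compact_space (mtop B)"
  shows "lam = 0 \<and> (\<exists>a>0. \<forall>p\<in>points B. \<psi> p = a)"
proof -
  obtain q where "q \<in> points F"
    using F.mf unfolding smooth_manifold_def by blast
  then obtain d y where d: "d \<in> atlas F" and y: "y \<in> chart_img d"
    using F.chart_exists F.chart_map_in_img by metis
  \<comment> \<open>The candidate for the separation constant, as a function of the base
    point.\<close>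
  define N where "N c x = lam * exp (2 * ln_psi c x) + exp (- (2 * ((\<mu> - 1) * ln_psi c x))) *
    (laplacian (GB c) (ln_psi c) x + ((real CARD('m) - 2) * \<mu> + real CARD('k)) * grad_prod (GB c) (ln_psi c) (ln_psi c) x)" for c x
  note pos = riemannian_components_pos[OF R]
  note mB = B.components_metric_on
  \<comment> \<open>One nonzero entry of the fibre metric suffices to cancel it from the fibre
    equation over two different base points.\<close>
  have "GF d y \<noteq> 0"
    using metric_onD(5)[OF F.components_metric_on[OF d] y, of undefined undefined] by auto
  then obtain i j where "GF d y $ i $ j \<noteq> 0"
    by (auto simp: vec_eq_iff)
  then have N_const: "N c x = N c' x'"
    if "c \<in> atlas B" "x \<in> chart_img c" "c' \<in> atlas B" "x' \<in> chart_img c'" for c x c' x'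
    using einstein_prod_fiber[OF E that(1) d that(2) y, of i j] einstein_prod_fiber[OF E that(3) d that(4) y, of i j]
    unfolding N_def by (metis mult_right_cancel)
  have "compact (\<psi> ` points B)"
    using image_compactin[OF _ B.continuous_map_smooth_fun[OF psi_smooth]] K
    by (simp add: compact_space_def)
  moreover have "\<psi> ` points B \<noteq> {}"
    using B.mf by (simp add: smooth_manifold_def)
  ultimately obtain p1 p0 where p1: "p1 \<in> points B" "\<And>p. p \<in> points B \<Longrightarrow> \<psi> p \<le> \<psi> p1"
    and p0: "p0 \<in> points B" "\<And>p. p \<in> points B \<Longrightarrow> \<psi> p0 \<le> \<psi> p"
    using compact_attains_sup[of "\<psi> ` points B"] compact_attains_inf[of "\<psi> ` points B"] by auto
  obtain c1 where c1: "c1 \<in> atlas B" "p1 \<in> chart_dom c1"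
    using B.chart_exists[OF p1(1)] by blast
  obtain c0 where c0: "c0 \<in> atlas B" "p0 \<in> chart_dom c0"
    using B.chart_exists[OF p0(1)] by blast
  define x1 where "x1 = chart_map c1 p1"
  define x0 where "x0 = chart_map c0 p0"
  have x1: "x1 \<in> chart_img c1" and x0: "x0 \<in> chart_img c0"
    using c1 c0 by (auto simp: x1_def x0_def B.chart_map_in_img)
  have l1: "ln_psi c1 x1 = ln (\<psi> p1)" and l0: "ln_psi c0 x0 = ln (\<psi> p0)"
    using c1 c0 by (simp_all add: ln_psi_def x1_def x0_def B.chart_inv_map)
  have max: "ln_psi c x \<le> ln (\<psi> p1)" and min: "ln (\<psi> p0) \<le> ln_psi c x" if "c \<in> atlas B" "x \<in> chart_img c" for c x
    using ln_psi_eq_iff[OF that] p1 p0 inv_in_points[OF that] by blast+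
  let ?l1 = "laplacian (GB c1) (ln_psi c1) x1" and ?l0 = "laplacian (GB c0) (ln_psi c0) x0"
  have at1: "pderiv_at i (ln_psi c1) x1 = 0" "?l1 \<le> 0" for i
    using laplacian_nonpos_at_max[OF mB[OF c1(1)] pos[OF c1(1)] ln_psi_twice_diff[OF c1(1)] x1]
      max[OF c1(1)] l1 by auto
  have at0: "pderiv_at i (ln_psi c0) x0 = 0" "0 \<le> ?l0" for i
    using laplacian_nonneg_at_min[OF mB[OF c0(1)] pos[OF c0(1)] ln_psi_twice_diff[OF c0(1)] x0]
      min[OF c0(1)] l0 by auto
  define e where "e = ((real CARD('m) - 2) * \<mu> + real CARD('k)) + real CARD('m) * \<mu>"
  define m1 where "m1 = real CARD('m) * exp (2 * (\<mu> * ln_psi c1 x1))"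
  define m0 where "m0 = real CARD('m) * exp (2 * (\<mu> * ln_psi c0 x0))"
  have "m1 > 0" "m0 > 0"
    by (simp_all add: m1_def m0_def)
  have "- e * ?l1 = lam * m1" "- e * ?l0 = lam * m0"
    using einstein_prod_base_trace[OF E S c1(1) d x1 y at1(1)] einstein_prod_base_trace[OF E S c0(1) d x0 y at0(1)]
    by (simp_all add: e_def m1_def m0_def)
  \<comment> \<open>Multiplying the two equations squares \<open>lam\<close> and \<open>e\<close>,
    while the Laplacians at the maximum and the minimum have a nonpositive product.\<close>
  then have "(lam * m1) * (lam * m0) = (- e * ?l1) * (- e * ?l0)"
    by (simp only:)
  then have "lam\<^sup>2 * (m1 * m0) = e\<^sup>2 * (?l1 * ?l0)"
    by (simp add: power2_eq_square mult_ac)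
  also have "\<dots> \<le> 0"
    using at1(2) at0(2) by (intro mult_nonneg_nonpos mult_nonpos_nonneg) auto
  finally have lam: "lam = 0"
    using \<open>m1 > 0\<close> \<open>m0 > 0\<close> by (simp add: mult_le_0_iff)
  \<comment> \<open>With \<open>lam = 0\<close> and vanishing gradient only the Laplacian is left in
    \<open>N\<close>, up to a positive factor; constancy of \<open>N\<close> then forces it to be
    0.\<close>
  have "N c1 x1 \<le> 0" "0 \<le> N c0 x0"
    using at1(2) at0(2) by (simp_all add: N_def lam laplacian_at_critical(2)[OF at1(1)] laplacian_at_critical(2)[OF at0(1)]
        mult_nonneg_nonpos)
  then have "N c1 x1 = 0"
    using N_const[OF c1(1) x1 c0(1) x0] by simp
  then have L: "0 \<le> laplacian (GB c) (ln_psi c) x + ((real CARD('m) - 2) * \<mu> + real CARD('k)) * grad_prod (GB c) (ln_psi c) (ln_psi c) x"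
    if "c \<in> atlas B" "x \<in> chart_img c" for c x
    using N_const[OF that c1(1) x1] by (simp add: N_def lam)
  \<comment> \<open>The set where the maximum is attained will be both open and closed. The
    singleton presents it as the preimage of a closed set.\<close>
  define Z where "Z = {p \<in> points B. \<psi> p \<in> {\<psi> p1}}"
  have "closedin (mtop B) Z"
    unfolding Z_def by (rule closedin_continuous_map_preimage[OF B.continuous_map_smooth_fun[OF psi_smooth]]) simp
  moreover have "openin (mtop B) Z"
  proof (subst openin_subopen, intro ballI)
    fix p assume "p \<in> Z"
    then have p: "p \<in> points B" "\<psi> p = \<psi> p1"
      by (auto simp: Z_def)
    obtain c where c: "c \<in> atlas B" "p \<in> chart_dom c"
      using B.chart_exists[OF p(1)] by blast
    have x: "chart_map c p \<in> chart_img c" and v: "ln_psi c (chart_map c p) = ln (\<psi> p1)"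
      using c p by (simp_all add: B.chart_map_in_img ln_psi_def B.chart_inv_map)
    obtain r where r: "r > 0" "ball (chart_map c p) r \<subseteq> chart_img c"
      "\<And>z. z \<in> ball (chart_map c p) r \<Longrightarrow> ln_psi c z = ln (\<psi> p1)"
      using laplacian_strong_maximum[OF mB[OF c(1)] pos[OF c(1)] ln_psi_twice_diff[OF c(1)] L[OF c(1)]
          max[OF c(1)] x v] by blast
    let ?T = "{q \<in> chart_dom c. chart_map c q \<in> ball (chart_map c p) r}"
    have "?T \<subseteq> Z"
    proof
      fix q assume q: "q \<in> ?T"
      then have "ln_psi c (chart_map c q) = ln (\<psi> p1)"
        using r(3) by blast
      then have "\<psi> q = \<psi> p1"
        using ln_psi_eq_iff(1)[OF c(1) _ p1(1)] q c(1) by (simp add: B.chart_map_in_img B.chart_inv_map)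
      then show "q \<in> Z"
        using q B.chart_dom_subset[OF c(1)] by (auto simp: Z_def)
    qed
    moreover have "openin (mtop B) ?T"
      by (rule B.openin_chart_preimage[OF c(1) open_ball])
    moreover have "p \<in> ?T"
      using c r by simp
    ultimately show "\<exists>T. openin (mtop B) T \<and> p \<in> T \<and> T \<subseteq> Z"
      by blast
  qed
  moreover have "connected_space (mtop B)"
    using B.mf by (simp add: smooth_manifold_def)
  moreover have "Z \<noteq> {}"
    using p1 by (auto simp: Z_def)
  ultimately have "Z = points B"
    unfolding connected_space_clopen_in by blast
  then have "\<forall>p\<in>points B. \<psi> p = \<psi> p1"
    by (auto simp: Z_def)
  then show ?thesis
    using lam psi_pos[OF p1(1)] by blast
qed

end

theorem mainTheorem6:
  fixes B :: "('p, 'm::finite) manifold" and gB :: "'p tensor2"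
    and F :: "('q, 'k::finite) manifold" and gF :: "'q tensor2"
    and \<mu> lam :: real and \<psi> :: "'p \<Rightarrow> real"
  assumes "riemannian B gB" and "compact_space (mtop B)" and "scalar_flat B gB"
    and "pseudo_riemannian F gF"
    and "\<mu> \<notin> {0, 1, real CARD('k), mubar_plus CARD('m) CARD('k), mubar_minus CARD('m) CARD('k)}"
    and "smooth_fun B \<psi>" and "\<forall>p\<in>points B. \<psi> p > 0"
  shows "einstein (prod_manifold B F) (bcwp_metric B gB F gF \<mu> \<psi>) (\<lambda>_. lam) \<longleftrightarrow>
         einstein F gF (\<lambda>_. 0) \<and> lam = 0 \<and> (\<exists>a>0. \<forall>p\<in>points B. \<psi> p = a) \<and> ricci_flat B gB"
proof -
  interpret warped_mf B F gB gF \<mu> \<psi>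
    using assms by unfold_locales (auto simp: riemannian_def pseudo_riemannian_def)
  \<comment> \<open>The Einstein equation forces \<open>lam = 0\<close> and constant
    \<open>\<psi>\<close>; under these two conditions \<open>einstein_prod_const_iff\<close> settles
    both directions.\<close>
  show ?thesis
    using einstein_prod_imp_const[OF _ assms(3,1,2)] einstein_prod_const_iff by blast
qed

end
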